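(* Let $A\subset\mathbb{R}^m$ be a finite set whose convex hull $P=\mathrm{conv}(A)$ has dimension $m$, let $\alpha_a>0$ for $a\in A$, and let $\mathcal{E}(x)=\sum_{a\in A}\xi_a\alpha_a e^{\langle a,x\rangle}$, $x\in\mathbb{R}^m$, with $(\xi_a)_{a\in A}$ i.i.d. standard real Gaussian variables. Let $\Phi(x)=\frac12\log\big(\mathbb{E}[\mathcal{E}(x)^2]\big)$ and let $\Phi^*$ be its Legendre transform. Then $$\mathbb{E}\mathbb{S}\{\mathcal{E};\mathbb{R}^m\}=\frac{1}{2^{\frac{m-2}{2}}s_m}\,\mathrm{vol}_g(P),$$ where $s_m$ is the Euclidean ($m$-dimensional) volume of the unit sphere $S^m\subset\mathbb{R}^{m+1}$ and $\mathrm{vol}_g$ is the Riemannian volume for the metric $g_p:=D^2_p\Phi^*$ given by the Hessian of $\Phi^*$ (on the interior of $P$).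
   Context: $\mathbb{E}\mathbb{S}\{\mathcal{E};U\}$ denotes the expected number (in $[0,\infty]$) of points $x\in U$ with $\mathcal{E}_1(x)=\dots=\mathcal{E}_m(x)=0$, where $\mathcal{E}_1,\dots,\mathcal{E}_m$ are i.i.d. copies of $\mathcal{E}$. Explicitly $\Phi(x)=\frac12\log\sum_{a\in A}\alpha_a^2e^{2\langle a,x\rangle}$. The Legendre transform is $\Phi^*(p)=\sup\{\langle p,x\rangle-\Phi(x)\mid x\in\mathbb{R}^m\}$; it is a smooth strictly convex function on $\mathrm{int}(P)$. The Riemannian volume is $\mathrm{vol}_g(P)=\int_{\mathrm{int}(P)}\sqrt{\det D^2_p\Phi^*}\,dp$. *)

theory Defs
  imports "HOL-Probability.Probability"
begin

text \<open>
  The i.i.d. copies of a random function \<open>F\<close> on the probability space \<open>M\<close> are realised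
  canonically: on the product of copies of \<open>M\<close> indexed by \<open>'m\<close>, the \<open>i\<close>-th copy is
  \<open>F (\<omega> i)\<close>, which depends on the \<open>i\<close>-th factor only.  There are as many copies as
  coordinates.  Counting measure makes the number of common zeros (and hence the expectation)
  \<open>\<infinity>\<close>-valued instead of \<open>0\<close> when there are infinitely many of them.
\<close>

definition expected_zeros ::
    "'w measure \<Rightarrow> ('w \<Rightarrow> real ^ 'm \<Rightarrow> real) \<Rightarrow> (real ^ 'm) set \<Rightarrow> ennreal" where
  "expected_zeros M F U =
     (\<integral>\<^sup>+ \<omega>. emeasure (count_space UNIV) {x \<in> U. \<forall>i::'m. F (\<omega> i) x = 0}
        \<partial>(Pi\<^sub>M UNIV (\<lambda>_::'m. M)))"

text \<open>
  The supremum is taken in the reals, so the value is meaningful only at points \<open>p\<close>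
  where the affine perturbations are bounded above.  For a log-sum-exp function with frequencies
  in \<open>A\<close> these are exactly the points of \<open>convex hull A\<close>.
\<close>

definition legendre :: "('a::real_inner \<Rightarrow> real) \<Rightarrow> 'a \<Rightarrow> real" where
  "legendre f p = (SUP x. p \<bullet> x - f x)"

definition hessian :: "(real ^ 'm \<Rightarrow> real) \<Rightarrow> real ^ 'm \<Rightarrow> real ^ 'm ^ 'm" where
  "hessian f p =
     (\<chi> i j. frechet_derivative (\<lambda>q. frechet_derivative f (at q) (axis j 1)) (at p) (axis i 1))"

text \<open>The metric is given by its Gram matrix in the standard coordinates.\<close>

definition riemannian_volume :: "(real ^ 'm \<Rightarrow> real ^ 'm ^ 'm) \<Rightarrow> (real ^ 'm) set \<Rightarrow> ennreal" where
  "riemannian_volume g U = (\<integral>\<^sup>+ p \<in> U. ennreal (sqrt (det (g p))) \<partial>lborel)"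

text \<open>
  The \<open>(n-1)\<close>-dimensional Euclidean volume of a compact hypersurface in an
  \<open>n\<close>-dimensional space, as its Minkowski content: half the rate of growth of the volume
  of its \<open>\<epsilon>\<close>-neighbourhoods.
\<close>

definition hypersurface_volume :: "'a::euclidean_space set \<Rightarrow> real" where
  "hypersurface_volume S =
     Lim (at_right 0) (\<lambda>\<epsilon>. measure lborel {x. infdist x S < \<epsilon>} / (2 * \<epsilon>))"

lemma infdist_unit_sphere:
  fixes x :: "'a::euclidean_space"
  shows "infdist x (sphere 0 1) = \<bar>norm x - 1\<bar>"
proof (rule antisym)
  obtain u :: 'a where u: "norm u = 1" "x = norm x *\<^sub>R u"
  proof (cases "x = 0")
    case True
    obtain b :: 'a where "b \<in> Basis" using nonempty_Basis by blast
    with True show ?thesis by (intro that[of b]) auto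
  next
    case False
    then show ?thesis by (intro that[of "x /\<^sub>R norm x"]) auto
  qed
  have "x - u = (norm x - 1) *\<^sub>R u"
    using u(2) by (metis scaleR_left_diff_distrib scaleR_one)
  then have "dist x u = \<bar>norm x - 1\<bar>"
    using u(1) by (simp add: dist_norm)
  then show "infdist x (sphere 0 1) \<le> \<bar>norm x - 1\<bar>"
    using u(1) infdist_le[of u "sphere 0 1" x] by simp
  have "\<bar>norm x - 1\<bar> \<le> dist x y" if "y \<in> sphere 0 1" for y
    using that norm_triangle_ineq3[of x y] by (simp add: dist_norm)
  moreover have "sphere (0::'a) 1 \<noteq> {}"
    using u(1) by auto
  ultimately show "\<bar>norm x - 1\<bar> \<le> infdist x (sphere 0 1)"
    unfolding infdist_def by (auto intro!: cINF_greatest)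
qed

lemma hypersurface_volume_unit_sphere:
  "hypersurface_volume (sphere (0::'a::euclidean_space) 1) =
     real DIM('a) * unit_ball_vol (real DIM('a))"
proof -
  define n where "n = DIM('a)"
  define c where "c = unit_ball_vol (real n)"
  have shell: "measure lborel {x::'a. infdist x (sphere 0 1) < e} =
      c * (1 + e) ^ n - c * (1 - e) ^ n" if "0 < e" "e < 1" for e
  proof -
    have eq: "{x::'a. infdist x (sphere 0 1) < e} = ball 0 (1 + e) - cball 0 (1 - e)"
      using that by (auto simp: infdist_unit_sphere)
    have "measure lborel (ball (0::'a) (1 + e) - cball 0 (1 - e)) =
        measure lborel (ball (0::'a) (1 + e)) - measure lborel (cball (0::'a) (1 - e))"
      using that by (intro measure_Diff) (auto simp: emeasure_ball)
    then show ?thesis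
      using that content_ball[of "1 + e" "0::'a"] content_cball[of "1 - e" "0::'a"]
      by (simp add: eq c_def n_def)
  qed
  have "((\<lambda>e. c * (1 + e) ^ n - c * (1 - e) ^ n) has_real_derivative 2 * (n * c)) (at 0)"
    by (auto intro!: derivative_eq_intros)
  then have "((\<lambda>e. (c * (1 + e) ^ n - c * (1 - e) ^ n) / e) \<longlongrightarrow> 2 * (n * c)) (at 0)"
    by (simp add: has_field_derivative_iff)
  then have "((\<lambda>e. (c * (1 + e) ^ n - c * (1 - e) ^ n) / e / 2) \<longlongrightarrow> 2 * (n * c) / 2) (at_right 0)"
    by (intro tendsto_divide tendsto_const) (auto simp: filterlim_at_split)
  moreover have "\<forall>\<^sub>F e in at_right (0::real). e < 1"
    unfolding eventually_at_right_field by (auto intro!: exI[of _ 1])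
  then have "\<forall>\<^sub>F e in at_right 0. (c * (1 + e) ^ n - c * (1 - e) ^ n) / e / 2 =
      measure lborel {x::'a. infdist x (sphere 0 1) < e} / (2 * e)"
    using eventually_at_right_less[of "0::real"]
    by eventually_elim (simp add: shell)
  ultimately have "((\<lambda>e. measure lborel {x::'a. infdist x (sphere 0 1) < e} / (2 * e))
      \<longlongrightarrow> n * c) (at_right 0)"
    by (subst (asm) tendsto_cong) auto
  then show ?thesis
    unfolding hypersurface_volume_def c_def n_def
    by (intro tendsto_Lim) auto
qed

end

(*
  Dividing by the term of one exponent a0, the system reads y = G(x), where y collects the m Gaussian
  coefficients of exp <a0, x> and G depends on the other coefficients. By Sard's theorem and the
  change of variables formula, the expected number of solutions is the integral over x of a Gaussian
  expectation of |det DG(x)| weighted by the density of y at G(x). Its rows are independent, and a row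
  has an explicit Gaussian density whose quadratic form is, up to scaling, the inverse of the
  covariance C(x) of the exponents under the weights (alpha_a exp <a, x>)^2 / Z(x). Hence the
  expectation is a constant, depending on m only, times sqrt (det C(x)).
  On the other side, the Hessian of Phi is 2 C(x), the gradient of Phi is a diffeomorphism from R^m
  onto the interior of P, and the Hessian of Phi* at the image of x is the inverse of 2 C(x). The
  substitution p = grad Phi(x) turns the Riemannian volume into the integral of sqrt (det (2 C(x))).
*)
theory Submission
  imports Defs
begin

text \<open>The value of an equation at a point and its gradient there share the random
  coefficients, so the mean of the determinant cannot be taken by itself: every row needs the joint
  density of value and derivative, restricted to value 0. As the number of exponents is arbitrary,
  that density is built from a basis of exponent differences by adding coefficients one at a time.
  Its normalising factor carries the variance of the value, the only trace of the chosen exponent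
  a0; it cancels at the end. The constant needs the mean of |det| for a Gaussian matrix. It comes
  from one double integral evaluated in both orders: one order cancels the determinant, the other
  leaves the multivariate Cauchy integral pi^((m+1)/2) / Gamma((m+1)/2), which is s_m / 2. Hence the
  density of zeros is (2 / s_m) sqrt (det C), and the factor 2 in the Hessian 2 C, worth 2^(m/2) in
  the volume, turns 2 / s_m into 1 / (2^((m-2)/2) s_m). Counts and integrals take values in
  [0, \<infinity>] throughout, so neither integrability nor nondegeneracy of zeros has to be
  shown.\<close>

subsection \<open>Measurability of the number of zeros\<close>

abbreviation (input) num_elems :: "'a set \<Rightarrow> ennreal" where
  "num_elems \<equiv> emeasure (count_space UNIV)"

text \<open>By compactness the norm of \<open>h \<omega>\<close> attains its minimum on
  \<open>K\<close>, so a zero exists iff the infimum is 0; by continuity the infimum may be taken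
  over a countable dense subset.\<close>

lemma measurable_zero_in_compact:
  fixes h :: "'w \<Rightarrow> 'a::euclidean_space \<Rightarrow> 'b::euclidean_space"
  assumes meas [measurable]: "\<And>x. (\<lambda>\<omega>. h \<omega> x) \<in> borel_measurable M"
    and cont: "\<And>\<omega>. continuous_on UNIV (h \<omega>)"
    and K: "compact K"
  shows "Measurable.pred M (\<lambda>\<omega>. \<exists>x\<in>K. h \<omega> x = 0)"
proof -
  obtain T where T: "countable T" "T \<subseteq> K" "K \<subseteq> closure T"
    using separable[of K] by blast
  have "(\<exists>x\<in>K. h \<omega> x = 0) \<longleftrightarrow> (\<forall>n. \<exists>x\<in>T. norm (h \<omega> x) < 1 / real (Suc n))" for \<omega>
  proof
    assume "\<exists>x\<in>K. h \<omega> x = 0"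
    then obtain x where x: "x \<in> K" "h \<omega> x = 0" by blast
    show "\<forall>n. \<exists>x\<in>T. norm (h \<omega> x) < 1 / real (Suc n)"
    proof
      fix n
      have "isCont (h \<omega>) x" using cont by (simp add: continuous_on_eq_continuous_at)
      then obtain d where d: "d > 0" "\<And>y. dist y x < d \<Longrightarrow> dist (h \<omega> y) (h \<omega> x) < 1 / real (Suc n)"
        unfolding continuous_at_eps_delta by (metis of_nat_0_less_iff zero_less_Suc zero_less_divide_1_iff)
      obtain y where "y \<in> T" "dist y x < d"
        using T(3) x(1) d(1) by (meson closure_approachable subsetD)
      then show "\<exists>x\<in>T. norm (h \<omega> x) < 1 / real (Suc n)"
        using d(2)[of y] x(2) by (auto simp: dist_norm)
    qed
  next
    assume *: "\<forall>n. \<exists>x\<in>T. norm (h \<omega> x) < 1 / real (Suc n)"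
    then have "K \<noteq> {}" using T(2) by blast
    moreover have "continuous_on K (\<lambda>x. norm (h \<omega> x))"
      by (intro continuous_intros continuous_on_subset[OF cont]) auto
    ultimately obtain x where x: "x \<in> K" "\<And>y. y \<in> K \<Longrightarrow> norm (h \<omega> x) \<le> norm (h \<omega> y)"
      using continuous_attains_inf[OF K] by blast
    have "h \<omega> x = 0"
    proof (rule ccontr)
      assume "h \<omega> x \<noteq> 0"
      then obtain n where n: "1 / real (Suc n) < norm (h \<omega> x)"
        using reals_Archimedean[of "norm (h \<omega> x)"] by (auto simp: inverse_eq_divide)
      from * obtain y where "y \<in> T" "norm (h \<omega> y) < 1 / real (Suc n)" by blast
      with x(2)[of y] T(2) n show False by force
    qed
    with x(1) show "\<exists>x\<in>K. h \<omega> x = 0" by blast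
  qed
  moreover have "Measurable.pred M (\<lambda>\<omega>. \<forall>n. \<exists>x\<in>T. norm (h \<omega> x) < 1 / real (Suc n))"
    unfolding pred_def
    by (intro sets.sets_Collect_countable_All sets.sets_Collect_countable_Ex' T(1)) measurable
  ultimately show ?thesis by (simp only:)
qed

lemma separated_by_small_balls:
  fixes Y :: "'a::euclidean_space set"
  assumes Y: "finite Y" and D: "\<And>X. open X \<Longrightarrow> X \<noteq> {} \<Longrightarrow> \<exists>d\<in>D. d \<in> X"
  obtains q n where "\<And>y. y \<in> Y \<Longrightarrow> q y \<in> D" "\<And>y. y \<in> Y \<Longrightarrow> y \<in> cball (q y) (1 / real (Suc n))"
    "\<And>y z. y \<in> Y \<Longrightarrow> z \<in> Y \<Longrightarrow> y \<noteq> z \<Longrightarrow> cball (q y) (1 / real (Suc n)) \<inter> cball (q z) (1 / real (Suc n)) = {}"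
proof -
  define P where "P = (\<lambda>(y,z). dist y z) ` {p \<in> Y \<times> Y. fst p \<noteq> snd p}"
  have fP: "finite P" using Y by (simp add: P_def)
  \<comment> \<open>The 1 keeps \<open>Min\<close> meaningful when \<open>Y\<close> has at most one
    point.\<close>
  define \<delta> where "\<delta> = Min (insert 1 P)"
  have \<delta>: "\<delta> > 0" using fP by (auto simp: \<delta>_def P_def)
  have \<delta>le: "\<delta> \<le> dist y z" if "y \<in> Y" "z \<in> Y" "y \<noteq> z" for y z
    unfolding \<delta>_def using fP that by (intro Min_le) (auto simp: P_def image_iff)
  \<comment> \<open>The quarter pays for four legs of length at most \<open>r\<close>: from
    \<open>y\<close> to its centre, to a common point of the balls, to the other centre, to
    \<open>z\<close>.\<close>
  obtain n where n: "1 / real (Suc n) < \<delta> / 4"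
    using reals_Archimedean[of "\<delta> / 4"] \<delta> by (auto simp: inverse_eq_divide)
  define r where "r = 1 / real (Suc n)"
  have r: "r > 0" by (simp add: r_def)
  have "\<exists>d\<in>D. d \<in> ball y r" for y using D[of "ball y r"] r by auto
  then obtain q where q: "\<And>y. q y \<in> D" "\<And>y. q y \<in> ball y r" by metis
  show thesis
  proof (rule that[of q n])
    show "y \<in> cball (q y) (1 / real (Suc n))" for y using q(2)[of y] by (simp add: r_def dist_commute)
    fix y z assume yz: "y \<in> Y" "z \<in> Y" "y \<noteq> z"
    have False if "w \<in> cball (q y) r" "w \<in> cball (q z) r" for w
    proof -
      have "dist y z \<le> dist y (q y) + dist (q y) z" "dist (q y) z \<le> dist (q y) w + dist w z"
        "dist w z \<le> dist w (q z) + dist (q z) z" by (rule dist_triangle)+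
      moreover have "dist (q y) w \<le> r" "dist w (q z) \<le> r" "dist y (q y) < r" "dist (q z) z < r"
        using that q(2)[of y] q(2)[of z] by (auto simp: dist_commute)
      moreover have "4 * r < \<delta>" using n by (simp add: r_def)
      ultimately show False using \<delta>le[OF yz] by linarith
    qed
    then show "cball (q y) (1 / real (Suc n)) \<inter> cball (q z) (1 / real (Suc n)) = {}"
      by (auto simp: r_def)
  qed (use q in auto)
qed

text \<open>
  The number of zeros is the supremum, over finite disjoint families of closed balls with centre in
  a countable dense set and radius \<open>1 / (n + 1)\<close>, of the number of balls that contain a zero.
\<close>

theorem measurable_card_zeros:
  fixes h :: "'w \<Rightarrow> 'a::euclidean_space \<Rightarrow> 'b::euclidean_space"
  assumes meas: "\<And>x. (\<lambda>\<omega>. h \<omega> x) \<in> borel_measurable M"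
    and cont: "\<And>\<omega>. continuous_on UNIV (h \<omega>)"
  shows "(\<lambda>\<omega>. num_elems {x. h \<omega> x = 0}) \<in> borel_measurable M"
proof -
  obtain D :: "'a set" where D: "countable D" "\<And>X. open X \<Longrightarrow> X \<noteq> {} \<Longrightarrow> \<exists>d\<in>D. d \<in> X"
    using countable_dense_setE by blast
  define \<K> where "\<K> = (\<lambda>(q,n). cball q (1 / real (Suc n))) ` (D \<times> (UNIV::nat set))"
  define \<F> where "\<F> = {F. F \<subseteq> \<K> \<and> finite F \<and> disjoint F}"
  define hit where "hit K \<omega> = (if \<exists>x\<in>K. h \<omega> x = 0 then 1 else 0 :: ennreal)" for K \<omega>
  let ?S = "\<lambda>\<omega>. SUP F\<in>\<F>. \<Sum>K\<in>F. hit K \<omega>"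
  have "countable \<K>" unfolding \<K>_def using D(1) by (intro countable_image countable_SIGMA) auto
  then have "countable {F. finite F \<and> F \<subseteq> \<K>}" by (rule countable_Collect_finite_subset)
  then have c\<F>: "countable \<F>" by (rule countable_subset[rotated]) (auto simp: \<F>_def)
  have [measurable]: "hit K \<in> borel_measurable M" if "K \<in> \<K>" for K
  proof -
    have "compact K" using that by (auto simp: \<K>_def)
    note measurable_zero_in_compact[OF meas cont this, measurable]
    show ?thesis unfolding hit_def by measurable
  qed
  have m: "(\<lambda>\<omega>. SUP F\<in>\<F>. \<Sum>K\<in>F. hit K \<omega>) \<in> borel_measurable M"
    using c\<F> by (rule borel_measurable_SUP) (auto simp: \<F>_def intro!: borel_measurable_sum)
  have "num_elems {x. h \<omega> x = 0} = ?S \<omega>" for \<omega>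
  proof (rule antisym)
    define Z where "Z = {x. h \<omega> x = 0}"
    \<comment> \<open>Finite subsets suffice: if \<open>Z\<close> is infinite, they push the
      supremum above every natural number, hence to \<open>\<top>\<close>.\<close>
    have fin: "of_nat (card Y) \<le> ?S \<omega>" if Y: "finite Y" "Y \<subseteq> Z" for Y
    proof -
      obtain q n where q: "\<And>y. y \<in> Y \<Longrightarrow> q y \<in> D" "\<And>y. y \<in> Y \<Longrightarrow> y \<in> cball (q y) (1 / real (Suc n))"
        "\<And>y z. y \<in> Y \<Longrightarrow> z \<in> Y \<Longrightarrow> y \<noteq> z \<Longrightarrow> cball (q y) (1 / real (Suc n)) \<inter> cball (q z) (1 / real (Suc n)) = {}"
        using separated_by_small_balls[OF Y(1) D(2)] by metis
      define B where "B y = cball (q y) (1 / real (Suc n))" for y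
      have inj: "inj_on B Y" using q unfolding B_def inj_on_def by blast
      have "disjoint (B ` Y)"
        using q(3) unfolding B_def disjoint_def by blast
      moreover have "B ` Y \<subseteq> \<K>"
        using q(1) by (auto simp: \<K>_def B_def)
      ultimately have "B ` Y \<in> \<F>"
        using Y(1) by (auto simp: \<F>_def)
      moreover have "(\<Sum>K\<in>B ` Y. hit K \<omega>) = of_nat (card Y)"
      proof -
        have "hit (B y) \<omega> = 1" if "y \<in> Y" for y
          using that q(2)[OF that] Y(2) by (auto simp: hit_def B_def Z_def)
        then show ?thesis by (simp add: sum.reindex[OF inj])
      qed
      ultimately show ?thesis by (metis SUP_upper)
    qed
    show "num_elems {x. h \<omega> x = 0} \<le> ?S \<omega>"
    proof (cases "finite Z")
      case True
      with fin[of Z] show ?thesis by (simp add: Z_def)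
    next
      case False
      have "of_nat n \<le> ?S \<omega>" for n
        using fin infinite_arbitrarily_large[OF False, of n] by metis
      then have "?S \<omega> = \<top>"
        by (metis ennreal_Ex_less_of_nat leD less_top)
      then show ?thesis by (simp only: top_greatest)
    qed
    \<comment> \<open>Choosing a zero in each ball that contains one is injective because the balls
      are disjoint.\<close>
    show "?S \<omega> \<le> num_elems {x. h \<omega> x = 0}"
    proof (rule SUP_least)
      fix F assume F: "F \<in> \<F>"
      then have fF: "finite F" and dF: "disjoint F" by (auto simp: \<F>_def)
      define F1 where "F1 = {K \<in> F. \<exists>x\<in>K. h \<omega> x = 0}"
      have "(\<Sum>K\<in>F. hit K \<omega>) = (\<Sum>K\<in>F1. 1)"
        by (rule sum.mono_neutral_cong_right) (use fF in \<open>auto simp: hit_def F1_def\<close>)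
      then have eq: "(\<Sum>K\<in>F. hit K \<omega>) = of_nat (card F1)" by simp
      have "\<forall>K\<in>F1. \<exists>x. x \<in> K \<and> h \<omega> x = 0" by (auto simp: F1_def)
      from bchoice[OF this] obtain z where z: "\<And>K. K \<in> F1 \<Longrightarrow> z K \<in> K" "\<And>K. K \<in> F1 \<Longrightarrow> h \<omega> (z K) = 0"
        by blast
      have inj: "inj_on z F1"
      proof (rule inj_onI)
        fix K L assume KL: "K \<in> F1" "L \<in> F1" "z K = z L"
        then have "z K \<in> K \<inter> L" using z(1)[of K] z(1)[of L] by simp
        then show "K = L" using dF KL(1,2) unfolding disjoint_def F1_def by blast
      qed
      have "of_nat (card F1) = num_elems (z ` F1)"
        using inj fF by (simp add: F1_def card_image)
      also have "\<dots> \<le> num_elems {x. h \<omega> x = 0}"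
        using z(2) by (intro emeasure_mono) auto
      finally show "(\<Sum>K\<in>F. hit K \<omega>) \<le> num_elems {x. h \<omega> x = 0}"
        by (simp only: eq)
    qed
  qed
  with m show ?thesis by (simp only:)
qed

subsection \<open>The area formula\<close>

text \<open>The push-forward of the weight \<open>\<bar>det (D x)\<bar>\<close> on \<open>S\<close>
  and Lebesgue measure on the image of \<open>S\<close> agree on all Borel sets, hence on
  \<open>\<phi>\<close>. The image side is stated for \<open>lebesgue\<close> because the argument
  only gives Lebesgue measurability of the image.\<close>

lemma nn_integral_change_of_variables_inj_wo:
  fixes G :: "real^'n::{finite,wellorder} \<Rightarrow> real^'n::_" and D :: "real^'n::_ \<Rightarrow> real^'n::_^'n::_"
  assumes S [measurable]: "S \<in> sets borel"
    and der: "\<And>x. (G has_derivative (\<lambda>h. D x *v h)) (at x)"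
    and inj: "inj_on G S"
    and det [measurable]: "(\<lambda>x. det (D x)) \<in> borel_measurable borel"
    and \<phi> [measurable]: "\<phi> \<in> borel_measurable borel"
  shows "G ` S \<in> sets lebesgue"
    and "(\<integral>\<^sup>+y. indicator (G ` S) y * \<phi> y \<partial>lebesgue) =
         (\<integral>\<^sup>+x. indicator S x * ennreal \<bar>det (D x)\<bar> * \<phi> (G x) \<partial>lborel)"
proof -
  have contG: "continuous_on UNIV G"
    using der by (meson continuous_at_imp_continuous_on has_derivative_continuous)
  then have [measurable]: "G \<in> borel_measurable borel"
    by (rule borel_measurable_continuous_onI)
  have derS: "(G has_derivative (\<lambda>h. D x *v h)) (at x within T)" for x T
    using der by (rule has_derivative_at_withinI)
  have img: "G ` T \<in> sets lebesgue" if "T \<in> sets borel" "T \<subseteq> S" for T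
    by (rule differentiable_image_in_sets_lebesgue)
       (use that derS in \<open>auto simp: differentiable_on_def differentiable_def\<close>)
  show imgS: "G ` S \<in> sets lebesgue"
    by (rule img) auto
  define M1 where "M1 = distr (density lborel (\<lambda>x. indicator S x * ennreal \<bar>det (D x)\<bar>)) borel G"
  define M2 where "M2 = distr (density lebesgue (indicator (G ` S))) (borel :: (real^'n::_) measure) (\<lambda>x. x)"
  have "M1 = M2"
  proof (rule measure_eqI)
    show "sets M1 = sets M2" by (simp add: M1_def M2_def)
    fix T assume "T \<in> sets M1"
    then have T [measurable]: "T \<in> sets borel" by (simp add: M1_def)
    define S' where "S' = S \<inter> G -` T"
    have S'[measurable]: "S' \<in> sets borel"
      using measurable_sets_borel[of G borel T] unfolding S'_def by auto
    have 1: "emeasure M1 T = (\<integral>\<^sup>+x. ennreal \<bar>det (D x)\<bar> * indicator S' x \<partial>lborel)"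
    proof -
      have "G -` T \<in> sets borel" using measurable_sets_borel[of G borel T] by auto
      then show ?thesis unfolding M1_def
        by (subst emeasure_distr) (auto simp: emeasure_density S'_def indicator_inter_arith ac_simps
            intro!: nn_integral_cong split: split_indicator)
    qed
    have GT: "G ` S' = G ` S \<inter> T" by (auto simp: S'_def)
    have 2: "emeasure M2 T = emeasure lebesgue (G ` S')"
    proof -
      have [measurable]: "G ` S \<in> sets lebesgue" "T \<in> sets lebesgue"
        using imgS T by auto
      have "(\<lambda>x. x) \<in> density lebesgue (indicator (G ` S)) \<rightarrow>\<^sub>M borel"
        by (simp add: measurable_completion)
      then have "emeasure M2 T = (\<integral>\<^sup>+x. indicator (G ` S) x * indicator T x \<partial>lebesgue)"
        unfolding M2_def
        by (subst emeasure_distr) (auto simp: emeasure_density)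
      also have "\<dots> = (\<integral>\<^sup>+x. indicator (G ` S') x \<partial>lebesgue)"
        unfolding GT by (intro nn_integral_cong) (auto split: split_indicator)
      also have "\<dots> = emeasure lebesgue (G ` S')"
        unfolding GT by (subst nn_integral_indicator) auto
      finally show ?thesis .
    qed
    have img': "G ` S' \<in> sets lebesgue" by (rule img) (auto simp: S'_def)
    have inj': "inj_on G S'" using inj by (rule inj_on_subset) (auto simp: S'_def)
    have hm: "G ` S' \<in> lmeasurable \<and> measure lebesgue (G ` S') = m \<longleftrightarrow>
      ((\<lambda>x. \<bar>det (D x)\<bar>) has_integral m) S'" for m
      using has_measure_differentiable_image[of S' G "\<lambda>x h. D x *v h" m] derS inj' S'
      by simp
    show "emeasure M1 T = emeasure M2 T"
    proof (cases "G ` S' \<in> lmeasurable")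
      case True
      define m where "m = measure lebesgue (G ` S')"
      have "((\<lambda>x. \<bar>det (D x)\<bar>) has_integral m) S'"
        using hm True m_def by blast
      from nn_integral_has_integral_lebesgue'[OF _ this]
      have "emeasure M1 T = ennreal m" unfolding 1 by simp
      moreover have "emeasure M2 T = ennreal m"
        unfolding 2 m_def using True by (rule emeasure_eq_measure2)
      ultimately show ?thesis by simp
    next
      \<comment> \<open>\<open>hm\<close> equates finite values only. A finite
        \<open>emeasure M1 T\<close> would by \<open>hm\<close> make the image
        \<open>lmeasurable\<close>, so both sides are infinite here.\<close>
      case False
      then have inf2: "emeasure M2 T = \<infinity>"
        unfolding 2 infinity_ennreal_def
        using img' by (metis (no_types, lifting) fmeasurableI top.not_eq_extremum infinity_ennreal_def)
      have "emeasure M1 T = \<infinity>"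
      proof (rule ccontr)
        assume fin: "emeasure M1 T \<noteq> \<infinity>"
        then obtain r where r: "emeasure M1 T = ennreal r" "r \<ge> 0"
          by (metis ennreal_cases infinity_ennreal_def)
        have "((\<lambda>x. indicator S' x * \<bar>det (D x)\<bar>) has_integral r) UNIV"
        proof (rule nn_integral_has_integral)
          show "(\<integral>\<^sup>+x. ennreal (indicator S' x * \<bar>det (D x)\<bar>) \<partial>lborel) = ennreal r"
            unfolding r(1)[symmetric] 1 by (intro nn_integral_cong) (auto split: split_indicator)
        qed (use r in auto)
        then have "((\<lambda>x. if x \<in> S' then \<bar>det (D x)\<bar> else 0) has_integral r) UNIV"
          by (rule has_integral_eq[rotated]) (auto simp: indicator_def)
        then have "((\<lambda>x. \<bar>det (D x)\<bar>) has_integral r) S'"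
          by (simp add: has_integral_restrict_UNIV)
        with hm False show False by blast
      qed
      with inf2 show ?thesis by simp
    qed
  qed
  then have "(\<integral>\<^sup>+y. \<phi> y \<partial>M1) = (\<integral>\<^sup>+y. \<phi> y \<partial>M2)" by simp
  moreover have "(\<integral>\<^sup>+y. \<phi> y \<partial>M1) = (\<integral>\<^sup>+x. indicator S x * ennreal \<bar>det (D x)\<bar> * \<phi> (G x) \<partial>lborel)"
    unfolding M1_def by (subst nn_integral_distr) (auto simp: nn_integral_density)
  moreover have "(\<integral>\<^sup>+y. \<phi> y \<partial>M2) = (\<integral>\<^sup>+y. indicator (G ` S) y * \<phi> y \<partial>lebesgue)"
  proof -
    have [measurable]: "G ` S \<in> sets lebesgue" by fact
    have m: "(\<lambda>x. x) \<in> density lebesgue (indicator (G ` S)) \<rightarrow>\<^sub>M borel"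
      by (simp add: measurable_completion)
    have "\<phi> \<in> borel_measurable lebesgue"
      by (simp add: measurable_completion)
    then show ?thesis unfolding M2_def by (subst nn_integral_distr[OF m]) (auto simp: nn_integral_density)
  qed
  ultimately show "(\<integral>\<^sup>+y. indicator (G ` S) y * \<phi> y \<partial>lebesgue) =
         (\<integral>\<^sup>+x. indicator S x * ennreal \<bar>det (D x)\<bar> * \<phi> (G x) \<partial>lborel)" by simp
qed


lemma locally_inj_of_det_nonzero:
  fixes G :: "real^'n \<Rightarrow> real^'n" and D :: "real^'n \<Rightarrow> real^'n^'n"
  assumes der: "\<And>x. (G has_derivative (\<lambda>h. D x *v h)) (at x)"
    and cont: "continuous_on UNIV D"
    and nz: "det (D a) \<noteq> 0"
  obtains r where "r > 0" "inj_on G (ball a r)"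
proof -
  obtain B where B: "B ** D a = mat 1"
    using nz by (auto simp: invertible_det_nz[symmetric] invertible_def)
  show thesis
  proof (rule has_derivative_locally_injective[of a UNIV "\<lambda>h. B *v h" "\<lambda>x h. D x *v h" G])
    show "(\<lambda>h. B *v h) \<circ> (\<lambda>h. D a *v h) = id"
      by (simp add: fun_eq_iff matrix_vector_mul_assoc B)
    show "\<exists>d>0. \<forall>x. dist a x < d \<longrightarrow> onorm (\<lambda>v. D x *v v - D a *v v) < e" if e: "e > 0" for e
    proof -
      \<comment> \<open>The operator norm is at most \<open>?K\<close> times a bound on the entries;
        the further factor 2 makes the final inequality strict.\<close>
      let ?K = "real CARD('n) * real CARD('n)"
      have K: "?K > 0" by simp
      have "isCont D a" using cont by (simp add: continuous_on_eq_continuous_at)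
      then obtain d where d: "d > 0" "\<And>x. dist x a < d \<Longrightarrow> dist (D x) (D a) < e / (2 * ?K)"
        using e K unfolding continuous_at_eps_delta by (metis divide_pos_pos mult_pos_pos zero_less_numeral)
      have "onorm (\<lambda>v. D x *v v - D a *v v) < e" if "dist a x < d" for x
      proof -
        have "\<bar>(D x - D a) $ i $ j\<bar> \<le> e / (2 * ?K)" for i j
        proof -
          have "\<bar>(D x - D a) $ i $ j\<bar> \<le> norm ((D x - D a) $ i)" by (rule component_le_norm_cart)
          also have "\<dots> \<le> norm (D x - D a)" by (rule Finite_Cartesian_Product.norm_nth_le)
          also have "\<dots> \<le> e / (2 * ?K)"
            using d(2)[of x] that by (simp add: dist_norm norm_minus_commute)
          finally show ?thesis .
        qed
        then have "onorm ((*v) (D x - D a)) \<le> ?K * (e / (2 * ?K))"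
          by (rule onorm_le_matrix_component)
        then have "onorm ((*v) (D x - D a)) < e" using e K by simp
        moreover have "(*v) (D x - D a) = (\<lambda>v. D x *v v - D a *v v)"
          by (simp add: fun_eq_iff matrix_vector_mult_diff_rdistrib)
        ultimately show ?thesis by simp
      qed
      with d(1) show ?thesis by blast
    qed
  qed (use der that in auto)
qed

lemma continuous_on_det:
  fixes D :: "'a::topological_space \<Rightarrow> real^'n^'n"
  assumes "continuous_on S D"
  shows "continuous_on S (\<lambda>x. det (D x))"
  unfolding det_def by (intro continuous_intros assms)

text \<open>Points with \<open>det (D x) = 0\<close> count on neither side: their image is null, and
  the integrand on the right vanishes. The rest is cut into countably many disjoint Borel pieces on
  which \<open>G\<close> is injective; the number of preimages of \<open>y\<close> is then the
  number of pieces whose image contains \<open>y\<close>.\<close>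

theorem area_formula_wo:
  fixes G :: "real^'n::{finite,wellorder} \<Rightarrow> real^'n::_" and D :: "real^'n::_ \<Rightarrow> real^'n::_^'n::_"
  assumes der: "\<And>x. (G has_derivative (\<lambda>h. D x *v h)) (at x)"
    and cont: "continuous_on UNIV D"
    and \<phi> [measurable]: "\<phi> \<in> borel_measurable borel"
  shows "(\<integral>\<^sup>+y. num_elems {x. G x = y} * \<phi> y \<partial>lborel) =
         (\<integral>\<^sup>+x. ennreal \<bar>det (D x)\<bar> * \<phi> (G x) \<partial>lborel)"
proof -
  define U where "U = {x. det (D x) \<noteq> 0}"
  have cdet: "continuous_on UNIV (\<lambda>x. det (D x))"
    by (rule continuous_on_det[OF cont])
  then have [measurable]: "(\<lambda>x. det (D x)) \<in> borel_measurable borel"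
    by (rule borel_measurable_continuous_onI)
  have U[measurable]: "U \<in> sets borel" unfolding U_def by measurable
  have contG: "continuous_on UNIV G"
    using der by (meson continuous_at_imp_continuous_on has_derivative_continuous)
  then have [measurable]: "G \<in> borel_measurable borel"
    by (rule borel_measurable_continuous_onI)
  define F where "F = insert {} {ball a r |a r. inj_on G (ball a r)}"
  obtain F' where F': "F' \<subseteq> F" "countable F'" "\<Union>F' = \<Union>F"
    by (rule Lindelof[of F]) (auto simp: F_def)
  have UF: "U \<subseteq> \<Union>F"
  proof
    fix a assume "a \<in> U"
    then obtain r where "r > 0" "inj_on G (ball a r)"
      using locally_inj_of_det_nonzero[OF der cont, of a] by (auto simp: U_def)
    then show "a \<in> \<Union>F" unfolding F_def by (intro UnionI[of "ball a r"]) auto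
  qed
  \<comment> \<open>The empty set makes the family nonempty, as \<open>range_from_nat_into\<close>
    requires, and does not change the union.\<close>
  define F'' where "F'' = insert {} F'"
  define B where "B = from_nat_into F''"
  have Brange: "range B = F''"
    unfolding B_def by (rule range_from_nat_into) (auto simp: F''_def F'(2))
  have BF: "B k \<in> F" for k
    using Brange F'(1) by (auto simp: F''_def F_def)
  have Bopen: "open (B k)" and Binj: "inj_on G (B k)" for k
    using BF[of k] by (auto simp: F_def)
  have UB: "U \<subseteq> (\<Union>k. B k)"
    using UF unfolding Brange F'(3)[symmetric] by (auto simp: F''_def)
  define S where "S k = U \<inter> disjointed B k" for k
  have S[measurable]: "S k \<in> sets borel" for k
    unfolding S_def using U Bopen by (auto simp: disjointed_def intro!: sets.Int sets.Diff sets.finite_UN)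
  have Sdisj: "disjoint_family S"
    using disjoint_family_disjointed[of B] by (auto simp: disjoint_family_on_def S_def)
  have SU: "(\<Union>k. S k) = U"
    using UB UN_disjointed_eq[of B] by (auto simp: S_def)
  have Sinj: "inj_on G (S k)" for k
    using Binj[of k] disjointed_subset[of B k] by (auto simp: S_def inj_on_def)
  note chg = nn_integral_change_of_variables_inj_wo[OF S der Sinj _ \<phi>]
  have imS[measurable]: "G ` S k \<in> sets lebesgue" for k
    by (rule chg) auto
  have [measurable]: "\<phi> \<in> borel_measurable lebesgue"
    by (simp add: measurable_completion)
  have "negligible (G ` {x. det (D x) = 0})"
  proof (rule baby_Sard[where f' = "\<lambda>x h. D x *v h"])
    show "rank (matrix ((*v) (D x))) < CARD('n)" if "x \<in> {x. det (D x) = 0}" for x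
      using that by (simp add: det_eq_0_rank)
  qed (use der in \<open>auto intro: has_derivative_at_withinI\<close>)
  then have ae: "AE y in lebesgue. y \<notin> G ` {x. det (D x) = 0}"
    by (intro AE_not_in) (simp add: negligible_iff_null_sets)
  have count: "num_elems {x. G x = y} = (\<Sum>k. indicator (G ` S k) y)"
    if y: "y \<notin> G ` {x. det (D x) = 0}" for y
  proof -
    have eq: "{x. G x = y} = (\<Union>k. {x \<in> S k. G x = y})"
      using y SU by (auto simp: U_def)
    have "num_elems (\<Union>k. {x \<in> S k. G x = y}) =
        (\<Sum>k. num_elems {x \<in> S k. G x = y})"
      by (rule suminf_emeasure[symmetric])
         (use Sdisj in \<open>auto simp: disjoint_family_on_def\<close>)
    also have "\<dots> = (\<Sum>k. indicator (G ` S k) y)"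
    proof (rule suminf_cong)
      fix k
      show "num_elems {x \<in> S k. G x = y} = indicator (G ` S k) y"
      proof (cases "y \<in> G ` S k")
        case True
        then obtain x where "x \<in> S k" "y = G x" by auto
        then have "{x \<in> S k. G x = y} = {x}" using Sinj[of k] by (auto simp: inj_on_def)
        then show ?thesis using True by simp
      next
        case False
        then have "{x \<in> S k. G x = y} = {}" by auto
        then show ?thesis using False by (simp only: \<open>{x \<in> S k. G x = y} = {}\<close>) simp
      qed
    qed
    finally show ?thesis by (simp add: eq)
  qed
  have "(\<integral>\<^sup>+y. num_elems {x. G x = y} * \<phi> y \<partial>lborel) =
      (\<integral>\<^sup>+y. num_elems {x. G x = y} * \<phi> y \<partial>lebesgue)"
    by (simp add: nn_integral_completion)
  also have "\<dots> = (\<integral>\<^sup>+y. (\<Sum>k. indicator (G ` S k) y * \<phi> y) \<partial>lebesgue)"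
    using ae by (intro nn_integral_cong_AE) (auto elim!: eventually_mono simp: count)
  also have "\<dots> = (\<Sum>k. \<integral>\<^sup>+y. indicator (G ` S k) y * \<phi> y \<partial>lebesgue)"
    by (rule nn_integral_suminf) auto
  also have "\<dots> = (\<Sum>k. \<integral>\<^sup>+x. indicator (S k) x * (ennreal \<bar>det (D x)\<bar> * \<phi> (G x)) \<partial>lborel)"
    by (intro suminf_cong) (simp add: chg(2) mult.assoc)
  also have "\<dots> = (\<integral>\<^sup>+x. (\<Sum>k. indicator (S k) x * (ennreal \<bar>det (D x)\<bar> * \<phi> (G x))) \<partial>lborel)"
    by (rule nn_integral_suminf[symmetric]) auto
  also have "\<dots> = (\<integral>\<^sup>+x. ennreal \<bar>det (D x)\<bar> * \<phi> (G x) \<partial>lborel)"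
  proof (rule nn_integral_cong)
    fix x
    have "(\<Sum>k. indicator (S k) x * (ennreal \<bar>det (D x)\<bar> * \<phi> (G x))) =
        indicator U x * (ennreal \<bar>det (D x)\<bar> * \<phi> (G x))"
      using suminf_indicator[OF Sdisj, of x] by (simp add: SU)
    then show "(\<Sum>k. indicator (S k) x * (ennreal \<bar>det (D x)\<bar> * \<phi> (G x))) =
        ennreal \<bar>det (D x)\<bar> * \<phi> (G x)"
      by (auto simp: U_def split: split_indicator)
  qed
  finally show ?thesis .
qed


text \<open>
  The library proves Sard's theorem and the change of variables formula only for well-ordered
  index types; a well-ordered copy of a finite type removes this restriction.
\<close>

typedef 'a fin_wo = "UNIV :: 'a set" morphisms from_fin_wo to_fin_wo by simp

instantiation fin_wo :: (finite) "{finite, wellorder}"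
begin

definition enum_fin_wo :: "'a fin_wo \<Rightarrow> nat"
  where "enum_fin_wo = (SOME f. inj f)"

definition less_eq_fin_wo :: "'a fin_wo \<Rightarrow> 'a fin_wo \<Rightarrow> bool"
  where "less_eq_fin_wo x y \<longleftrightarrow> enum_fin_wo x \<le> enum_fin_wo y"

definition less_fin_wo :: "'a fin_wo \<Rightarrow> 'a fin_wo \<Rightarrow> bool"
  where "less_fin_wo x y \<longleftrightarrow> enum_fin_wo x < enum_fin_wo y"

instance
proof
  have "range (to_fin_wo :: 'a \<Rightarrow> 'a fin_wo) = UNIV"
    by (metis from_fin_wo_inverse surjI)
  then show fin: "finite (UNIV :: 'a fin_wo set)"
    by (metis finite finite_imageI)
  have "\<exists>f :: 'a fin_wo \<Rightarrow> nat. inj f"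
    using finite_imp_inj_to_nat_seg[OF fin] by auto
  then have inj: "inj (enum_fin_wo :: 'a fin_wo \<Rightarrow> nat)"
    unfolding enum_fin_wo_def by (rule someI_ex)
  fix x y z :: "'a fin_wo"
  show "x < y \<longleftrightarrow> x \<le> y \<and> \<not> y \<le> x" by (auto simp: less_eq_fin_wo_def less_fin_wo_def)
  show "x \<le> x" by (auto simp: less_eq_fin_wo_def)
  show "x \<le> y \<Longrightarrow> y \<le> z \<Longrightarrow> x \<le> z" by (auto simp: less_eq_fin_wo_def)
  show "x \<le> y \<Longrightarrow> y \<le> x \<Longrightarrow> x = y"
    using inj by (auto simp: less_eq_fin_wo_def inj_def)
  show "x \<le> y \<or> y \<le> x" by (auto simp: less_eq_fin_wo_def)
next
  fix P :: "'a fin_wo \<Rightarrow> bool" and a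
  assume step: "\<And>x. (\<And>y. y < x \<Longrightarrow> P y) \<Longrightarrow> P x"
  show "P a"
    by (induction a rule: measure_induct_rule[of enum_fin_wo]) (metis less_fin_wo_def step)
qed

end

lemma bij_from_fin_wo: "bij from_fin_wo"
  by (rule bijI') (auto simp: from_fin_wo_inject intro: to_fin_wo_inverse[symmetric])

section \<open>Invariance under relabelling of coordinates\<close>

lemma det_reindex:
  fixes A :: "'a::comm_ring_1^'n::finite^'n" and f :: "'m::finite \<Rightarrow> 'n::finite"
  assumes f: "bij f"
  shows "det (\<chi> i j. A $ f i $ f j) = det A"
proof -
  have fimg: "f ` UNIV = UNIV" "inj f" using f by (auto simp: bij_def)
  \<comment> \<open>Conjugation with \<open>f\<close> matches the permutations in the two Leibniz
    sums and preserves their signs.\<close>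
  have bij: "bij_betw (map_permutation UNIV f) {p. p permutes UNIV} {p. p permutes UNIV}"
  proof (rule bij_betw_byWitness[where f' = "map_permutation UNIV (inv f)"])
    have "map_permutation UNIV (inv f) (map_permutation UNIV f p) = p"
      if "p permutes UNIV" for p
      by (rule map_permutation_compose_inv[of _ UNIV])
         (use f that in \<open>auto simp: bij_betw_def bij_is_inj dest: bij_imp_bij_inv\<close>)
    then show "\<forall>a\<in>{p. p permutes UNIV}. map_permutation UNIV (inv f) (map_permutation UNIV f a) = a"
      by blast
    have "map_permutation UNIV f (map_permutation UNIV (inv f) p) = p"
      if "p permutes UNIV" for p
      by (rule map_permutation_compose_inv[of _ UNIV])
         (use f that in \<open>auto simp: bij_is_inj bij_is_surj surj_f_inv_f dest: bij_imp_bij_inv\<close>)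
    then show "\<forall>a\<in>{p. p permutes UNIV}. map_permutation UNIV f (map_permutation UNIV (inv f) a) = a"
      by blast
  qed (use f in \<open>auto intro!: map_permutation_permutes bij_imp_bij_inv\<close>)
  have "det A = (\<Sum>p | p permutes UNIV. of_int (sign (map_permutation UNIV f p)) *
      (\<Prod>i\<in>UNIV. A $ i $ map_permutation UNIV f p i))"
    unfolding det_def by (rule sum.reindex_bij_betw[OF bij, symmetric])
  also have "\<dots> = (\<Sum>p | p permutes UNIV. of_int (sign p) * (\<Prod>i\<in>UNIV. A $ f i $ f (p i)))"
  proof (rule sum.cong)
    fix p :: "'m \<Rightarrow> 'm" assume "p \<in> {p. p permutes UNIV}"
    then have p: "p permutes UNIV" by simp
    have "(\<Prod>i\<in>UNIV. A $ i $ map_permutation UNIV f p i) =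
        (\<Prod>i\<in>UNIV. A $ f i $ map_permutation UNIV f p (f i))"
      by (rule prod.reindex_bij_betw[OF f, symmetric])
    also have "\<dots> = (\<Prod>i\<in>UNIV. A $ f i $ f (p i))"
      using fimg by (simp add: map_permutation_apply)
    finally show "of_int (sign (map_permutation UNIV f p)) * (\<Prod>i\<in>UNIV. A $ i $ map_permutation UNIV f p i)
        = of_int (sign p) * (\<Prod>i\<in>UNIV. A $ f i $ f (p i))"
      using p fimg by (simp add: sign_map_permutation)
  qed simp
  finally show ?thesis by (simp add: det_def)
qed

lemma distr_lborel_reindex:
  fixes f :: "'m::finite \<Rightarrow> 'n::finite"
  assumes f: "bij f"
  shows "distr (lborel :: (real^'n) measure) borel (\<lambda>x. \<chi> i. x $ f i) = (lborel :: (real^'m) measure)"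
proof (rule lborel_eqI[symmetric])
  let ?t = "\<lambda>x::real^'n. (\<chi> i. x $ f i) :: real^'m"
  let ?s = "\<lambda>x::real^'m. (\<chi> i. x $ inv f i) :: real^'n"
  have fi [simp]: "f (inv f i) = i" "inv f (f k) = k" for i k
    using f by (auto simp: bij_def surj_f_inv_f)
  have prod: "(\<Prod>b\<in>Basis. (z::real^'k) \<bullet> b) = (\<Prod>i\<in>UNIV. z $ i)" for z
  proof -
    have "(\<Prod>b\<in>Basis. z \<bullet> b) = (\<Prod>b\<in>range (\<lambda>i. axis i 1). z \<bullet> b)"
      by (rule prod.cong) (auto simp: Basis_vec_def)
    also have "\<dots> = (\<Prod>i\<in>UNIV. z $ i)"
      by (subst prod.reindex) (auto simp: inj_on_def axis_eq_axis inner_axis)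
    finally show ?thesis .
  qed
  have meas: "?t \<in> borel_measurable borel"
    by (intro borel_measurable_continuous_onI continuous_intros)
  fix l u :: "real^'m"
  assume "\<And>b. b \<in> Basis \<Longrightarrow> l \<bullet> b \<le> u \<bullet> b"
  then have le: "l $ i \<le> u $ i" for i
    by (force simp: Basis_vec_def inner_axis)
  have "?t -` box l u = box (?s l) (?s u)"
  proof (intro set_eqI iffI)
    fix x assume "x \<in> box (?s l) (?s u)"
    then have "l $ inv f k < x $ k \<and> x $ k < u $ inv f k" for k by (simp add: mem_box_cart)
    from this[of "f i" for i] show "x \<in> ?t -` box l u" by (simp add: mem_box_cart)
  next
    fix x assume "x \<in> ?t -` box l u"
    then have "l $ i < x $ f i \<and> x $ f i < u $ i" for i by (simp add: mem_box_cart)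
    from this[of "inv f i" for i] show "x \<in> box (?s l) (?s u)" by (simp add: mem_box_cart)
  qed
  then have "emeasure (distr lborel borel ?t) (box l u) = emeasure lborel (box (?s l) (?s u))"
    using meas by (subst emeasure_distr) auto
  also have "\<dots> = (\<Prod>b\<in>Basis. (?s u - ?s l) \<bullet> b)"
    using le by (subst emeasure_lborel_box) (auto simp: Basis_vec_def inner_axis)
  also have "\<dots> = (\<Prod>b\<in>Basis. (u - l) \<bullet> b)"
    unfolding prod using prod.reindex_bij_betw[OF f, of "\<lambda>i. (?s u - ?s l) $ i"] by simp
  finally show "emeasure (distr lborel borel ?t) (box l u) = (\<Prod>b\<in>Basis. (u - l) \<bullet> b)" .
qed simp

text \<open>The mutually inverse relabellings \<open>t\<close> and \<open>s\<close> preserve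
  Lebesgue measure, determinants and the cardinality of fibres, so the well-ordered case applies to
  the conjugated map \<open>t (G (s z))\<close>.\<close>

theorem area_formula:
  fixes G :: "real^'n \<Rightarrow> real^'n" and D :: "real^'n \<Rightarrow> real^'n^'n"
  assumes der: "\<And>x. (G has_derivative (\<lambda>h. D x *v h)) (at x)"
    and cont: "continuous_on UNIV D"
    and \<phi> [measurable]: "\<phi> \<in> borel_measurable borel"
  shows "(\<integral>\<^sup>+y. num_elems {x. G x = y} * \<phi> y \<partial>lborel) =
         (\<integral>\<^sup>+x. ennreal \<bar>det (D x)\<bar> * \<phi> (G x) \<partial>lborel)"
proof -
  let ?f = "from_fin_wo :: 'n fin_wo \<Rightarrow> 'n" and ?g = "to_fin_wo :: 'n \<Rightarrow> 'n fin_wo"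
  define t :: "real^'n \<Rightarrow> real^'n fin_wo" where "t x = (\<chi> i. x $ ?f i)" for x
  define s :: "real^'n fin_wo \<Rightarrow> real^'n" where "s x = (\<chi> i. x $ ?g i)" for x
  have ts[simp]: "t (s z) = z" and st[simp]: "s (t x) = x" for z x
    by (simp_all add: t_def s_def vec_eq_iff from_fin_wo_inverse to_fin_wo_inverse)
  have lin: "bounded_linear t" "bounded_linear s"
    unfolding t_def s_def linear_conv_bounded_linear[symmetric]
    by (auto intro!: linearI simp: vec_eq_iff)
  define D' where "D' z = (\<chi> i j. D (s z) $ ?f i $ ?f j)" for z
  have D': "t (D x *v h) = D' (t x) *v t h" for x h
  proof -
    have "(\<Sum>j\<in>UNIV. D x $ ?f i $ j * h $ j) = (\<Sum>j\<in>UNIV. D x $ ?f i $ ?f j * h $ ?f j)" for i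
      by (rule sum.reindex_bij_betw[OF bij_from_fin_wo, symmetric])
    then show ?thesis by (simp add: vec_eq_iff t_def[of "D x *v h"] D'_def matrix_vector_mult_def) (simp add: t_def)
  qed
  have det: "det (D' z) = det (D (s z))" for z
    unfolding D'_def by (rule det_reindex[OF bij_from_fin_wo])
  have conts: "continuous_on UNIV s" "continuous_on UNIV t"
    using lin linear_continuous_on by auto
  then have [measurable]: "s \<in> borel_measurable borel" "t \<in> borel_measurable borel"
    by (auto intro: borel_measurable_continuous_onI)
  have "continuous_on UNIV (\<lambda>z. D (s z))"
    using continuous_on_compose2[OF cont conts(1)] by simp
  then have contD': "continuous_on UNIV D'"
    unfolding D'_def by (intro continuous_intros)
  have der': "((\<lambda>z. t (G (s z))) has_derivative (\<lambda>h. D' z *v h)) (at z)" for z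
  proof -
    have "((\<lambda>z. t (G (s z))) has_derivative (\<lambda>h. t (D (s z) *v s h))) (at z)"
      by (intro bounded_linear.has_derivative[OF lin(1)] has_derivative_compose[OF _ der, of s]
            bounded_linear_imp_has_derivative lin(2))
    then show ?thesis by (simp add: D')
  qed
  have dt: "distr lborel borel t = lborel" and ds: "distr lborel borel s = lborel"
  proof -
    show dt: "distr lborel borel t = lborel"
      unfolding t_def by (rule distr_lborel_reindex[OF bij_from_fin_wo])
    have "distr lborel borel s = distr (distr lborel borel t) borel s" by (simp add: dt)
    also have "\<dots> = lborel" by (subst distr_distr) (auto simp: comp_def distr_id2)
    finally show "distr lborel borel s = lborel" .
  qed
  have cnt: "num_elems {z. t (G (s z)) = y} = num_elems {x. G x = s y}" for y
  proof -
    have "{z. t (G (s z)) = y} = t ` {x. G x = s y}"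
      by (auto simp: image_iff) (metis st ts)+
    moreover have "inj_on t X" for X by (metis inj_onI st)
    ultimately show ?thesis
      by (simp add: emeasure_count_space finite_image_iff card_image)
  qed
  have "(\<integral>\<^sup>+y. num_elems {z. t (G (s z)) = y} * \<phi> (s y) \<partial>lborel) =
        (\<integral>\<^sup>+x. ennreal \<bar>det (D' x)\<bar> * \<phi> (s (t (G (s x)))) \<partial>lborel)"
    by (rule area_formula_wo[OF der' contD']) measurable
  then have eq: "(\<integral>\<^sup>+y. num_elems {x. G x = s y} * \<phi> (s y) \<partial>lborel) =
        (\<integral>\<^sup>+x. ennreal \<bar>det (D (s x))\<bar> * \<phi> (G (s x)) \<partial>lborel)"
    by (simp add: cnt det)
  have tr: "(\<integral>\<^sup>+y. h (s y) \<partial>lborel) = (\<integral>\<^sup>+x. h x \<partial>lborel)"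
    if [measurable]: "h \<in> borel_measurable borel" for h :: "real^'n \<Rightarrow> ennreal"
  proof -
    have "(\<integral>\<^sup>+y. h (s y) \<partial>lborel) = (\<integral>\<^sup>+x. h x \<partial>distr lborel borel s)"
      by (simp add: nn_integral_distr)
    then show ?thesis by (simp add: ds)
  qed
  have contG: "continuous_on UNIV G"
    using der by (meson continuous_at_imp_continuous_on has_derivative_continuous)
  then have [measurable]: "G \<in> borel_measurable borel"
    by (rule borel_measurable_continuous_onI)
  have [measurable]: "(\<lambda>x. det (D x)) \<in> borel_measurable borel"
    by (intro borel_measurable_continuous_onI continuous_on_det cont)
  \<comment> \<open>The count must be measurable before its integral can be transported along
    \<open>s\<close>; it counts the zeros of \<open>G x - y\<close> with \<open>y\<close> as the
    random parameter.\<close>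
  have [measurable]: "(\<lambda>y. num_elems {x. G x = y}) \<in> borel_measurable borel"
    using measurable_card_zeros[of "\<lambda>y x. G x - y" borel] contG
    by (simp add: continuous_on_diff)
  show ?thesis using eq by (simp add: tr[of "\<lambda>y. num_elems {x. G x = y} * \<phi> y"]
      tr[of "\<lambda>x. ennreal \<bar>det (D x)\<bar> * \<phi> (G x)"])
qed

subsection \<open>Finite product measures\<close>

lemma prod_indicator_eq:
  "finite I \<Longrightarrow> (\<Prod>i\<in>I. indicator (A i) (x i) :: ennreal) = (if \<forall>i\<in>I. x i \<in> A i then 1 else 0)"
  by (induction I rule: finite_induct) (auto split: split_indicator)

text \<open>The hypothesis \<open>eq\<close> says that \<open>T i\<close> pushes the measure with
  density \<open>h i\<close> to the one with density \<open>p i\<close>. Product measures are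
  determined by rectangles, on which both sides factor; finiteness of \<open>p i\<close> keeps the
  factors sigma-finite.\<close>

lemma nn_integral_density_PiM:
  fixes \<mu> :: "'i \<Rightarrow> 'a measure" and \<nu> :: "'i \<Rightarrow> 'b measure"
  assumes I: "finite I"
    and sf\<mu>: "\<And>i. sigma_finite_measure (\<mu> i)" and sf\<nu>: "\<And>i. sigma_finite_measure (\<nu> i)"
    and T [measurable]: "\<And>i. T i \<in> \<mu> i \<rightarrow>\<^sub>M \<nu> i"
    and h [measurable]: "\<And>i. h i \<in> borel_measurable (\<mu> i)"
    and p [measurable]: "\<And>i. p i \<in> borel_measurable (\<nu> i)"
    and pfin: "\<And>i r. p i r \<noteq> (\<top>::ennreal)"
    and eq: "\<And>i f. f \<in> borel_measurable (\<nu> i) \<Longrightarrow>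
      (\<integral>\<^sup>+z. h i z * f (T i z) \<partial>\<mu> i) = (\<integral>\<^sup>+r. p i r * f r \<partial>\<nu> i)"
    and F: "F \<in> borel_measurable (Pi\<^sub>M I \<nu>)"
  shows "(\<integral>\<^sup>+\<omega>. (\<Prod>i\<in>I. h i (\<omega> i)) * F (\<lambda>i\<in>I. T i (\<omega> i)) \<partial>Pi\<^sub>M I \<mu>) =
    (\<integral>\<^sup>+r. F r \<partial>Pi\<^sub>M I (\<lambda>i. density (\<nu> i) (p i)))"
proof -
  interpret \<mu>: product_sigma_finite \<mu> unfolding product_sigma_finite_def by (intro allI sf\<mu>)
  interpret D: product_sigma_finite "\<lambda>i. density (\<nu> i) (p i)"
    unfolding product_sigma_finite_def
    using sf\<nu> pfin by (simp add: sigma_finite_measure.sigma_finite_iff_density_finite)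
  let ?M = "distr (density (Pi\<^sub>M I \<mu>) (\<lambda>\<omega>. \<Prod>i\<in>I. h i (\<omega> i))) (Pi\<^sub>M I \<nu>) (\<lambda>\<omega>. \<lambda>i\<in>I. T i (\<omega> i))"
  let ?D = "Pi\<^sub>M I (\<lambda>i. density (\<nu> i) (p i))"
  have Tm [measurable]: "(\<lambda>\<omega>. \<lambda>i\<in>I. T i (\<omega> i)) \<in> Pi\<^sub>M I \<mu> \<rightarrow>\<^sub>M Pi\<^sub>M I \<nu>"
    by (rule measurable_restrict) (auto intro!: measurable_compose[OF measurable_component_singleton])
  have hm [measurable]: "(\<lambda>\<omega>. \<Prod>i\<in>I. h i (\<omega> i)) \<in> borel_measurable (Pi\<^sub>M I \<mu>)"
    by (rule borel_measurable_prod_ennreal) (auto intro!: measurable_compose[OF measurable_component_singleton])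
  have sets: "sets ?D = sets (Pi\<^sub>M I \<nu>)"
    by (rule sets_PiM_cong) auto
  have int: "(\<integral>\<^sup>+r. F r \<partial>?M) = (\<integral>\<^sup>+\<omega>. (\<Prod>i\<in>I. h i (\<omega> i)) * F (\<lambda>i\<in>I. T i (\<omega> i)) \<partial>Pi\<^sub>M I \<mu>)"
    if [measurable]: "F \<in> borel_measurable (Pi\<^sub>M I \<nu>)" for F
    by (subst nn_integral_distr) (auto simp: nn_integral_density)
  have M: "?M = ?D"
  proof (rule D.PiM_eqI[OF I])
    show "sets ?M = sets ?D" by (simp add: sets)
    fix A assume A: "\<And>i. i \<in> I \<Longrightarrow> A i \<in> sets (density (\<nu> i) (p i))"
    then have A [measurable]: "i \<in> I \<Longrightarrow> A i \<in> sets (\<nu> i)" for i by simp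
    have PA [measurable]: "Pi\<^sub>E I A \<in> sets (Pi\<^sub>M I \<nu>)"
      using I A by (auto intro!: sets_PiM_I_finite)
    have "emeasure ?M (Pi\<^sub>E I A) = (\<integral>\<^sup>+r. indicator (Pi\<^sub>E I A) r \<partial>?M)"
      by (subst nn_integral_indicator) auto
    also have "\<dots> = (\<integral>\<^sup>+\<omega>. (\<Prod>i\<in>I. h i (\<omega> i)) * indicator (Pi\<^sub>E I A) (\<lambda>i\<in>I. T i (\<omega> i)) \<partial>Pi\<^sub>M I \<mu>)"
      by (rule int) measurable
    also have "\<dots> = (\<integral>\<^sup>+\<omega>. (\<Prod>i\<in>I. h i (\<omega> i) * indicator (A i) (T i (\<omega> i))) \<partial>Pi\<^sub>M I \<mu>)"
    proof (rule nn_integral_cong)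
      fix \<omega>
      have "indicator (Pi\<^sub>E I A) (\<lambda>i\<in>I. T i (\<omega> i)) = (\<Prod>i\<in>I. indicator (A i) (T i (\<omega> i)) :: ennreal)"
        using I by (auto simp: prod_indicator_eq indicator_def PiE_def Pi_def)
      then show "(\<Prod>i\<in>I. h i (\<omega> i)) * indicator (Pi\<^sub>E I A) (\<lambda>i\<in>I. T i (\<omega> i)) =
          (\<Prod>i\<in>I. h i (\<omega> i) * indicator (A i) (T i (\<omega> i)))"
        by (simp add: prod.distrib)
    qed
    also have "\<dots> = (\<Prod>i\<in>I. \<integral>\<^sup>+z. h i z * indicator (A i) (T i z) \<partial>\<mu> i)"
      by (rule \<mu>.product_nn_integral_prod[OF I]) measurable
    also have "\<dots> = (\<Prod>i\<in>I. emeasure (density (\<nu> i) (p i)) (A i))"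
      by (rule prod.cong) (auto simp: eq emeasure_density)
    finally show "emeasure ?M (Pi\<^sub>E I A) = (\<Prod>i\<in>I. emeasure (density (\<nu> i) (p i)) (A i))" .
  qed
  show ?thesis using int[OF F] by (simp only: M)
qed

text \<open>A change of variables in all independent factors at once. It serves for linear
  substitutions in matrix rows, for the densities of Gaussian rows, and for replacing the underlying
  probability space by the law of the coefficients.\<close>

lemma nn_integral_PiM_transfer:
  fixes \<mu> :: "'i \<Rightarrow> 'a measure" and \<nu> :: "'i \<Rightarrow> 'b measure"
  assumes "finite I"
    and "\<And>i. sigma_finite_measure (\<mu> i)" "\<And>i. sigma_finite_measure (\<nu> i)"
    and "\<And>i. T i \<in> \<mu> i \<rightarrow>\<^sub>M \<nu> i" "\<And>i. h i \<in> borel_measurable (\<mu> i)"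
    and "\<And>i. p i \<in> borel_measurable (\<nu> i)" "\<And>i r. p i r \<noteq> (\<top>::ennreal)"
    and "\<And>i f. f \<in> borel_measurable (\<nu> i) \<Longrightarrow>
      (\<integral>\<^sup>+z. h i z * f (T i z) \<partial>\<mu> i) = (\<integral>\<^sup>+r. p i r * f r \<partial>\<nu> i)"
    and F: "F \<in> borel_measurable (Pi\<^sub>M I \<nu>)"
  shows "(\<integral>\<^sup>+\<omega>. (\<Prod>i\<in>I. h i (\<omega> i)) * F (\<lambda>i\<in>I. T i (\<omega> i)) \<partial>Pi\<^sub>M I \<mu>) =
         (\<integral>\<^sup>+r. (\<Prod>i\<in>I. p i (r i)) * F r \<partial>Pi\<^sub>M I \<nu>)"
proof -
  have "(\<integral>\<^sup>+\<omega>. (\<Prod>i\<in>I. h i (\<omega> i)) * F (\<lambda>i\<in>I. T i (\<omega> i)) \<partial>Pi\<^sub>M I \<mu>) =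
      (\<integral>\<^sup>+r. F r \<partial>Pi\<^sub>M I (\<lambda>i. density (\<nu> i) (p i)))"
    by (rule nn_integral_density_PiM) (use assms in auto)
  \<comment> \<open>The same lemma for the identity maps, with \<open>p\<close> in the role of
    \<open>h\<close>, turns the product of densities into a density of the product.\<close>
  also have "\<dots> = (\<integral>\<^sup>+r. (\<Prod>i\<in>I. p i (r i)) * F (\<lambda>i\<in>I. r i) \<partial>Pi\<^sub>M I \<nu>)"
    by (rule nn_integral_density_PiM[where T = "\<lambda>_ x. x", symmetric]) (use assms in auto)
  also have "\<dots> = (\<integral>\<^sup>+r. (\<Prod>i\<in>I. p i (r i)) * F r \<partial>Pi\<^sub>M I \<nu>)"
    by (rule nn_integral_cong) (simp add: space_PiM PiE_restrict)
  finally show ?thesis .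
qed

text \<open>For a random matrix with rows indexed by \<open>I\<close>, this separates the column
  \<open>a\<close> of all rows from the remaining columns, so that it can be integrated out with the
  others fixed.\<close>

lemma nn_integral_PiM_PiM_insert:
  fixes M :: "'b \<Rightarrow> 'a measure"
  assumes I: "finite I" and B: "finite B" and a: "a \<notin> B"
    and sf: "\<And>b. sigma_finite_measure (M b)"
    and F [measurable]: "F \<in> borel_measurable (Pi\<^sub>M I (\<lambda>_. Pi\<^sub>M (insert a B) M))"
  shows "(\<integral>\<^sup>+\<omega>. F \<omega> \<partial>Pi\<^sub>M I (\<lambda>_. Pi\<^sub>M (insert a B) M)) =
    (\<integral>\<^sup>+\<eta>. \<integral>\<^sup>+y. F (\<lambda>i\<in>I. (\<eta> i)(a := y i)) \<partial>Pi\<^sub>M I (\<lambda>_. M a) \<partial>Pi\<^sub>M I (\<lambda>_. Pi\<^sub>M B M))"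
proof -
  interpret M: product_sigma_finite M unfolding product_sigma_finite_def by (intro allI sf)
  have sfB: "sigma_finite_measure (Pi\<^sub>M B M)" "sigma_finite_measure (Pi\<^sub>M (insert a B) M)"
    using B by (auto intro: M.sigma_finite)
  interpret PB: product_sigma_finite "\<lambda>_. Pi\<^sub>M B M" unfolding product_sigma_finite_def by (intro allI sfB)
  interpret PA: product_sigma_finite "\<lambda>_. Pi\<^sub>M (insert a B) M" unfolding product_sigma_finite_def by (intro allI sfB)
  interpret Pa: product_sigma_finite "\<lambda>_. M a" unfolding product_sigma_finite_def by (intro allI sf)
  let ?\<mu> = "Pi\<^sub>M I (\<lambda>_. Pi\<^sub>M B M)" and ?\<nu> = "Pi\<^sub>M I (\<lambda>_. M a)" and ?N = "Pi\<^sub>M I (\<lambda>_. Pi\<^sub>M (insert a B) M)"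
  interpret n: sigma_finite_measure ?\<nu> by (rule Pa.sigma_finite[OF I])
  have upd [measurable]: "(\<lambda>p. (fst p)(a := snd p)) \<in> Pi\<^sub>M B M \<Otimes>\<^sub>M M a \<rightarrow>\<^sub>M Pi\<^sub>M (insert a B) M"
    by (rule measurable_fun_upd) auto
  have Tm [measurable]: "(\<lambda>p. \<lambda>i\<in>I. (fst p i)(a := snd p i)) \<in> ?\<mu> \<Otimes>\<^sub>M ?\<nu> \<rightarrow>\<^sub>M ?N"
  proof (rule measurable_restrict)
    fix i assume "i \<in> I"
    then have "(\<lambda>p. (fst p i, snd p i)) \<in> ?\<mu> \<Otimes>\<^sub>M ?\<nu> \<rightarrow>\<^sub>M Pi\<^sub>M B M \<Otimes>\<^sub>M M a"
      by measurable
    from measurable_compose[OF this upd]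
    show "(\<lambda>p. (fst p i)(a := snd p i)) \<in> ?\<mu> \<Otimes>\<^sub>M ?\<nu> \<rightarrow>\<^sub>M Pi\<^sub>M (insert a B) M" by simp
  qed
  define P where "P = distr (?\<mu> \<Otimes>\<^sub>M ?\<nu>) ?N (\<lambda>p. \<lambda>i\<in>I. (fst p i)(a := snd p i))"
  have "P = ?N"
  proof (rule PA.PiM_eqI[OF I])
    show "sets P = sets ?N" by (simp add: P_def)
    fix A assume A [measurable]: "\<And>i. i \<in> I \<Longrightarrow> A i \<in> sets (Pi\<^sub>M (insert a B) M)"
    have PA [measurable]: "Pi\<^sub>E I A \<in> sets ?N"
      using I A by (auto intro!: sets_PiM_I_finite)
    have Asec: "(\<lambda>p. indicator (A i) ((fst p)(a := snd p)) :: ennreal) \<in> borel_measurable (Pi\<^sub>M B M \<Otimes>\<^sub>M M a)"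
      if "i \<in> I" for i
      using measurable_compose[OF upd, of "indicator (A i)" borel] A[OF that] by simp
    have "emeasure P (Pi\<^sub>E I A) = (\<integral>\<^sup>+r. indicator (Pi\<^sub>E I A) r \<partial>P)"
      by (subst nn_integral_indicator) (auto simp: P_def)
    also have "\<dots> = (\<integral>\<^sup>+p. indicator (Pi\<^sub>E I A) (\<lambda>i\<in>I. (fst p i)(a := snd p i)) \<partial>(?\<mu> \<Otimes>\<^sub>M ?\<nu>))"
      unfolding P_def by (subst nn_integral_distr) auto
    also have "\<dots> = (\<integral>\<^sup>+\<eta>. \<integral>\<^sup>+y. indicator (Pi\<^sub>E I A) (\<lambda>i\<in>I. (\<eta> i)(a := y i)) \<partial>?\<nu> \<partial>?\<mu>)"
      by (subst n.nn_integral_fst[symmetric]) auto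
    also have "\<dots> = (\<integral>\<^sup>+\<eta>. \<integral>\<^sup>+y. (\<Prod>i\<in>I. indicator (A i) ((\<eta> i)(a := y i))) \<partial>?\<nu> \<partial>?\<mu>)"
      using I by (intro nn_integral_cong) (auto simp: prod_indicator_eq indicator_def PiE_def Pi_def)
    also have "\<dots> = (\<integral>\<^sup>+\<eta>. (\<Prod>i\<in>I. \<integral>\<^sup>+y. indicator (A i) ((\<eta> i)(a := y)) \<partial>M a) \<partial>?\<mu>)"
    proof (rule nn_integral_cong)
      fix \<eta> assume \<eta>: "\<eta> \<in> space ?\<mu>"
      show "(\<integral>\<^sup>+y. (\<Prod>i\<in>I. indicator (A i) ((\<eta> i)(a := y i))) \<partial>?\<nu>) =
          (\<Prod>i\<in>I. \<integral>\<^sup>+y. indicator (A i) ((\<eta> i)(a := y)) \<partial>M a)"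
      proof (rule Pa.product_nn_integral_prod[OF I, of "\<lambda>i y. indicator (A i) ((\<eta> i)(a := y))"])
        fix i assume i: "i \<in> I"
        then have "\<eta> i \<in> space (Pi\<^sub>M B M)" using \<eta> by (auto simp: space_PiM)
        from measurable_Pair2[OF Asec[OF i] this]
        show "(\<lambda>y. indicator (A i) ((\<eta> i)(a := y)) :: ennreal) \<in> borel_measurable (M a)" by simp
      qed
    qed
    also have "\<dots> = (\<Prod>i\<in>I. \<integral>\<^sup>+\<eta>. \<integral>\<^sup>+y. indicator (A i) (\<eta>(a := y)) \<partial>M a \<partial>Pi\<^sub>M B M)"
    proof (rule PB.product_nn_integral_prod[OF I, of "\<lambda>i \<eta>. \<integral>\<^sup>+y. indicator (A i) (\<eta>(a := y)) \<partial>M a"])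
      fix i assume i: "i \<in> I"
      interpret s: sigma_finite_measure "M a" by (rule sf)
      show "(\<lambda>\<eta>. \<integral>\<^sup>+y. indicator (A i) (\<eta>(a := y)) \<partial>M a) \<in> borel_measurable (Pi\<^sub>M B M)"
        using Asec[OF i] by (intro sigma_finite_measure.borel_measurable_nn_integral sf) (simp add: case_prod_beta')
    qed
    also have "\<dots> = (\<Prod>i\<in>I. emeasure (Pi\<^sub>M (insert a B) M) (A i))"
    proof (rule prod.cong)
      fix i assume i: "i \<in> I"
      show "(\<integral>\<^sup>+\<eta>. \<integral>\<^sup>+y. indicator (A i) (\<eta>(a := y)) \<partial>M a \<partial>Pi\<^sub>M B M) = emeasure (Pi\<^sub>M (insert a B) M) (A i)"
        by (subst M.product_nn_integral_insert[OF B a, symmetric]) (use A[OF i] in auto)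
    qed simp
    finally show "emeasure P (Pi\<^sub>E I A) = (\<Prod>i\<in>I. emeasure (Pi\<^sub>M (insert a B) M) (A i))" .
  qed
  then have "(\<integral>\<^sup>+\<omega>. F \<omega> \<partial>?N) = (\<integral>\<^sup>+\<omega>. F \<omega> \<partial>P)" by simp
  also have "\<dots> = (\<integral>\<^sup>+p. F (\<lambda>i\<in>I. (fst p i)(a := snd p i)) \<partial>(?\<mu> \<Otimes>\<^sub>M ?\<nu>))"
    unfolding P_def by (subst nn_integral_distr) auto
  also have "\<dots> = (\<integral>\<^sup>+\<eta>. \<integral>\<^sup>+y. F (\<lambda>i\<in>I. (\<eta> i)(a := y i)) \<partial>?\<nu> \<partial>?\<mu>)"
    using measurable_compose[OF Tm F] by (subst n.nn_integral_fst[symmetric]) auto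
  finally show ?thesis .
qed

subsection \<open>Gaussian integrals\<close>

lemma measurable_vec_nth [measurable (raw)]:
  fixes f :: "'a \<Rightarrow> real^'n"
  assumes "f \<in> borel_measurable M"
  shows "(\<lambda>x. f x $ i) \<in> borel_measurable M"
  using assms by (rule measurable_compose) (intro borel_measurable_continuous_onI continuous_intros)

lemma measurable_matrix_vector_mult [measurable (raw)]:
  fixes f :: "'a \<Rightarrow> real^'n" and T :: "real^'n^'m"
  assumes "f \<in> borel_measurable M"
  shows "(\<lambda>x. T *v f x) \<in> borel_measurable M"
  using assms by (rule measurable_compose)
    (intro borel_measurable_continuous_onI linear_continuous_on matrix_vector_mul_bounded_linear)

lemma ennreal_divide_cancel:
  assumes c: "c > 0" and eq: "ennreal c * X = ennreal y" and y: "y \<ge> 0"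
  shows "X = ennreal (y / c)"
proof -
  have "X = ennreal (inverse c * c) * X" using c by simp
  also have "\<dots> = ennreal (inverse c) * (ennreal c * X)"
    using c by (subst ennreal_mult) (auto simp: mult.assoc)
  also have "\<dots> = ennreal (inverse c * y)"
    unfolding eq using c y by (simp add: ennreal_mult)
  finally show ?thesis by (simp add: divide_inverse mult.commute)
qed

text \<open>The area formula for a map all of whose fibres are single points.\<close>

lemma nn_integral_linear_change:
  fixes T :: "real^'n^'n"
  assumes T: "det T \<noteq> 0" and f [measurable]: "f \<in> borel_measurable borel"
  shows "(\<integral>\<^sup>+x. ennreal \<bar>det T\<bar> * f (T *v x) \<partial>lborel) = (\<integral>\<^sup>+y. f y \<partial>lborel)"
proof -
  obtain T' where T': "T ** T' = mat 1" "T' ** T = mat 1"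
    using T by (auto simp: invertible_det_nz[symmetric] invertible_def)
  have "{x. T *v x = y} = {T' *v y}" for y
    using T' by (auto simp: matrix_vector_mul_assoc)
  then have one: "num_elems {x. T *v x = y} = 1" for y by simp
  have "(\<integral>\<^sup>+y. num_elems {x. T *v x = y} * f y \<partial>lborel) =
      (\<integral>\<^sup>+x. ennreal \<bar>det T\<bar> * f (T *v x) \<partial>lborel)"
    by (rule area_formula) (auto intro!: bounded_linear_imp_has_derivative)
  then show ?thesis by (simp add: one)
qed

lemma nn_integral_gaussian_1d:
  assumes "\<sigma> > 0"
  shows "(\<integral>\<^sup>+c. ennreal (exp (- c\<^sup>2 / (2 * \<sigma>\<^sup>2))) \<partial>lborel) = ennreal (sqrt (2 * pi) * \<sigma>)"
proof -
  have eq: "exp (- c\<^sup>2 / (2 * \<sigma>\<^sup>2)) = (sqrt (2 * pi) * \<sigma>) * normal_density 0 \<sigma> c" for c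
    using assms by (simp add: normal_density_def real_sqrt_mult)
  interpret prob_space "density lborel (normal_density 0 \<sigma>)"
    by (rule prob_space_normal_density[OF assms])
  have "(\<integral>\<^sup>+c. normal_density 0 \<sigma> c \<partial>lborel) = 1"
    using emeasure_space_1 by (simp add: emeasure_density)
  then show ?thesis
    unfolding eq using assms
    by (subst ennreal_mult) (auto simp: nn_integral_cmult)
qed

lemma nn_integral_std_gaussian:
  "(\<integral>\<^sup>+x. ennreal (exp (- (norm (x :: real^'n))\<^sup>2 / 2)) \<partial>lborel) = ennreal (sqrt (2 * pi) ^ CARD('n))"
proof -
  have "(norm x)\<^sup>2 = (\<Sum>b\<in>Basis. (x \<bullet> b)\<^sup>2)" for x :: "real^'n"
    unfolding power2_norm_eq_inner by (subst euclidean_inner) (simp add: power2_eq_square)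
  then have "exp (- (norm x)\<^sup>2 / 2) = (\<Prod>b\<in>Basis. exp (- (x \<bullet> b)\<^sup>2 / 2))" for x :: "real^'n"
    by (subst exp_sum[symmetric]) (auto simp: sum_negf simp flip: sum_divide_distrib)
  then have "(\<integral>\<^sup>+x. ennreal (exp (- (norm (x :: real^'n))\<^sup>2 / 2)) \<partial>lborel) =
      (\<integral>\<^sup>+x. (\<Prod>b\<in>(Basis :: (real^'n) set). ennreal (exp (- (x \<bullet> b)\<^sup>2 / 2))) \<partial>lborel)"
    by (simp add: prod_ennreal)
  also have "\<dots> = (\<Prod>b\<in>(Basis :: (real^'n) set). \<integral>\<^sup>+c. ennreal (exp (- c\<^sup>2 / 2)) \<partial>lborel)"
    by (rule nn_integral_lborel_prod) auto
  also have "\<dots> = ennreal (sqrt (2 * pi) ^ CARD('n))"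
    using nn_integral_gaussian_1d[of 1] by (simp add: ennreal_power)
  finally show ?thesis .
qed

lemma nn_integral_gaussian_form:
  fixes S :: "real^'n^'n"
  assumes S: "det S \<noteq> 0"
  shows "ennreal \<bar>det S\<bar> * (\<integral>\<^sup>+x. ennreal (exp (- (norm (S *v x))\<^sup>2 / 2)) \<partial>lborel) = ennreal (sqrt (2 * pi) ^ CARD('n))"
proof -
  have "ennreal \<bar>det S\<bar> * (\<integral>\<^sup>+x. ennreal (exp (- (norm (S *v x))\<^sup>2 / 2)) \<partial>lborel) =
      (\<integral>\<^sup>+x. ennreal \<bar>det S\<bar> * ennreal (exp (- (norm (S *v x))\<^sup>2 / 2)) \<partial>lborel)"
    by (subst nn_integral_cmult) auto
  also have "\<dots> = (\<integral>\<^sup>+x. ennreal (exp (- (norm (x :: real^'n))\<^sup>2 / 2)) \<partial>lborel)"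
    by (rule nn_integral_linear_change[OF S]) measurable
  also have "\<dots> = ennreal (sqrt (2 * pi) ^ CARD('n))" by (rule nn_integral_std_gaussian)
  finally show ?thesis .
qed

text \<open>Gram--Schmidt for the inner product \<open>x \<bullet> C y\<close>.\<close>

lemma congruent_to_identity:
  fixes C :: "real^'n^'n"
  assumes sym: "transpose C = C" and pos: "\<And>x. x \<noteq> 0 \<Longrightarrow> x \<bullet> (C *v x) > 0"
  obtains T :: "real^'n^'n" where "transpose T ** C ** T = mat 1"
proof -
  define B where "B x y = x \<bullet> (C *v y)" for x y
  have Bsym: "B x y = B y x" for x y
    unfolding B_def by (metis sym dot_lmul_matrix inner_commute vector_transpose_matrix)
  have B_sum: "B (\<Sum>f\<in>F. c f *\<^sub>R f) y = (\<Sum>f\<in>F. c f * B f y)" for F c y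
    by (simp add: B_def inner_sum_left)
  have Bdiff: "B (x - z) y = B x y - B z y" for x y z by (simp add: B_def inner_diff_left)
  have Bscale: "B (c *\<^sub>R x) y = c * B x y" "B x (c *\<^sub>R y) = c * B x y" for c x y
    by (simp_all add: B_def matrix_vector_mult_scaleR)
  have ex: "\<exists>F. finite F \<and> card F = k \<and> (\<forall>f\<in>F. \<forall>g\<in>F. B f g = (if f = g then 1 else 0))"
    if "k \<le> CARD('n)" for k
    using that
  proof (induction k)
    case 0
    show ?case by (intro exI[of _ "{}"]) auto
  next
    case (Suc k)
    then obtain F where F: "finite F" "card F = k" "\<And>f g. f \<in> F \<Longrightarrow> g \<in> F \<Longrightarrow> B f g = (if f = g then 1 else 0)"
      by auto
    have "span F \<noteq> UNIV"
    proof
      assume "span F = UNIV"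
      then have "DIM(real^'n) \<le> card F"
        using F(1) by (metis dim_UNIV dim_le_card' dim_span)
      then show False using F(2) Suc.prems by simp
    qed
    then obtain v where v: "v \<notin> span F" by blast
    define w where "w = v - (\<Sum>f\<in>F. B v f *\<^sub>R f)"
    have w0: "w \<noteq> 0"
    proof
      assume "w = 0"
      then have "v = (\<Sum>f\<in>F. B v f *\<^sub>R f)" by (simp add: w_def)
      also have "\<dots> \<in> span F" by (intro span_sum span_scale span_base)
      finally show False using v by blast
    qed
    have wF: "B w g = 0" if "g \<in> F" for g
    proof -
      have "(\<Sum>f\<in>F. B v f * B f g) = (\<Sum>f\<in>F. if f = g then B v f else 0)"
        using F(3) that by (intro sum.cong) auto
      then show ?thesis using F(1) that by (simp add: w_def Bdiff B_sum)
    qed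
    define c where "c = sqrt (B w w)"
    have Bww: "B w w > 0" using pos[OF w0] by (simp add: B_def)
    then have c: "c > 0" "c * c = B w w" by (auto simp: c_def)
    define u where "u = inverse c *\<^sub>R w"
    have uF: "B u g = 0" "B g u = 0" if "g \<in> F" for g
      using wF[OF that] by (simp_all add: u_def Bscale Bsym[of g w])
    have uu: "B u u = 1"
      using c Bww by (simp add: u_def Bscale field_simps)
    have "u \<notin> F" using uF(1)[of u] uu by auto
    then have "card (insert u F) = Suc k" using F by simp
    moreover have "\<forall>f\<in>insert u F. \<forall>g\<in>insert u F. B f g = (if f = g then 1 else 0)"
      using F(3) uF uu \<open>u \<notin> F\<close> by fastforce
    ultimately show ?case using F(1) by blast
  qed
  from ex[of "CARD('n)"] obtain F where F: "finite F" "card F = CARD('n)"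
    "\<And>f g. f \<in> F \<Longrightarrow> g \<in> F \<Longrightarrow> B f g = (if f = g then 1 else 0)" by auto
  obtain e where e: "bij_betw e (UNIV :: 'n set) F"
    using F(1,2) by (metis finite finite_same_card_bij)
  define T where "T = (\<chi> i j. e j $ i)"
  have "(transpose T ** C ** T) $ i $ j = B (e i) (e j)" for i j
  proof -
    have "(transpose T ** C ** T) $ i $ j = (\<Sum>k\<in>UNIV. (\<Sum>l\<in>UNIV. e i $ l * C $ l $ k) * e j $ k)"
      by (simp add: matrix_matrix_mult_def transpose_def T_def)
    also have "\<dots> = (\<Sum>l\<in>UNIV. e i $ l * (\<Sum>k\<in>UNIV. C $ l $ k * e j $ k))"
      unfolding sum_distrib_left sum_distrib_right by (subst sum.swap) (simp add: mult.assoc)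
    finally show ?thesis by (simp add: B_def inner_vec_def matrix_vector_mult_def)
  qed
  moreover have "B (e i) (e j) = (if i = j then 1 else 0)" for i j
    using e F(3)[of "e i" "e j"] by (auto simp: bij_betw_def inj_on_def)
  ultimately have "transpose T ** C ** T = mat 1" by (simp add: vec_eq_iff mat_def)
  then show thesis by (rule that)
qed

section \<open>The mean absolute determinant of a Gaussian matrix\<close>

lemma measurable_det_rows [measurable]:
  "(\<lambda>r. det (\<chi> i. (r i :: real^'n))) \<in> borel_measurable (Pi\<^sub>M UNIV (\<lambda>_::'n. lborel))"
proof -
  have "(\<lambda>r. r i $ j) \<in> borel_measurable (Pi\<^sub>M UNIV (\<lambda>_::'n. lborel :: (real^'n) measure))" for i j
    by measurable
  then show ?thesis unfolding det_def by simp
qed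

text \<open>The rows of the identity are replaced by variable rows one at a time. With the others
  fixed, the determinant is linear in the new row and takes the previous value, nonzero almost
  everywhere, at \<open>axis i 1\<close>; so the bad choices form a hyperplane, a null set.\<close>

lemma AE_det_rows_nonzero:
  "AE r in Pi\<^sub>M UNIV (\<lambda>_::'n::finite. lborel). det (\<chi> i. (r i :: real^'n)) \<noteq> 0"
proof -
  interpret product_sigma_finite "\<lambda>_::'n. lborel :: (real^'n) measure"
    unfolding product_sigma_finite_def by (intro allI sigma_finite_lborel)
  define d :: "'n set \<Rightarrow> ('n \<Rightarrow> real^'n) \<Rightarrow> real" where "d I r = det (\<chi> i. if i \<in> I then r i else axis i 1)" for I r
  have dm [measurable]: "d I \<in> borel_measurable (Pi\<^sub>M I (\<lambda>_. lborel))" for I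
  proof -
    have "(\<lambda>r. (if i \<in> I then r i else axis i 1) $ j) \<in> borel_measurable (Pi\<^sub>M I (\<lambda>_. lborel :: (real^'n) measure))"
      for i j
    proof (cases "i \<in> I")
      case True
      then have "(\<lambda>r. r i) \<in> borel_measurable (Pi\<^sub>M I (\<lambda>_. lborel :: (real^'n) measure))"
        using measurable_component_singleton[of i I "\<lambda>_. lborel"] by simp
      from measurable_vec_nth[OF this] show ?thesis using True by simp
    qed simp
    then show ?thesis unfolding d_def det_def by simp
  qed
  have "(\<integral>\<^sup>+r. indicator {0} (d I r) \<partial>Pi\<^sub>M I (\<lambda>_. lborel)) = 0" for I
    using finite[of I]
  proof (induction I rule: finite_induct)
    case empty
    have "(\<chi> i. (axis i 1 :: real^'n)) = mat 1" by (simp add: vec_eq_iff mat_def axis_def)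
    then show ?case by (simp add: d_def space_PiM)
  next
    case (insert i I)
    have "AE r in Pi\<^sub>M I (\<lambda>_. lborel). (indicator {0} (d I r) :: ennreal) = 0"
      using insert.IH by (subst (asm) nn_integral_0_iff_AE) auto
    then have ae: "AE r in Pi\<^sub>M I (\<lambda>_. lborel). d I r \<noteq> 0"
      by eventually_elim (auto simp: indicator_def split: if_splits)
    have inner: "(\<integral>\<^sup>+y. indicator {0} (d (insert i I) (r(i := y))) \<partial>lborel) = (0::ennreal)"
      if "d I r \<noteq> 0" for r
    proof -
      define L where "L y = d (insert i I) (r(i := y))" for y
      have L: "L y = det (\<chi> k. if k = i then y else (if k \<in> I then r k else axis k 1))" for y
        unfolding L_def d_def by (intro arg_cong[where f = det]) (auto simp: vec_eq_iff)
      have lin: "linear L"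
      proof (rule linearI)
        show "L (x + y) = L x + L y" for x y unfolding L by (rule det_row_add)
        have sc: "c *s x = c *\<^sub>R x" for c and x :: "real^'n" by (simp add: vec_eq_iff)
        show "L (c *\<^sub>R x) = c *\<^sub>R L x" for c x
          unfolding L using det_row_mul[of i c "\<lambda>_. x" "\<lambda>k. if k \<in> I then r k else axis k 1"]
          unfolding sc by simp
      qed
      have "L (axis i 1) = d I r"
        using insert.hyps(2) unfolding L d_def by (intro arg_cong[where f = det]) (auto simp: vec_eq_iff)
      with that have Lne: "L (axis i 1) \<noteq> 0" by simp
      have Ladj: "L y = adjoint L 1 \<bullet> y" for y
        using adjoint_works[OF lin, of y 1] by (simp add: inner_commute)
      with Lne have "adjoint L 1 \<noteq> 0" by auto
      then have "negligible {y. adjoint L 1 \<bullet> y = 0}" by (intro negligible_hyperplane) auto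
      then have "AE y in lebesgue. y \<notin> {y. adjoint L 1 \<bullet> y = 0}"
        by (intro AE_not_in) (simp add: negligible_iff_null_sets)
      then have "AE y in lborel. y \<notin> {y. adjoint L 1 \<bullet> y = 0}"
        by (simp add: AE_completion_iff)
      then have "AE y in lborel. (indicator {0} (L y) :: ennreal) = 0"
        by eventually_elim (auto simp: Ladj indicator_def)
      moreover have "L \<in> borel_measurable borel"
        using lin by (intro borel_measurable_continuous_onI linear_continuous_on) (simp add: linear_conv_bounded_linear)
      ultimately show ?thesis
        unfolding L_def by (subst nn_integral_0_iff_AE) auto
    qed
    have "(\<integral>\<^sup>+r. indicator {0} (d (insert i I) r) \<partial>Pi\<^sub>M (insert i I) (\<lambda>_. lborel)) =
        (\<integral>\<^sup>+r. \<integral>\<^sup>+y. indicator {0} (d (insert i I) (r(i := y))) \<partial>lborel \<partial>Pi\<^sub>M I (\<lambda>_. lborel))"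
      by (rule product_nn_integral_insert[OF insert.hyps]) measurable
    also have "\<dots> = (\<integral>\<^sup>+r. 0 \<partial>Pi\<^sub>M I (\<lambda>_. lborel :: (real^'n) measure))"
      using ae by (intro nn_integral_cong_AE) (auto elim!: eventually_mono simp: inner)
    finally show ?case by simp
  qed
  from this[of UNIV] have "AE r in Pi\<^sub>M UNIV (\<lambda>_::'n. lborel). (indicator {0} (d UNIV r) :: ennreal) = 0"
    by (subst (asm) nn_integral_0_iff_AE) auto
  then show ?thesis
    by eventually_elim (auto simp: d_def indicator_def split: if_splits)
qed


text \<open>The mean of |det| for a matrix of independent standard normal entries, times
  \<open>sqrt (2 * pi) ^ (CARD('n) * CARD('n))\<close>: the Gaussian weight is left
  unnormalised.\<close>

definition abs_det_moment :: "'n::finite itself \<Rightarrow> ennreal" where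
  "abs_det_moment _ = (\<integral>\<^sup>+r. ennreal \<bar>det (\<chi> i. (r i :: real^'n))\<bar> * (\<Prod>i\<in>UNIV. ennreal (exp (- (norm (r i))\<^sup>2 / 2)))
     \<partial>Pi\<^sub>M UNIV (\<lambda>_::'n. lborel))"

text \<open>Substituting \<open>S *v r i\<close> costs \<open>\<bar>det S\<bar>\<close> once for
  each of the \<open>CARD('n)\<close> rows, and the determinant of the matrix of rows contributes
  one more factor.\<close>

lemma abs_det_moment_form:
  fixes S :: "real^'n^'n"
  assumes S: "det S \<noteq> 0"
  shows "ennreal (\<bar>det S\<bar> ^ (CARD('n) + 1)) *
     (\<integral>\<^sup>+r. ennreal \<bar>det (\<chi> i. (r i :: real^'n))\<bar> * (\<Prod>i\<in>UNIV. ennreal (exp (- (norm (S *v r i))\<^sup>2 / 2)))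
       \<partial>Pi\<^sub>M UNIV (\<lambda>_::'n. lborel)) = abs_det_moment TYPE('n)"
proof -
  let ?P = "Pi\<^sub>M UNIV (\<lambda>_::'n. lborel :: (real^'n) measure)"
  have [measurable]: "(\<lambda>r. r i) \<in> borel_measurable ?P" for i
    using measurable_component_singleton[of i UNIV "\<lambda>_. lborel"] by simp
  have det: "det (\<chi> i. S *v r i) = det S * det (\<chi> i. r i)" for r :: "'n \<Rightarrow> real^'n"
  proof -
    have "(\<chi> i. S *v r i) = (\<chi> i. r i) ** transpose S"
      by (simp add: vec_eq_iff matrix_matrix_mult_def transpose_def matrix_vector_mult_def mult.commute)
    then show ?thesis by (simp add: det_mul det_transpose)
  qed
  have "(\<integral>\<^sup>+r. (\<Prod>i\<in>UNIV. ennreal \<bar>det S\<bar> * ennreal (exp (- (norm (S *v r i))\<^sup>2 / 2))) *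
        ennreal \<bar>det (\<chi> i. (\<lambda>i\<in>UNIV. S *v r i) i)\<bar> \<partial>?P) =
      (\<integral>\<^sup>+r. (\<Prod>i\<in>UNIV. ennreal (exp (- (norm (r i))\<^sup>2 / 2))) * ennreal \<bar>det (\<chi> i. r i)\<bar> \<partial>?P)"
  proof (rule nn_integral_PiM_transfer[where T = "\<lambda>_ x. S *v x" and h = "\<lambda>_ z. ennreal \<bar>det S\<bar> * ennreal (exp (- (norm (S *v z))\<^sup>2 / 2))"
        and p = "\<lambda>_ z. ennreal (exp (- (norm z)\<^sup>2 / 2))" and F = "\<lambda>r. ennreal \<bar>det (\<chi> i. r i)\<bar>"])
    fix f :: "real^'n \<Rightarrow> ennreal" assume "f \<in> borel_measurable lborel"
    then have [measurable]: "f \<in> borel_measurable borel" by simp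
    show "(\<integral>\<^sup>+z. ennreal \<bar>det S\<bar> * ennreal (exp (- (norm (S *v z))\<^sup>2 / 2)) * f (S *v z) \<partial>lborel) =
        (\<integral>\<^sup>+r. ennreal (exp (- (norm r)\<^sup>2 / 2)) * f r \<partial>lborel)"
      using nn_integral_linear_change[OF S, of "\<lambda>r. ennreal (exp (- (norm r)\<^sup>2 / 2)) * f r"]
      by (simp add: mult.assoc)
  qed (auto intro: sigma_finite_lborel)
  also have "\<dots> = abs_det_moment TYPE('n)"
    unfolding abs_det_moment_def by (simp add: mult.commute)
  also have "(\<integral>\<^sup>+r. (\<Prod>i\<in>UNIV. ennreal \<bar>det S\<bar> * ennreal (exp (- (norm (S *v r i))\<^sup>2 / 2))) *
        ennreal \<bar>det (\<chi> i. (\<lambda>i\<in>UNIV. S *v r i) i)\<bar> \<partial>?P) =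
      (\<integral>\<^sup>+r. ennreal (\<bar>det S\<bar> ^ (CARD('n) + 1)) * (ennreal \<bar>det (\<chi> i. r i)\<bar> *
        (\<Prod>i\<in>UNIV. ennreal (exp (- (norm (S *v r i))\<^sup>2 / 2)))) \<partial>?P)"
    by (intro nn_integral_cong)
       (simp add: prod.distrib det abs_mult ennreal_mult' ennreal_power[symmetric] ac_simps)
  also have "\<dots> = ennreal (\<bar>det S\<bar> ^ (CARD('n) + 1)) * (\<integral>\<^sup>+r. (ennreal \<bar>det (\<chi> i. r i)\<bar> *
        (\<Prod>i\<in>UNIV. ennreal (exp (- (norm (S *v r i))\<^sup>2 / 2)))) \<partial>?P)"
    by (rule nn_integral_cmult) measurable
  finally show ?thesis .
qed

lemma nn_integral_gamma_scaled:
  assumes "s > 0" "a > 0"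
  shows "(\<integral>\<^sup>+t. indicator {0..} t * ennreal (t powr (s - 1) * exp (- a * t)) \<partial>lborel) = ennreal (Gamma s / a powr s)"
proof -
  let ?g = "\<lambda>t. indicator {0..} t * ennreal (t powr (s - 1) * exp (- a * t))"
  have "ennreal (Gamma s) = (\<integral>\<^sup>+t. ennreal (indicator {0..} t * t powr (s - 1) / exp t) \<partial>lborel)"
    using Gamma_conv_nn_integral_real[OF assms(1)] by (simp add: mult.assoc)
  also have "\<dots> = ennreal a * (\<integral>\<^sup>+t. ennreal (indicator {0..} (0 + a * t) * (0 + a * t) powr (s - 1) / exp (0 + a * t)) \<partial>lborel)"
    using nn_integral_real_affine[of "\<lambda>t. ennreal (indicator {0..} t * t powr (s - 1) / exp t)" a 0] assms(2)
    by simp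
  also have "\<dots> = ennreal a * (\<integral>\<^sup>+t. ennreal (a powr (s - 1)) * (?g t) \<partial>lborel)"
  proof (intro arg_cong[where f = "(*) (ennreal a)"] nn_integral_cong)
    fix t :: real
    show "ennreal (indicator {0..} (0 + a * t) * (0 + a * t) powr (s - 1) / exp (0 + a * t)) =
        ennreal (a powr (s - 1)) * (?g t)"
      using assms(2) by (cases "t \<ge> 0")
        (auto simp: powr_mult exp_minus field_simps ennreal_mult[symmetric] zero_le_mult_iff)
  qed
  also have "\<dots> = ennreal a * (ennreal (a powr (s - 1)) * (\<integral>\<^sup>+t. ?g t \<partial>lborel))"
    by (subst nn_integral_cmult) auto
  also have "\<dots> = ennreal (a powr s) * (\<integral>\<^sup>+t. ?g t \<partial>lborel)"
    using assms(2) by (simp add: mult.assoc[symmetric] ennreal_mult[symmetric] powr_diff)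
  finally have "ennreal (a powr s) * (\<integral>\<^sup>+t. ?g t \<partial>lborel) = ennreal (Gamma s)" ..
  then show ?thesis
    by (rule ennreal_divide_cancel[rotated]) (use assms Gamma_real_pos[of s] in auto)
qed

text \<open>Writing the power as a Gamma integral over \<open>t\<close> and exchanging the integrals
  leaves a Gaussian integral in \<open>x\<close>, worth \<open>(pi / t) powr (n / 2)\<close>. With
  \<open>s = (n + 1) / 2\<close> the remaining integral over \<open>t\<close> is
  \<open>Gamma (1 / 2)\<close>, that is \<open>sqrt pi\<close>.\<close>

lemma nn_integral_cauchy_density:
  "(\<integral>\<^sup>+x. ennreal ((1 + (norm (x :: real^'n))\<^sup>2) powr (- (real CARD('n) + 1) / 2)) \<partial>lborel) =
   ennreal (pi powr ((real CARD('n) + 1) / 2) / Gamma ((real CARD('n) + 1) / 2))"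
proof -
  define n where "n = real CARD('n)"
  define s where "s = (n + 1) / 2"
  have n: "n > 0" by (simp add: n_def)
  then have s: "s > 0" by (simp add: s_def)
  have G: "Gamma s > 0" by (rule Gamma_real_pos[OF s])
  let ?b = "\<lambda>x :: real^'n. 1 + (norm x)\<^sup>2"
  have gauss: "(\<integral>\<^sup>+x. ennreal (exp (- t * (norm (x :: real^'n))\<^sup>2)) \<partial>lborel) = ennreal ((pi / t) powr (n / 2))" if t: "t > 0" for t
  proof -
    define c where "c = sqrt (2 * t)"
    have c: "c > 0" "c\<^sup>2 = 2 * t" using t by (auto simp: c_def)
    define S :: "real^'n^'n" where "S = mat c"
    have S: "S *v x = c *\<^sub>R x" for x
      by (simp add: S_def mat_def vec_eq_iff matrix_vector_mult_def if_distrib[of "\<lambda>z. z * _"] cong: if_cong)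
    have "det S = c ^ CARD('n)"
      unfolding S_def mat_def by (subst det_diagonal) auto
    then have "ennreal (c ^ CARD('n)) * (\<integral>\<^sup>+x. ennreal (exp (- t * (norm (x :: real^'n))\<^sup>2)) \<partial>lborel) = ennreal (sqrt (2 * pi) ^ CARD('n))"
      using nn_integral_gaussian_form[of S] c by (simp add: S power_mult_distrib)
    then have "(\<integral>\<^sup>+x. ennreal (exp (- t * (norm (x :: real^'n))\<^sup>2)) \<partial>lborel) = ennreal (sqrt (2 * pi) ^ CARD('n) / c ^ CARD('n))"
      by (rule ennreal_divide_cancel[rotated]) (use c in auto)
    also have "sqrt (2 * pi) ^ CARD('n) / c ^ CARD('n) = (sqrt (2 * pi) / c) ^ CARD('n)"
      by (simp add: power_divide)
    also have "sqrt (2 * pi) / c = (pi / t) powr (1 / 2)"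
      using t by (simp add: c_def real_sqrt_divide[symmetric] powr_half_sqrt)
    also have "((pi / t) powr (1 / 2)) ^ CARD('n) = (pi / t) powr (n / 2)"
      using t by (simp add: powr_realpow[symmetric] powr_powr n_def)
    finally show ?thesis .
  qed
  have "ennreal (Gamma s) * (\<integral>\<^sup>+x. ennreal (?b x powr - s) \<partial>lborel) =
      (\<integral>\<^sup>+x. ennreal (Gamma s) * ennreal (?b x powr - s) \<partial>lborel)"
    by (rule nn_integral_cmult[symmetric]) measurable
  also have "\<dots> = (\<integral>\<^sup>+x. \<integral>\<^sup>+t. indicator {0..} t * ennreal (t powr (s - 1) * exp (- ?b x * t)) \<partial>lborel \<partial>lborel)"
  proof (rule nn_integral_cong)
    fix x :: "real^'n"
    have "1 + (norm x)\<^sup>2 > 0" by (simp add: add_pos_nonneg)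
    then show "ennreal (Gamma s) * ennreal ((1 + (norm x)\<^sup>2) powr - s) =
        (\<integral>\<^sup>+t. indicator {0..} t * ennreal (t powr (s - 1) * exp (- (1 + (norm x)\<^sup>2) * t)) \<partial>lborel)"
      using nn_integral_gamma_scaled[OF s, of "1 + (norm x)\<^sup>2"] G
      by (simp add: powr_minus divide_inverse ennreal_mult)
  qed
  also have "\<dots> = (\<integral>\<^sup>+t. \<integral>\<^sup>+x. indicator {0..} t * ennreal (t powr (s - 1) * exp (- ?b x * t)) \<partial>lborel \<partial>lborel)"
    by (rule lborel_pair.Fubini') measurable
  also have "\<dots> = (\<integral>\<^sup>+t. ennreal (pi powr (n / 2)) * (indicator {0..} t * ennreal (t powr (1 / 2 - 1) * exp (- 1 * t))) \<partial>lborel)"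
  proof (rule nn_integral_cong_AE)
    have "AE t in lborel. t \<noteq> (0::real)" by (rule AE_lborel_singleton)
    then show "AE t in lborel. (\<integral>\<^sup>+x. indicator {0..} t * ennreal (t powr (s - 1) * exp (- ?b x * t)) \<partial>lborel) =
        ennreal (pi powr (n / 2)) * (indicator {0..} t * ennreal (t powr (1 / 2 - 1) * exp (- 1 * t)))"
    proof eventually_elim
      case (elim t)
      show ?case
      proof (cases "t > 0")
        case True
        have "(\<integral>\<^sup>+x. indicator {0..} t * ennreal (t powr (s - 1) * exp (- ?b x * t)) \<partial>lborel) =
            (\<integral>\<^sup>+x. ennreal (t powr (s - 1) * exp (- t)) * ennreal (exp (- t * (norm (x :: real^'n))\<^sup>2)) \<partial>lborel)"
          using True by (intro nn_integral_cong)
            (simp add: ennreal_mult[symmetric] mult_exp_exp algebra_simps)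
        also have "\<dots> = ennreal (t powr (s - 1) * exp (- t)) * ennreal ((pi / t) powr (n / 2))"
          using gauss[OF True] by (subst nn_integral_cmult) auto
        also have "\<dots> = ennreal (pi powr (n / 2)) * (indicator {0..} t * ennreal (t powr (1 / 2 - 1) * exp (- 1 * t)))"
        proof -
          have "t powr (s - 1) * (pi / t) powr (n / 2) = pi powr (n / 2) * t powr (1 / 2 - 1)"
          proof -
            have "(pi / t) powr (n / 2) = pi powr (n / 2) * t powr (- (n / 2))"
              using True by (simp add: powr_divide powr_minus_divide)
            moreover have "t powr (s - 1) * t powr (- (n / 2)) = t powr (1 / 2 - 1)"
              unfolding powr_add[symmetric] by (rule arg_cong[where f = "(powr) t"]) (simp add: s_def field_simps)
            ultimately show ?thesis by (metis mult.commute mult.left_commute)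
          qed
          then show ?thesis using True by (simp add: ennreal_mult[symmetric] mult.commute mult.left_commute)
        qed
        finally show ?thesis .
      next
        case False
        with elim show ?thesis by simp
      qed
    qed
  qed
  also have "\<dots> = ennreal (pi powr (n / 2)) * ennreal (Gamma (1 / 2) / 1 powr (1 / 2))"
    using nn_integral_gamma_scaled[of "1 / 2" 1] by (subst nn_integral_cmult) auto
  also have "\<dots> = ennreal (pi powr s)"
    by (simp add: ennreal_mult[symmetric] Gamma_one_half_real powr_half_sqrt[symmetric] powr_add[symmetric] s_def add_divide_distrib)
  finally have "(\<integral>\<^sup>+x. ennreal (?b x powr - s) \<partial>lborel) = ennreal (pi powr s / Gamma s)"
    by (rule ennreal_divide_cancel[OF G]) simp
  then show ?thesis by (simp add: s_def n_def minus_divide_left)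
qed


text \<open>After a rotation of \<open>x\<close> onto a coordinate axis, the form is diagonal, and
  stretching that axis by \<open>sqrt (1 + (norm x)\<^sup>2)\<close> realises it.\<close>

lemma rank_one_perturbation_form:
  fixes x :: "real^'n"
  obtains S :: "real^'n^'n" where "\<And>r. (norm (S *v r))\<^sup>2 = (norm r)\<^sup>2 + (r \<bullet> x)\<^sup>2" "\<bar>det S\<bar> = sqrt (1 + (norm x)\<^sup>2)"
proof -
  fix k :: 'n
  have "norm x = norm (axis k (norm x) :: real^'n)" by (simp add: norm_eq_sqrt_inner inner_axis_axis)
  then obtain f where f: "orthogonal_transformation f" "f x = axis k (norm x)"
    by (rule orthogonal_transformation_exists)
  define c where "c = sqrt (1 + (norm x)\<^sup>2)"
  have c2: "c\<^sup>2 = 1 + (norm x)\<^sup>2" by (simp add: c_def)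
  define E :: "real^'n^'n" where "E = (\<chi> i j. if i = j then (if i = k then c else 1) else 0)"
  define S where "S = E ** matrix f"
  have lf: "linear f" using f(1) by (rule orthogonal_transformation_linear)
  have "S *v r = E *v f r" for r
    by (simp add: S_def matrix_vector_mul_assoc[symmetric] fun_cong[OF matrix_vector_mul(2)[OF lf]])
  moreover have Ei: "(E *v y) $ i = (if i = k then c else 1) * y $ i" for y i
    by (simp add: E_def matrix_vector_mult_def if_distrib[of "\<lambda>z. z * _"] cong: if_cong)
  have n2: "(norm y)\<^sup>2 = (\<Sum>i\<in>UNIV. (y $ i)\<^sup>2)" for y :: "real^'n"
    by (simp add: norm_vec_def L2_set_def sum_nonneg)
  have En: "(norm (E *v y))\<^sup>2 = (norm y)\<^sup>2 + (norm x)\<^sup>2 * (y $ k)\<^sup>2" for y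
  proof -
    have "(norm (E *v y))\<^sup>2 = (\<Sum>i\<in>UNIV. (y $ i)\<^sup>2 + (if i = k then (norm x)\<^sup>2 * (y $ k)\<^sup>2 else 0))"
      unfolding n2[of "E *v y"] Ei
      using c2 by (auto simp: power_mult_distrib algebra_simps intro!: sum.cong)
    also have "\<dots> = (norm y)\<^sup>2 + (norm x)\<^sup>2 * (y $ k)\<^sup>2"
      by (simp add: sum.distrib n2)
    finally show ?thesis .
  qed
  moreover have "norm (f r) = norm r" for r
    using f(1) by (simp add: orthogonal_transformation_norm)
  moreover have "norm x * f r $ k = r \<bullet> x" for r
  proof -
    have "r \<bullet> x = f r \<bullet> f x" using f(1) by (simp add: orthogonal_transformation_def)
    then show ?thesis by (simp add: f(2) inner_axis)
  qed
  then have "(norm x)\<^sup>2 * (f r $ k)\<^sup>2 = (r \<bullet> x)\<^sup>2" for r by (metis power_mult_distrib)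
  ultimately have 1: "(norm (S *v r))\<^sup>2 = (norm r)\<^sup>2 + (r \<bullet> x)\<^sup>2" for r by simp
  have "det E = (\<Prod>i\<in>UNIV. if i = k then c else 1)"
    by (subst det_diagonal) (auto simp: E_def)
  then have "det E = c" by simp
  moreover have "\<bar>det (matrix f)\<bar> = 1"
    using f(1) det_orthogonal_matrix[of "matrix f"] by (auto simp: orthogonal_transformation_matrix)
  ultimately have "\<bar>det S\<bar> = c" by (simp add: S_def det_mul abs_mult c_def)
  with 1 show thesis by (intro that[of S]) (auto simp: c_def)
qed

text \<open>
  Both orders of integration of \<open>\<bar>det B\<bar> exp (- (\<parallel>B\<parallel>\<^sup>2 + \<parallel>B x\<parallel>\<^sup>2) / 2)\<close> over matrices \<open>B\<close> and
  vectors \<open>x\<close> can be computed: integrating over \<open>x\<close> first cancels the determinant, and integrating over \<open>B\<close>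
  first gives a multiple of the moment, because the quadratic form of each row is
  \<open>\<parallel>r\<parallel>\<^sup>2 + (r \<bullet> x)\<^sup>2\<close>.
\<close>

theorem abs_det_moment_eq:
  "abs_det_moment TYPE('n::finite) =
   ennreal (sqrt (2 * pi) ^ (CARD('n) * (CARD('n) + 1)) * (Gamma ((real CARD('n) + 1) / 2) / pi powr ((real CARD('n) + 1) / 2)))"
proof -
  let ?P = "Pi\<^sub>M UNIV (\<lambda>_::'n. lborel :: (real^'n) measure)"
  let ?n = "CARD('n)"
  let ?D = "abs_det_moment TYPE('n)"
  interpret product_sigma_finite "\<lambda>_::'n. lborel :: (real^'n) measure"
    unfolding product_sigma_finite_def by (intro allI sigma_finite_lborel)
  have sfP: "sigma_finite_measure ?P" by (rule sigma_finite) simp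
  interpret pair_sigma_finite "lborel :: (real^'n) measure" ?P
    unfolding pair_sigma_finite_def by (intro conjI sfP sigma_finite_lborel)
  define w where "w r = (\<Prod>i\<in>UNIV. ennreal (exp (- (norm (r i :: real^'n))\<^sup>2 / 2)))" for r :: "'n \<Rightarrow> real^'n"
  define B where "B r = (\<chi> i. (r i :: real^'n))" for r :: "'n \<Rightarrow> real^'n"
  let ?e = "\<lambda>r x. ennreal \<bar>det (B r)\<bar> * w r * ennreal (exp (- (norm (B r *v x))\<^sup>2 / 2))"
  have comp [measurable]: "(\<lambda>r. r i) \<in> borel_measurable ?P" for i
    using measurable_component_singleton[of i UNIV "\<lambda>_. lborel"] by simp
  have [measurable]: "w \<in> borel_measurable ?P" unfolding w_def by measurable
  have detm [measurable]: "(\<lambda>r. det (B r)) \<in> borel_measurable ?P" unfolding B_def by measurable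
  have nB: "ennreal (exp (- (norm (B r *v x))\<^sup>2 / 2)) = (\<Prod>i\<in>UNIV. ennreal (exp (- (r i \<bullet> x)\<^sup>2 / 2)))" for r x
  proof -
    have "(B r *v x) $ i = r i \<bullet> x" for i
      by (simp add: B_def matrix_vector_mult_def inner_vec_def)
    then have "(norm (B r *v x))\<^sup>2 = (\<Sum>i\<in>UNIV. (r i \<bullet> x)\<^sup>2)"
      by (simp add: norm_vec_def L2_set_def sum_nonneg)
    then have "exp (- (norm (B r *v x))\<^sup>2 / 2) = (\<Prod>i\<in>UNIV. exp (- (r i \<bullet> x)\<^sup>2 / 2))"
      by (subst exp_sum[symmetric]) (auto simp: sum_negf simp flip: sum_divide_distrib)
    then show ?thesis by (simp add: prod_ennreal)
  qed
  \<comment> \<open>The exponent is half of \<open>CARD('n) + 1\<close>: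
    \<open>abs_det_moment_form\<close> has that power of \<open>\<bar>det S\<bar>\<close>, which is
    itself a square root of \<open>1 + (norm x)\<^sup>2\<close>.\<close>
  have inner_x: "(\<integral>\<^sup>+r. ?e r x \<partial>?P) =
      ennreal ((1 + (norm x)\<^sup>2) powr (- (real ?n + 1) / 2)) * ?D" for x
  proof -
    obtain S :: "real^'n^'n" where S: "\<And>r. (norm (S *v r))\<^sup>2 = (norm r)\<^sup>2 + (r \<bullet> x)\<^sup>2" "\<bar>det S\<bar> = sqrt (1 + (norm x)\<^sup>2)"
      using rank_one_perturbation_form[of x] by blast
    have pos: "1 + (norm x)\<^sup>2 > 0" by (simp add: add_pos_nonneg)
    then have "det S \<noteq> 0" using S(2) by auto
    note form = abs_det_moment_form[OF this]
    define X where "X = (\<integral>\<^sup>+r. ?e r x \<partial>?P)"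
    have "X = (\<integral>\<^sup>+r. ennreal \<bar>det (\<chi> i. r i)\<bar> * (\<Prod>i\<in>UNIV. ennreal (exp (- (norm (S *v r i))\<^sup>2 / 2))) \<partial>?P)"
      unfolding X_def nB
      unfolding w_def mult.assoc prod.distrib[symmetric] B_def
      by (intro nn_integral_cong arg_cong2[where f = "(*)"] prod.cong)
         (auto simp: S(1) ennreal_mult[symmetric] mult_exp_exp add_divide_distrib)
    with form have D: "ennreal (sqrt (1 + (norm x)\<^sup>2) ^ (?n + 1)) * X = ?D" by (simp only: S(2))
    have q: "sqrt (1 + (norm x)\<^sup>2) ^ (?n + 1) = (1 + (norm x)\<^sup>2) powr ((real ?n + 1) / 2)"
      using pos by (simp add: powr_half_sqrt[symmetric] powr_realpow[symmetric] powr_powr add.commute del: power_Suc)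
    have "(1 + (norm x)\<^sup>2) powr (- (real ?n + 1) / 2) * (1 + (norm x)\<^sup>2) powr ((real ?n + 1) / 2) = 1"
      using pos by (simp add: powr_add[symmetric] add_divide_distrib[symmetric])
    then have "ennreal ((1 + (norm x)\<^sup>2) powr (- (real ?n + 1) / 2)) * ?D = X"
      unfolding D[symmetric] q by (simp add: mult.assoc[symmetric] ennreal_mult[symmetric])
    then show ?thesis by (simp add: X_def)
  qed
  have inner_r: "(\<integral>\<^sup>+x. ?e r x \<partial>lborel) =
      w r * ennreal (sqrt (2 * pi) ^ ?n)" if "det (B r) \<noteq> 0" for r
  proof -
    have "(\<integral>\<^sup>+x. ?e r x \<partial>lborel) =
        ennreal \<bar>det (B r)\<bar> * w r * (\<integral>\<^sup>+x. ennreal (exp (- (norm (B r *v x))\<^sup>2 / 2)) \<partial>lborel)"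
      by (subst nn_integral_cmult) auto
    also have "\<dots> = w r * (ennreal \<bar>det (B r)\<bar> * (\<integral>\<^sup>+x. ennreal (exp (- (norm (B r *v x))\<^sup>2 / 2)) \<partial>lborel))"
      by (simp add: mult_ac)
    finally show ?thesis by (simp only: nn_integral_gaussian_form[OF that])
  qed
  have jm: "(\<lambda>(x, r). ?e r x) \<in> borel_measurable (lborel \<Otimes>\<^sub>M ?P)"
  proof -
    have [measurable]: "(\<lambda>p. snd p i) \<in> borel_measurable ((lborel :: (real^'n) measure) \<Otimes>\<^sub>M ?P)" for i
      by (rule measurable_compose[OF measurable_snd comp])
    have [measurable]: "(\<lambda>p. w (snd p)) \<in> borel_measurable ((lborel :: (real^'n) measure) \<Otimes>\<^sub>M ?P)"
      "(\<lambda>p. det (B (snd p))) \<in> borel_measurable ((lborel :: (real^'n) measure) \<Otimes>\<^sub>M ?P)"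
      by (rule measurable_compose[OF measurable_snd], measurable)+
    show ?thesis unfolding nB split_beta' by measurable
  qed
  have "(\<integral>\<^sup>+r. w r \<partial>?P) =
      (\<Prod>i\<in>(UNIV::'n set). \<integral>\<^sup>+x. ennreal (exp (- (norm (x :: real^'n))\<^sup>2 / 2)) \<partial>lborel)"
    unfolding w_def by (rule product_nn_integral_prod) auto
  also have "\<dots> = (\<Prod>i\<in>(UNIV::'n set). ennreal (sqrt (2 * pi) ^ ?n))"
    by (simp only: nn_integral_std_gaussian)
  also have "\<dots> = ennreal (sqrt (2 * pi) ^ (?n * ?n))"
    by (simp add: ennreal_power power_mult)
  \<comment> \<open>The one-dimensional Gaussian integrals number \<open>?n * ?n\<close> for the
    rows and \<open>?n\<close> for \<open>x\<close>.\<close>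
  finally have "ennreal (sqrt (2 * pi) ^ (?n * (?n + 1))) = (\<integral>\<^sup>+r. w r * ennreal (sqrt (2 * pi) ^ ?n) \<partial>?P)"
    by (subst nn_integral_multc) (auto simp: ennreal_mult[symmetric] power_add)
  also have "\<dots> = (\<integral>\<^sup>+r. \<integral>\<^sup>+x. ?e r x \<partial>lborel \<partial>?P)"
    using AE_det_rows_nonzero[where 'n = 'n, folded B_def]
    by (intro nn_integral_cong_AE) (erule eventually_mono, rule inner_r[symmetric])
  also have "\<dots> = (\<integral>\<^sup>+x. \<integral>\<^sup>+r. ?e r x \<partial>?P \<partial>lborel)"
    by (rule Fubini'[OF jm])
  also have "\<dots> = (\<integral>\<^sup>+x. ennreal ((1 + (norm (x :: real^'n))\<^sup>2) powr (- (real ?n + 1) / 2)) \<partial>lborel) * ?D"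
    unfolding inner_x by (subst nn_integral_multc) auto
  also have "\<dots> = ennreal (pi powr ((real ?n + 1) / 2) / Gamma ((real ?n + 1) / 2)) * ?D"
    by (simp only: nn_integral_cauchy_density)
  finally have eq: "ennreal (pi powr ((real ?n + 1) / 2) / Gamma ((real ?n + 1) / 2)) * ?D =
      ennreal (sqrt (2 * pi) ^ (?n * (?n + 1)))" ..
  have "pi powr ((real ?n + 1) / 2) / Gamma ((real ?n + 1) / 2) > 0"
    by (intro divide_pos_pos Gamma_real_pos) (auto simp: add_pos_nonneg)
  from ennreal_divide_cancel[OF this eq] show ?thesis by simp
qed

subsection \<open>Densities of Gaussian rows\<close>

declare transpose_matrix_vector [simp del]

lemma det_scaleR:
  fixes A :: "real^'n^'n"
  shows "det (c *\<^sub>R A) = c ^ CARD('n) * det A"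
  by (simp add: det_def prod.distrib sum_distrib_left mult_ac)

abbreviation (input) gauss_density :: "real \<Rightarrow> ennreal" where
  "gauss_density x \<equiv> ennreal (std_normal_density x)"

abbreviation std_gauss :: "real measure" where
  "std_gauss \<equiv> density lborel gauss_density"

abbreviation (input) gauss_PiM :: "'i set \<Rightarrow> ('i \<Rightarrow> real) measure" where
  "gauss_PiM B \<equiv> Pi\<^sub>M B (\<lambda>_. std_gauss)"

lemma prob_space_std_gauss: "prob_space std_gauss"
  by (rule prob_space_normal_density) simp

text \<open>Passes from independent coefficients with arbitrary indices to a Gaussian density on
  \<open>real^'m\<close>. The detour over \<open>Basis\<close> is due to \<open>lborel_eq\<close>,
  which presents \<open>lborel\<close> as the image of a product indexed by
  \<open>Basis\<close>.\<close>

lemma nn_integral_PiM_std_gauss_reindex: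
  fixes e :: "'m::finite \<Rightarrow> 'i" and F :: "real^'m \<Rightarrow> ennreal"
  assumes e: "inj e" and F [measurable]: "F \<in> borel_measurable borel"
  shows "(\<integral>\<^sup>+\<eta>. F (\<chi> k. \<eta> (e k)) \<partial>gauss_PiM (range e)) =
    (\<integral>\<^sup>+h. ennreal (inverse (sqrt (2 * pi)) ^ CARD('m) * exp (- (norm h)\<^sup>2 / 2)) * F h \<partial>lborel)"
proof -
  interpret G: prob_space std_gauss by (rule prob_space_std_gauss)
  let ?b = "\<lambda>k::'m. axis k 1 :: real^'m"
  have binj: "inj ?b" by (auto simp: inj_def axis_eq_axis)
  have Bas: "(Basis :: (real^'m) set) = range ?b" by (auto simp: Basis_vec_def)
  define g where "g = e \<circ> inv ?b"
  have g: "g (?b k) = e k" for k by (simp add: g_def inv_f_f[OF binj])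
  have ginj: "inj_on g Basis" "g \<in> Basis \<rightarrow> range e"
    using e by (auto simp: Bas g inj_on_def inj_def)
  let ?PB = "Pi\<^sub>M (Basis :: (real^'m) set) (\<lambda>_. std_gauss)"
  let ?PL = "Pi\<^sub>M (Basis :: (real^'m) set) (\<lambda>_. lborel :: real measure)"
  have vm: "(\<lambda>\<omega>. \<chi> k. \<omega> (?b k)) = (\<lambda>\<omega>. \<Sum>b\<in>Basis. \<omega> b *\<^sub>R (b :: real^'m))"
  proof
    fix \<omega> :: "real^'m \<Rightarrow> real"
    have "(\<Sum>b\<in>Basis. \<omega> b *\<^sub>R (b :: real^'m)) = (\<Sum>k\<in>UNIV. \<omega> (?b k) *\<^sub>R ?b k)"
      unfolding Bas by (rule sum.reindex_cong[OF binj]) auto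
    then show "(\<chi> k. \<omega> (?b k)) = (\<Sum>b\<in>Basis. \<omega> b *\<^sub>R (b :: real^'m))"
      by (simp add: vec_eq_iff axis_def if_distrib[of "\<lambda>z. _ * z"] cong: if_cong)
  qed
  have [measurable]: "(\<lambda>\<omega>. \<chi> k. \<omega> (?b k)) \<in> borel_measurable ?PB"
    unfolding vm by measurable
  have [measurable]: "(\<lambda>\<omega>. \<chi> k. \<omega> (?b k)) \<in> borel_measurable ?PL"
    unfolding vm by measurable
  have "(\<integral>\<^sup>+\<eta>. F (\<chi> k. \<eta> (e k)) \<partial>gauss_PiM (range e)) =
      (\<integral>\<^sup>+\<eta>. F (\<chi> k. (\<lambda>n\<in>Basis. \<eta> (g n)) (?b k)) \<partial>gauss_PiM (range e))"
    by (simp add: g)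
  also have "\<dots> = (\<integral>\<^sup>+\<omega>. F (\<chi> k. \<omega> (?b k)) \<partial>distr (gauss_PiM (range e)) ?PB (\<lambda>\<eta>. \<lambda>n\<in>Basis. \<eta> (g n)))"
  proof (subst nn_integral_distr)
    show "(\<lambda>\<eta>. \<lambda>n\<in>Basis. \<eta> (g n)) \<in> gauss_PiM (range e) \<rightarrow>\<^sub>M ?PB"
      using ginj(2) by (intro measurable_restrict measurable_component_singleton) auto
  qed auto
  also have "distr (gauss_PiM (range e)) ?PB (\<lambda>\<eta>. \<lambda>n\<in>Basis. \<eta> (g n)) = ?PB"
    by (rule distr_PiM_reindex) (use ginj prob_space_std_gauss in auto)
  also have "(\<integral>\<^sup>+\<omega>. F (\<chi> k. \<omega> (?b k)) \<partial>?PB) =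
      (\<integral>\<^sup>+\<omega>. (\<Prod>b\<in>(Basis :: (real^'m) set). 1) * F (\<chi> k. \<omega> (?b k)) \<partial>?PB)" by simp
  also have "\<dots> = (\<integral>\<^sup>+\<omega>. (\<Prod>b\<in>(Basis :: (real^'m) set). gauss_density (\<omega> b)) * F (\<chi> k. (\<lambda>b\<in>Basis. \<omega> b) (?b k)) \<partial>?PL)"
    by (rule nn_integral_PiM_transfer[symmetric, where T = "\<lambda>_ x. x" and h = "\<lambda>_ x. gauss_density x" and p = "\<lambda>_ _. 1"])
       (auto simp: nn_integral_density G.sigma_finite_measure_axioms sigma_finite_lborel)
  also have "\<dots> = (\<integral>\<^sup>+\<omega>. ennreal (inverse (sqrt (2 * pi)) ^ CARD('m) * exp (- (norm (\<chi> k. \<omega> (?b k) :: real^'m))\<^sup>2 / 2)) * F (\<chi> k. \<omega> (?b k)) \<partial>?PL)"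
  proof (intro nn_integral_cong arg_cong2[where f = "(*)"])
    fix \<omega> :: "real^'m \<Rightarrow> real"
    have "(\<Prod>b\<in>(Basis :: (real^'m) set). gauss_density (\<omega> b)) = ennreal (\<Prod>k\<in>UNIV. std_normal_density (\<omega> (?b k)))"
      unfolding Bas by (subst prod.reindex[OF binj]) (simp add: prod_ennreal)
    also have "(\<Prod>k\<in>UNIV. std_normal_density (\<omega> (?b k))) =
        inverse (sqrt (2 * pi)) ^ CARD('m) * (\<Prod>k\<in>UNIV. exp (- (\<omega> (?b k))\<^sup>2 / 2))"
    proof -
      have "std_normal_density y = inverse (sqrt (2 * pi)) * exp (- y\<^sup>2 / 2)" for y
        by (simp add: std_normal_density_def inverse_eq_divide)
      then show ?thesis by (simp only: prod.distrib prod_constant)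
    qed
    also have "(\<Prod>k\<in>UNIV. exp (- (\<omega> (?b k))\<^sup>2 / 2)) = exp (- (norm (\<chi> k. \<omega> (?b k) :: real^'m))\<^sup>2 / 2)"
      by (subst exp_sum[symmetric])
         (auto simp: norm_vec_def L2_set_def sum_nonneg sum_negf simp flip: sum_divide_distrib)
    finally show "(\<Prod>b\<in>(Basis :: (real^'m) set). gauss_density (\<omega> b)) =
        ennreal (inverse (sqrt (2 * pi)) ^ CARD('m) * exp (- (norm (\<chi> k. \<omega> (?b k) :: real^'m))\<^sup>2 / 2))" .
  qed (simp add: Bas)
  also have "\<dots> = (\<integral>\<^sup>+h. ennreal (inverse (sqrt (2 * pi)) ^ CARD('m) * exp (- (norm h)\<^sup>2 / 2)) * F h \<partial>distr ?PL borel (\<lambda>\<omega>. \<chi> k. \<omega> (?b k)))"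
    by (subst nn_integral_distr) auto
  also have "distr ?PL borel (\<lambda>\<omega>. \<chi> k. \<omega> (?b k)) = (lborel :: (real^'m) measure)"
    unfolding vm by (rule lborel_eq[symmetric])
  finally show ?thesis .
qed

text \<open>
  For independent standard normal \<open>y\<close> and \<open>\<eta> a\<close>, the pair
  \<open>(y + \<Sum> \<eta> a u a, \<Sum> \<eta> a c a)\<close> is Gaussian with covariance operator \<open>row_cov\<close>;
  its density at \<open>s\<close> is \<open>K exp (- s \<bullet> J s / 2)\<close> with \<open>J\<close> the inverse covariance.
\<close>

definition row_cov :: "'i set \<Rightarrow> ('i \<Rightarrow> real) \<Rightarrow> ('i \<Rightarrow> real^'m) \<Rightarrow> real \<times> (real^'m) \<Rightarrow> real \<times> (real^'m)" where
  "row_cov B u c z = (fst z, 0) + (\<Sum>a\<in>B. ((u a, c a) \<bullet> z) *\<^sub>R (u a, c a))"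

abbreviation (input) row_integral :: "'i set \<Rightarrow> ('i \<Rightarrow> real) \<Rightarrow> ('i \<Rightarrow> real^'m) \<Rightarrow> (real^'m \<Rightarrow> ennreal) \<Rightarrow> real \<Rightarrow> ennreal" where
  "row_integral B u c f x \<equiv>
     (\<integral>\<^sup>+\<eta>. f (\<Sum>a\<in>B. \<eta> a *\<^sub>R c a) * gauss_density (x - (\<Sum>a\<in>B. \<eta> a * u a)) \<partial>gauss_PiM B)"

abbreviation (input) quad_integral :: "real \<Rightarrow> (real \<times> (real^'m) \<Rightarrow> real \<times> (real^'m)) \<Rightarrow> (real^'m \<Rightarrow> ennreal) \<Rightarrow> real \<Rightarrow> ennreal" where
  "quad_integral K J f x \<equiv> (\<integral>\<^sup>+r. f r * ennreal (K * exp (- ((x, r) \<bullet> J (x, r)) / 2)) \<partial>lborel)"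

text \<open>The normal factor in \<open>row_integral\<close> is the density of the value at
  \<open>x\<close> given the coefficients \<open>\<eta>\<close>, so \<open>y\<close> is already
  integrated out. A left inverse of the covariance is a two-sided one in finite dimension.\<close>

definition gaussian_row :: "'i set \<Rightarrow> ('i \<Rightarrow> real) \<Rightarrow> ('i \<Rightarrow> real^'m) \<Rightarrow> real \<Rightarrow> (real \<times> (real^'m) \<Rightarrow> real \<times> (real^'m)) \<Rightarrow> bool" where
  "gaussian_row B u c K J \<longleftrightarrow> K > 0 \<and> linear J \<and> (\<forall>s t. s \<bullet> J t = J s \<bullet> t) \<and> (\<forall>z. J (row_cov B u c z) = z) \<and>
     (\<forall>f\<in>borel_measurable borel. \<forall>x.
        row_integral B u c f x = quad_integral K J f x)"

lemma linear_row_cov: "linear (row_cov B u c)"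
  unfolding row_cov_def
  by (intro linear_compose_add linear_compose_sum ballI linearI)
     (auto simp: inner_add_right scaleR_add_left algebra_simps scaleR_sum_right)

lemma row_cov_form: "z \<bullet> row_cov B u c z = (fst z)\<^sup>2 + (\<Sum>a\<in>B. ((u a, c a) \<bullet> z)\<^sup>2)"
  by (simp add: row_cov_def inner_add_right inner_sum_right power2_eq_square inner_commute[of z]
      del: inner_Pair) (cases z, simp add: algebra_simps)

text \<open>With \<open>w = row_cov B u c z\<close> the form becomes the variance
  \<open>z \<bullet> row_cov B u c z\<close>.\<close>

lemma gaussian_row_nonneg:
  assumes "gaussian_row B u c K J"
  shows "w \<bullet> J w \<ge> 0"
proof -
  have JS: "J (row_cov B u c z) = z" for z using assms unfolding gaussian_row_def by blast
  then have "inj (row_cov B u c)" by (metis injI)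
  then have "surj (row_cov B u c)" by (rule linear_inj_imp_surj[OF linear_row_cov])
  then obtain z where z: "w = row_cov B u c z" by (metis surjD)
  have "w \<bullet> J w = z \<bullet> row_cov B u c z" by (simp add: z JS inner_commute)
  then show ?thesis by (simp add: row_cov_form sum_nonneg)
qed

text \<open>Complete the square in \<open>t\<close>: up to a constant the integrand is the normal
  density with mean \<open>\<mu>\<close> and deviation \<open>\<sigma>\<close>. This integrates out
  one new coefficient \<open>t\<close> that shifts the argument of a quadratic form.\<close>

lemma gaussian_convolution_1d:
  assumes \<beta>: "\<beta> \<ge> 0"
  shows "(\<integral>\<^sup>+t. gauss_density t * ennreal (exp (- (q - 2 * t * b + t\<^sup>2 * \<beta>) / 2)) \<partial>lborel) =
    ennreal (inverse (sqrt (1 + \<beta>)) * exp (- (q - b\<^sup>2 / (1 + \<beta>)) / 2))"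
proof -
  let ?e = "\<lambda>t. ennreal (exp (- (q - 2 * t * b + t\<^sup>2 * \<beta>) / 2))"
  define \<sigma> where "\<sigma> = inverse (sqrt (1 + \<beta>))"
  define \<mu> where "\<mu> = b / (1 + \<beta>)"
  have \<sigma>: "\<sigma> > 0" "\<sigma>\<^sup>2 = inverse (1 + \<beta>)" using \<beta> by (auto simp: \<sigma>_def power_inverse)
  let ?c = "\<sigma> * exp (- (q - b\<^sup>2 / (1 + \<beta>)) / 2)"
  interpret prob_space "density lborel (normal_density \<mu> \<sigma>)"
    by (rule prob_space_normal_density[OF \<sigma>(1)])
  have one: "(\<integral>\<^sup>+t. ennreal (normal_density \<mu> \<sigma> t) \<partial>lborel) = 1"
    using emeasure_space_1 by (simp add: emeasure_density)
  have eq: "std_normal_density t * exp (- (q - 2 * t * b + t\<^sup>2 * \<beta>) / 2) =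
      (?c) * normal_density \<mu> \<sigma> t" for t
  proof -
    have e: "- t\<^sup>2 / 2 + - (q - 2 * t * b + t\<^sup>2 * \<beta>) / 2 = - (q - b\<^sup>2 / (1 + \<beta>)) / 2 + - (t - \<mu>)\<^sup>2 / (2 * \<sigma>\<^sup>2)"
    proof -
      have d: "1 + \<beta> > 0" using \<beta> by simp
      have "(t - \<mu>)\<^sup>2 * (1 + \<beta>) = t\<^sup>2 * (1 + \<beta>) - 2 * t * (\<mu> * (1 + \<beta>)) + \<mu> * (\<mu> * (1 + \<beta>))"
        by (simp add: power2_eq_square algebra_simps)
      also have "\<mu> * (1 + \<beta>) = b" using d by (simp add: \<mu>_def)
      also have "\<mu> * b = b\<^sup>2 / (1 + \<beta>)" by (simp add: \<mu>_def power2_eq_square)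
      finally have X: "(t - \<mu>)\<^sup>2 * (1 + \<beta>) = t\<^sup>2 * (1 + \<beta>) - 2 * t * b + b\<^sup>2 / (1 + \<beta>)" .
      have "(t - \<mu>)\<^sup>2 / (2 * \<sigma>\<^sup>2) = ((t - \<mu>)\<^sup>2 * (1 + \<beta>)) / 2"
        unfolding \<sigma>(2) by (simp add: inverse_eq_divide)
      then have Y: "- (t - \<mu>)\<^sup>2 / (2 * \<sigma>\<^sup>2) = - (t\<^sup>2 * (1 + \<beta>) - 2 * t * b + b\<^sup>2 / (1 + \<beta>)) / 2"
        by (simp only: X minus_divide_left[symmetric])
      show ?thesis unfolding Y by (simp add: ring_distribs add_divide_distrib diff_divide_distrib)
    qed
    have "std_normal_density t * exp (- (q - 2 * t * b + t\<^sup>2 * \<beta>) / 2) =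
        1 / sqrt (2 * pi) * exp (- t\<^sup>2 / 2 + - (q - 2 * t * b + t\<^sup>2 * \<beta>) / 2)"
      by (simp only: std_normal_density_def exp_add mult.assoc)
    also have "\<dots> = (?c) * normal_density \<mu> \<sigma> t"
      unfolding e exp_add normal_density_def using \<sigma>(1) by (simp add: real_sqrt_mult)
    finally show ?thesis .
  qed
  have "(\<integral>\<^sup>+t. gauss_density t * ?e t \<partial>lborel) =
      (\<integral>\<^sup>+t. ennreal (?c) * ennreal (normal_density \<mu> \<sigma> t) \<partial>lborel)"
  proof (rule nn_integral_cong)
    fix t
    have "gauss_density t * ?e t =
        ennreal (std_normal_density t * exp (- (q - 2 * t * b + t\<^sup>2 * \<beta>) / 2))"
      by (rule ennreal_mult[symmetric]) auto
    also have "\<dots> = ennreal (?c) * ennreal (normal_density \<mu> \<sigma> t)"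
      unfolding eq by (rule ennreal_mult) (use \<sigma>(1) in auto)
    finally show "gauss_density t * ?e t =
        ennreal (?c) * ennreal (normal_density \<mu> \<sigma> t)" .
  qed
  also have "\<dots> = ennreal (?c)"
    by (subst nn_integral_cmult) (auto simp: one)
  finally show ?thesis by (simp add: \<sigma>_def)
qed

text \<open>
  Adding one coordinate is a rank-one update of the covariance, and its inverse \<open>J\<close> changes by the
  Sherman--Morrison formula.
\<close>

lemma gaussian_row_insert:
  fixes c :: "'i \<Rightarrow> real^'m"
  assumes row: "gaussian_row B u c K J" and B: "finite B" and a: "a \<notin> B"
  shows "\<exists>K J. gaussian_row (insert a B) u c K J"
proof -
  interpret G: prob_space std_gauss by (rule prob_space_std_gauss)
  interpret product_sigma_finite "\<lambda>_::'i. std_gauss"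
    unfolding product_sigma_finite_def by (intro allI G.sigma_finite_measure_axioms)
  have K: "K > 0" and linJ: "linear J" and Jsym: "s \<bullet> J t = J s \<bullet> t" and Jinv: "J (row_cov B u c z) = z"
    for s t z using row unfolding gaussian_row_def by blast+
  have Jm [measurable]: "J \<in> borel_measurable borel"
    using linJ by (intro borel_measurable_continuous_onI linear_continuous_on) (simp add: linear_conv_bounded_linear)
  have law: "row_integral B u c f x = quad_integral K J f x"
    if "f \<in> borel_measurable borel" for f x using row that unfolding gaussian_row_def by blast
  define w where "w = (u a, c a)"
  define \<beta> where "\<beta> = w \<bullet> J w"
  have \<beta>: "\<beta> \<ge> 0" unfolding \<beta>_def by (rule gaussian_row_nonneg[OF row])
  define J' where "J' s = J s - ((w \<bullet> J s) / (1 + \<beta>)) *\<^sub>R J w" for s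
  \<comment> \<open>The rank-one update multiplies the determinant of the covariance by
    \<open>1 + \<beta>\<close>, and a Gaussian normalising factor scales with its inverse square
    root.\<close>
  define K' where "K' = K * inverse (sqrt (1 + \<beta>))"
  have P1: "K' > 0" using K \<beta> by (simp add: K'_def)
  have P2: "linear J'"
    unfolding J'_def
    by (rule linearI) (simp_all add: linear_add[OF linJ] linear_scale[OF linJ] inner_add_right add_divide_distrib algebra_simps)
  have P3: "s \<bullet> J' t = J' s \<bullet> t" for s t
  proof -
    have "s \<bullet> J t = J s \<bullet> t" "w \<bullet> J t = J w \<bullet> t" "s \<bullet> J w = w \<bullet> J s"
      by (metis Jsym inner_commute)+
    then show ?thesis by (simp add: J'_def inner_diff_left inner_diff_right)
  qed
  have P4: "J' (row_cov (insert a B) u c z) = z" for z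
  proof -
    have S: "row_cov (insert a B) u c z = row_cov B u c z + (w \<bullet> z) *\<^sub>R w"
      using B a by (simp add: row_cov_def w_def add_ac del: inner_Pair)
    have JS: "J (row_cov (insert a B) u c z) = z + (w \<bullet> z) *\<^sub>R J w"
      by (simp add: S linear_add[OF linJ] linear_scale[OF linJ] Jinv)
    have "w \<bullet> (z + (w \<bullet> z) *\<^sub>R J w) = (w \<bullet> z) * (1 + \<beta>)"
      by (simp add: inner_add_right \<beta>_def algebra_simps)
    then show ?thesis using \<beta> by (simp add: J'_def JS)
  qed
  have P5: "row_integral (insert a B) u c f x = quad_integral K' J' f x"
    if f [measurable]: "f \<in> borel_measurable borel" for f x
  proof -
    let ?k = "\<lambda>t r. K * exp (- (((x, r) - t *\<^sub>R w) \<bullet> J ((x, r) - t *\<^sub>R w)) / 2)"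
    have sumB: "(\<Sum>b\<in>B. (if b = a then t else \<eta> b) *\<^sub>R c b) = (\<Sum>b\<in>B. \<eta> b *\<^sub>R c b)"
      "(\<Sum>b\<in>B. (if b = a then t else \<eta> b) * u b) = (\<Sum>b\<in>B. \<eta> b * u b)" for \<eta> t
      using a by (auto intro!: sum.cong)
    have split: "(x - t * u a, r - t *\<^sub>R c a) = (x, r) - t *\<^sub>R w" for t r by (simp add: w_def)
    have quad: "((x, r) - t *\<^sub>R w) \<bullet> J ((x, r) - t *\<^sub>R w) =
        (x, r) \<bullet> J (x, r) - 2 * t * (w \<bullet> J (x, r)) + t\<^sup>2 * \<beta>" for t r
      using Jsym[of "(x, r)" w]
      by (simp add: linear_diff[OF linJ] linear_scale[OF linJ] inner_diff_left inner_diff_right \<beta>_def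
          power2_eq_square inner_commute algebra_simps del: inner_Pair)
    have mf: "(\<lambda>\<eta>. f (\<Sum>b\<in>insert a B. \<eta> b *\<^sub>R c b) * gauss_density (x - (\<Sum>b\<in>insert a B. \<eta> b * u b)))
        \<in> borel_measurable (gauss_PiM (insert a B))"
    proof -
      have "(\<lambda>\<eta>. \<eta> b) \<in> borel_measurable (gauss_PiM (insert a B))" if "b \<in> insert a B" for b
        using measurable_component_singleton[OF that, of "\<lambda>_. std_gauss"] by simp
      note [measurable] = this
      show ?thesis by measurable
    qed
    have "(\<integral>\<^sup>+\<eta>. f (\<Sum>b\<in>insert a B. \<eta> b *\<^sub>R c b) * gauss_density (x - (\<Sum>b\<in>insert a B. \<eta> b * u b)) \<partial>gauss_PiM (insert a B)) =
        (\<integral>\<^sup>+t. \<integral>\<^sup>+\<eta>. f (t *\<^sub>R c a + (\<Sum>b\<in>B. \<eta> b *\<^sub>R c b)) * gauss_density ((x - t * u a) - (\<Sum>b\<in>B. \<eta> b * u b)) \<partial>gauss_PiM B \<partial>std_gauss)"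
      by (subst product_nn_integral_insert_rev[OF B a mf])
         (use B a in \<open>simp add: sumB diff_diff_eq\<close>)
    also have "\<dots> = (\<integral>\<^sup>+t. \<integral>\<^sup>+r. f (t *\<^sub>R c a + r) * ennreal (K * exp (- ((x - t * u a, r) \<bullet> J (x - t * u a, r)) / 2)) \<partial>lborel \<partial>std_gauss)"
      by (intro nn_integral_cong law[of "\<lambda>r. f (_ *\<^sub>R c a + r)"]) measurable
    \<comment> \<open>Translating \<open>r\<close> by \<open>t *\<^sub>R c a\<close> frees
      \<open>f\<close> of \<open>t\<close>; the shift moves into the quadratic form, where it is
      \<open>t *\<^sub>R w\<close>.\<close>
    also have "\<dots> = (\<integral>\<^sup>+t. \<integral>\<^sup>+r. f r * ennreal (?k t r) \<partial>lborel \<partial>std_gauss)"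
    proof (rule nn_integral_cong)
      fix t
      have "(\<integral>\<^sup>+r. f r * ennreal (?k t r) \<partial>lborel) =
          (\<integral>\<^sup>+r. f r * ennreal (?k t r) \<partial>distr lborel borel ((+) (t *\<^sub>R c a)))"
        by (simp add: lborel_distr_plus)
      also have "\<dots> = (\<integral>\<^sup>+r. f (t *\<^sub>R c a + r) * ennreal (K * exp (- (((x, t *\<^sub>R c a + r) - t *\<^sub>R w) \<bullet> J ((x, t *\<^sub>R c a + r) - t *\<^sub>R w)) / 2)) \<partial>lborel)"
        by (subst nn_integral_distr) measurable
      finally show "(\<integral>\<^sup>+r. f (t *\<^sub>R c a + r) * ennreal (K * exp (- ((x - t * u a, r) \<bullet> J (x - t * u a, r)) / 2)) \<partial>lborel) =
          (\<integral>\<^sup>+r. f r * ennreal (?k t r) \<partial>lborel)"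
        by (simp add: w_def)
    qed
    also have "\<dots> = (\<integral>\<^sup>+t. \<integral>\<^sup>+r. gauss_density t * (f r * ennreal (?k t r)) \<partial>lborel \<partial>lborel)"
      by (subst nn_integral_density) (auto simp: nn_integral_cmult)
    also have "\<dots> = (\<integral>\<^sup>+r. \<integral>\<^sup>+t. gauss_density t * (f r * ennreal (?k t r)) \<partial>lborel \<partial>lborel)"
      by (rule lborel_pair.Fubini') measurable
    also have "\<dots> = quad_integral K' J' f x"
    proof (rule nn_integral_cong)
      fix r
      have "(\<integral>\<^sup>+t. gauss_density t * (f r * ennreal (?k t r)) \<partial>lborel) =
          (\<integral>\<^sup>+t. (f r * ennreal K) * (gauss_density t * ennreal (exp (- ((x, r) \<bullet> J (x, r) - 2 * t * (w \<bullet> J (x, r)) + t\<^sup>2 * \<beta>) / 2))) \<partial>lborel)"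
        using K by (simp only: quad) (simp add: ennreal_mult ac_simps del: inner_Pair)
      also have "\<dots> = (f r * ennreal K) * ennreal (inverse (sqrt (1 + \<beta>)) * exp (- ((x, r) \<bullet> J (x, r) - (w \<bullet> J (x, r))\<^sup>2 / (1 + \<beta>)) / 2))"
        by (subst nn_integral_cmult) (simp_all only: gaussian_convolution_1d[OF \<beta>], measurable)
      also have "(x, r) \<bullet> J (x, r) - (w \<bullet> J (x, r))\<^sup>2 / (1 + \<beta>) = (x, r) \<bullet> J' (x, r)"
        using Jsym[of "(x, r)" w]
        by (simp add: J'_def inner_diff_right power2_eq_square inner_commute del: inner_Pair)
      finally show "(\<integral>\<^sup>+t. gauss_density t * (f r * ennreal (?k t r)) \<partial>lborel) =
          f r * ennreal (K' * exp (- ((x, r) \<bullet> J' (x, r)) / 2))"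
        using K \<beta> by (simp add: K'_def ennreal_mult[symmetric] mult.assoc del: inner_Pair)
    qed
    finally show ?thesis .
  qed
  have "gaussian_row (insert a B) u c K' J'"
    unfolding gaussian_row_def by (intro conjI allI ballI P1 P2 P3 P4 P5)
  then show ?thesis by blast
qed

text \<open>With exactly \<open>CARD('m)\<close> coefficients the row determines them as
  \<open>T' *v r\<close>. The joint density is the product of their densities and that of the
  residual value \<open>x - \<upsilon> \<bullet> (T' *v r)\<close>, times the Jacobian
  \<open>\<bar>det T'\<bar>\<close>.\<close>

lemma gaussian_row_basis:
  fixes e :: "'m::finite \<Rightarrow> 'i" and c :: "'i \<Rightarrow> real^'m"
  assumes e: "inj e" and span: "span (range (\<lambda>k. c (e k))) = UNIV"
  shows "\<exists>K J. gaussian_row (range e) u c K J"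
proof -
  define T :: "real^'m^'m" where "T = (\<chi> i k. c (e k) $ i)"
  have colT: "column k T = c (e k)" for k by (simp add: T_def column_def vec_eq_iff)
  have "span (columns T) = UNIV"
    using span by (simp add: columns_def colT full_SetCompr_eq)
  then obtain T' where T': "T ** T' = mat 1" using matrix_right_invertible_span_columns[of T]
    by (auto simp: span_vec_eq)
  then have T'': "T' ** T = mat 1" by (simp add: matrix_left_right_inverse)
  have detT': "det T' \<noteq> 0"
    using T' T'' by (auto simp: invertible_det_nz[symmetric] invertible_def)
  have TT'[simp]: "T *v (T' *v r) = r" "T' *v (T *v h) = h" for r h
    by (simp_all add: matrix_vector_mul_assoc T' T'')
  have Th: "T *v h = (\<Sum>k\<in>UNIV. h $ k *\<^sub>R c (e k))" for h
    by (simp add: matrix_mult_sum colT vec_eq_iff)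
  define \<upsilon> :: "real^'m" where "\<upsilon> = (\<chi> k. u (e k))"
  define J where "J s = (fst s - \<upsilon> \<bullet> (T' *v snd s),
      transpose T' *v (T' *v snd s - (fst s - \<upsilon> \<bullet> (T' *v snd s)) *\<^sub>R \<upsilon>))" for s
  \<comment> \<open>There is one normalising factor for each of the \<open>CARD('m)\<close>
    coefficients and one for the value.\<close>
  define K where "K = \<bar>det T'\<bar> * inverse (sqrt (2 * pi)) ^ (CARD('m) + 1)"
  have adj: "r \<bullet> (transpose A *v h) = (A *v r) \<bullet> h" for A :: "real^'m^'m" and r h
    by (metis dot_lmul_matrix inner_commute transpose_matrix_vector)
  have form: "s \<bullet> J t = (fst s - \<upsilon> \<bullet> (T' *v snd s)) * (fst t - \<upsilon> \<bullet> (T' *v snd t)) + (T' *v snd s) \<bullet> (T' *v snd t)" for s t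
    by (cases s, cases t) (simp add: J_def adj inner_diff_right inner_commute algebra_simps)
  have P1: "K > 0" using detT' by (simp add: K_def)
  have P2: "linear J"
    unfolding J_def
    by (rule linearI)
       (simp_all add: matrix_vector_right_distrib matrix_vector_mult_diff_distrib matrix_vector_mult_scaleR inner_add_right algebra_simps)
  have P3: "s \<bullet> J t = J s \<bullet> t" for s t
    unfolding inner_commute[of "J s" t] form by (simp add: inner_commute mult.commute)
  have P4: "J (row_cov (range e) u c z) = z" for z
  proof -
    obtain l y where z: "z = (l, y)" by (cases z)
    define q where "q = l *\<^sub>R \<upsilon> + transpose T *v y"
    have tT: "(transpose T *v y) $ k = c (e k) \<bullet> y" for k
      by (simp add: matrix_vector_mult_def transpose_def T_def inner_vec_def)
    have qk: "q $ k = (u (e k), c (e k)) \<bullet> z" for k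
      by (simp add: q_def \<upsilon>_def tT z mult.commute)
    have "row_cov (range e) u c z = (l, 0) + (\<Sum>k\<in>UNIV. q $ k *\<^sub>R (u (e k), c (e k)))"
      unfolding row_cov_def qk by (subst sum.reindex[OF e]) (simp add: z)
    also have "(\<Sum>k\<in>UNIV. q $ k *\<^sub>R (u (e k), c (e k))) = (\<upsilon> \<bullet> q, T *v q)"
      by (simp add: prod_eq_iff fst_sum snd_sum Th \<upsilon>_def inner_vec_def mult.commute)
    finally have "row_cov (range e) u c z = (l + \<upsilon> \<bullet> q, T *v q)" by simp
    moreover have "transpose T' *v (transpose T *v y) = y"
      by (simp add: matrix_vector_mul_assoc matrix_transpose_mul[symmetric] T')
    ultimately show ?thesis by (simp add: J_def z q_def)
  qed
  have P5: "row_integral (range e) u c f x = quad_integral K J f x"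
    if f [measurable]: "f \<in> borel_measurable borel" for f x
  proof -
    define F where "F h = f (T *v h) * gauss_density (x - \<upsilon> \<bullet> h)" for h
    have [measurable]: "F \<in> borel_measurable borel" unfolding F_def by measurable
    define w where "w h = ennreal (inverse (sqrt (2 * pi)) ^ CARD('m) * exp (- (norm h)\<^sup>2 / 2))" for h :: "real^'m"
    have [measurable]: "w \<in> borel_measurable borel" unfolding w_def by measurable
    have "row_integral (range e) u c f x =
        (\<integral>\<^sup>+\<eta>. F (\<chi> k. \<eta> (e k)) \<partial>gauss_PiM (range e))"
      by (intro nn_integral_cong) (simp add: F_def Th sum.reindex[OF e] \<upsilon>_def inner_vec_def mult.commute)
    also have "\<dots> = (\<integral>\<^sup>+h. w h * F h \<partial>lborel)"
      unfolding w_def by (rule nn_integral_PiM_std_gauss_reindex[OF e]) measurable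
    also have "\<dots> = (\<integral>\<^sup>+r. ennreal \<bar>det T'\<bar> * (w (T' *v r) * F (T' *v r)) \<partial>lborel)"
      by (rule nn_integral_linear_change[OF detT', symmetric]) measurable
    also have "\<dots> = quad_integral K J f x"
    proof (rule nn_integral_cong)
      fix r
      let ?h = "T' *v r"
      have "\<bar>det T'\<bar> * (inverse (sqrt (2 * pi)) ^ CARD('m) * exp (- (norm ?h)\<^sup>2 / 2) * std_normal_density (x - \<upsilon> \<bullet> ?h)) =
          \<bar>det T'\<bar> * inverse (sqrt (2 * pi)) ^ (CARD('m) + 1) * (exp (- (norm ?h)\<^sup>2 / 2) * exp (- (x - \<upsilon> \<bullet> ?h)\<^sup>2 / 2))"
        by (simp add: std_normal_density_def inverse_eq_divide)
      also have "exp (- (norm ?h)\<^sup>2 / 2) * exp (- (x - \<upsilon> \<bullet> ?h)\<^sup>2 / 2) = exp (- ((x, r) \<bullet> J (x, r)) / 2)"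
        unfolding form exp_add[symmetric]
        by (simp add: dot_square_norm power2_eq_square add_divide_distrib)
      finally have eq: "\<bar>det T'\<bar> * (inverse (sqrt (2 * pi)) ^ CARD('m) * exp (- (norm ?h)\<^sup>2 / 2) * std_normal_density (x - \<upsilon> \<bullet> ?h)) =
          K * exp (- ((x, r) \<bullet> J (x, r)) / 2)"
        unfolding K_def .
      have ac: "ennreal d * (ennreal a * (y * ennreal s)) = y * ennreal (d * (a * s))"
        if "d \<ge> 0" "a \<ge> 0" "s \<ge> 0" for d a s and y :: ennreal
        using that by (simp add: ennreal_mult mult_ac)
      show "ennreal \<bar>det T'\<bar> * (w ?h * F ?h) = f r * ennreal (K * exp (- ((x, r) \<bullet> J (x, r)) / 2))"
        unfolding w_def F_def TT' eq[symmetric] by (rule ac) auto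
    qed
    finally show ?thesis .
  qed
  have "gaussian_row (range e) u c K J"
    unfolding gaussian_row_def by (intro conjI allI ballI P1 P2 P3 P4 P5)
  then show ?thesis by blast
qed

text \<open>Coefficients whose vectors \<open>c a\<close> form a basis already give an invertible
  covariance; the others are added singly.\<close>

lemma gaussian_row_exists:
  fixes c :: "'i \<Rightarrow> real^'m"
  assumes B: "finite B" and span: "span (c ` B) = UNIV"
  shows "\<exists>K J. gaussian_row B u c K J"
proof -
  obtain S where S: "S \<subseteq> c ` B" "independent S" "c ` B \<subseteq> span S"
    using maximal_independent_subset[of "c ` B"] by blast
  have spS: "span S = UNIV"
    using S(3) span by (metis span_minimal subspace_span top.extremum_uniqueI)
  have "card S = CARD('m)"
    using S(2) spS by (metis dim_UNIV dim_eq_card_independent dim_span DIM_cart DIM_real mult.right_neutral)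
  moreover have "finite S" using S(2) by (rule independent_imp_finite)
  ultimately obtain b where b: "bij_betw b (UNIV :: 'm set) S"
    by (metis finite finite_same_card_bij)
  have "\<exists>a\<in>B. c a = b k" for k
    using b S(1) by (metis UNIV_I bij_betwE image_iff subset_iff)
  then obtain e where e: "\<And>k. e k \<in> B" "\<And>k. c (e k) = b k" by metis
  have "inj e"
    using b e(2) by (metis bij_betw_imp_inj_on injI inj_eq)
  moreover have "range (\<lambda>k. c (e k)) = S"
    using b e(2) by (simp add: bij_betw_def)
  ultimately have base: "\<exists>K J. gaussian_row (range e) u c K J"
    using gaussian_row_basis[of e c u] spS by simp
  have "\<exists>K J. gaussian_row (range e \<union> E) u c K J" if "finite E" "E \<inter> range e = {}" for E
    using that
  proof (induction E rule: finite_induct)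
    case empty
    then show ?case using base by simp
  next
    case (insert a E)
    then obtain K J where "gaussian_row (range e \<union> E) u c K J" by auto
    then show ?case
      using gaussian_row_insert[of "range e \<union> E" u c K J a] insert by auto
  qed
  from this[of "B - range e"] show ?thesis
    using B e(1) by (simp add: Un_absorb1 image_subset_iff Diff_Int_distrib2)
qed

text \<open>\<open>U\<close> is the variance of the value and \<open>m\<close> its covariance with
  the row. The hypothesis \<open>C\<close> makes \<open>U *\<^sub>R C\<close> the Schur complement,
  that is the covariance of the row given the value; the conclusion is the joint density at value
  0.\<close>

theorem gaussian_row_density:
  fixes B :: "'i set" and c :: "'i \<Rightarrow> real^'m" and C :: "real^'m^'m" and u :: "'i \<Rightarrow> real"
  defines "U \<equiv> 1 + (\<Sum>a\<in>B. (u a)\<^sup>2)" and "m \<equiv> (\<Sum>a\<in>B. u a *\<^sub>R c a)"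
  assumes B: "finite B" and span: "span (c ` B) = UNIV"
    and sym: "transpose C = C" and pos: "\<And>z. z \<noteq> 0 \<Longrightarrow> z \<bullet> (C *v z) > 0"
    and C: "\<And>z. U *\<^sub>R (C *v z) = (\<Sum>a\<in>B. (c a \<bullet> z) *\<^sub>R c a) - ((m \<bullet> z) / U) *\<^sub>R m"
  obtains K :: real and S :: "real^'m^'m" where "K > 0" "det S \<noteq> 0" "(det S)\<^sup>2 * U ^ CARD('m) * det C = 1"
    "K * (sqrt (2 * pi) * sqrt U) * sqrt (2 * pi) ^ CARD('m) = \<bar>det S\<bar>"
    "\<And>f. f \<in> borel_measurable borel \<Longrightarrow>
      (\<integral>\<^sup>+\<eta>. f (\<Sum>a\<in>B. \<eta> a *\<^sub>R c a) * gauss_density (\<Sum>a\<in>B. \<eta> a * u a) \<partial>gauss_PiM B) =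
      (\<integral>\<^sup>+r. f r * ennreal (K * exp (- (norm (S *v r))\<^sup>2 / 2)) \<partial>lborel)"
proof -
  interpret G: prob_space std_gauss by (rule prob_space_std_gauss)
  interpret PB: prob_space "gauss_PiM B"
    by (intro prob_space_PiM prob_space_std_gauss)
  interpret pair_sigma_finite "lborel :: real measure" "gauss_PiM B"
    unfolding pair_sigma_finite_def by (intro conjI sigma_finite_lborel PB.sigma_finite_measure_axioms)
  obtain K J where row: "gaussian_row B u c K J" using gaussian_row_exists[OF B span] by blast
  have K: "K > 0" and linJ: "linear J" and Jsym: "s \<bullet> J t = J s \<bullet> t" and Jinv: "J (row_cov B u c z) = z"
    for s t z using row unfolding gaussian_row_def by blast+
  have [measurable]: "J \<in> borel_measurable borel"
    using linJ by (intro borel_measurable_continuous_onI linear_continuous_on) (simp add: linear_conv_bounded_linear)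
  have law: "row_integral B u c f x = quad_integral K J f x"
    if "f \<in> borel_measurable borel" for f x using row that unfolding gaussian_row_def by blast
  have U: "U > 0" unfolding U_def by (intro add_pos_nonneg sum_nonneg) auto
  let ?g = "\<lambda>x. exp (- x\<^sup>2 / (2 * (sqrt U)\<^sup>2))"
  obtain T :: "real^'m^'m" where T: "transpose T ** C ** T = mat 1"
    using congruent_to_identity[OF sym pos] by blast
  have detT: "(det T)\<^sup>2 * det C = 1"
    using arg_cong[OF T, of det] by (simp add: det_mul det_transpose power2_eq_square mult_ac)
  then have detT0: "det T \<noteq> 0" by auto
  \<comment> \<open>\<open>T ** transpose T\<close> inverts \<open>C\<close>, so
    \<open>(norm (S *v r))\<^sup>2\<close> is the quadratic form of the inverse of
    \<open>U *\<^sub>R C\<close>.\<close>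
  define S where "S = (inverse (sqrt U)) *\<^sub>R transpose T"
  have Sv: "S *v r = inverse (sqrt U) *\<^sub>R (transpose T *v r)" for r
    unfolding S_def by (rule scaleR_matrix_vector_assoc[symmetric])
  let ?s = "\<lambda>r. ennreal (exp (- (norm (S *v r))\<^sup>2 / 2))"
  have detS: "det S = inverse (sqrt U) ^ CARD('m) * det T"
    by (simp add: S_def det_scaleR det_transpose)
  \<comment> \<open>The first component \<open>- (m \<bullet> z) / U\<close> is chosen to cancel the
    value component; what remains is the Schur complement applied to \<open>z\<close>.\<close>
  have r1: "row_cov B u c (- (m \<bullet> z) / U, z) = (0, U *\<^sub>R (C *v z))" for z
  proof -
    have fst: "fst (row_cov B u c (t, z)) = t * U + m \<bullet> z" for t
    proof -
      have "fst (row_cov B u c (t, z)) = t + (\<Sum>a\<in>B. t * (u a)\<^sup>2 + u a * (c a \<bullet> z))"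
        by (simp add: row_cov_def fst_sum power2_eq_square algebra_simps)
      also have "\<dots> = t + (t * (\<Sum>a\<in>B. (u a)\<^sup>2) + m \<bullet> z)"
        by (simp add: m_def sum.distrib inner_sum_left sum_distrib_left)
      finally show ?thesis by (simp add: U_def algebra_simps)
    qed
    have snd: "snd (row_cov B u c (t, z)) = (\<Sum>a\<in>B. (c a \<bullet> z) *\<^sub>R c a) + t *\<^sub>R m" for t
    proof -
      have "snd (row_cov B u c (t, z)) = (\<Sum>a\<in>B. (c a \<bullet> z) *\<^sub>R c a + t *\<^sub>R (u a *\<^sub>R c a))"
        by (simp add: row_cov_def snd_sum scaleR_add_left mult.commute add.commute)
      then show ?thesis by (simp add: m_def sum.distrib scaleR_sum_right)
    qed
    show ?thesis
      unfolding prod_eq_iff fst snd using U by (simp add: C)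
  qed
  have r2: "row_cov B u c (1 / U, 0) = (1, (1 / U) *\<^sub>R m)"
  proof -
    have "row_cov B u c (1, 0) = (U, m)"
      by (simp add: row_cov_def prod_eq_iff fst_sum snd_sum U_def m_def power2_eq_square)
    then show ?thesis
      using U linear_scale[OF linear_row_cov, of B u c "1 / U" "(1, 0)"] by simp
  qed
  have J2: "J (1, (1 / U) *\<^sub>R m) = (1 / U, 0)" using Jinv[of "(1 / U, 0)"] by (simp add: r2)
  have CT: "C *v (T *v (transpose T *v r)) = r" for r
  proof -
    obtain T' where T': "T' ** T = mat 1" "T ** T' = mat 1"
      using detT0 by (auto simp: invertible_det_nz[symmetric] invertible_def)
    have tT': "transpose T' ** transpose T = mat 1"
      by (simp add: matrix_transpose_mul[symmetric] T')
    have "C ** T = transpose T' ** (transpose T ** C ** T)"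
      by (simp add: matrix_mul_assoc tT')
    then have "C ** T = transpose T'" by (simp add: T)
    then have "C ** T ** transpose T = mat 1" by (simp add: tT')
    then show ?thesis by (simp add: matrix_vector_mul_assoc matrix_mul_assoc)
  qed
  have q0: "(0, r) \<bullet> J (0, r) = (norm (S *v r))\<^sup>2" for r
  proof -
    define z where "z = (1 / U) *\<^sub>R (T *v (transpose T *v r))"
    have r: "U *\<^sub>R (C *v z) = r" using U by (simp add: z_def matrix_vector_mult_scaleR CT)
    have "J (0, r) = (- (m \<bullet> z) / U, z)" using Jinv[of "(- (m \<bullet> z) / U, z)"] unfolding r1 r .
    then have "(0, r) \<bullet> J (0, r) = r \<bullet> z" by simp
    also have "\<dots> = (1 / U) * (norm (transpose T *v r))\<^sup>2"
      by (simp add: z_def power2_norm_eq_inner dot_lmul_matrix[symmetric] vector_transpose_matrix transpose_matrix_vector)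
    also have "\<dots> = (norm (S *v r))\<^sup>2"
      using U by (simp add: Sv power_mult_distrib power_inverse divide_inverse)
    finally show ?thesis .
  qed
  \<comment> \<open>\<open>(1, (1 / U) *\<^sub>R m)\<close> is orthogonal to every
    \<open>(0, r)\<close> for the form of \<open>J\<close>, so the form splits into the value and
    the row recentred at its conditional mean.\<close>
  have q1: "(x, x *\<^sub>R ((1 / U) *\<^sub>R m) + r) \<bullet> J (x, x *\<^sub>R ((1 / U) *\<^sub>R m) + r) = x\<^sup>2 / U + (norm (S *v r))\<^sup>2" for x r
  proof -
    let ?v = "(1, (1 / U) *\<^sub>R m)"
    have s: "(x, x *\<^sub>R ((1 / U) *\<^sub>R m) + r) = x *\<^sub>R ?v + (0, r)" by simp
    have 1: "(0, r) \<bullet> J ?v = 0" "?v \<bullet> J ?v = 1 / U" unfolding J2 by simp_all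
    then have 2: "?v \<bullet> J (0, r) = 0" using Jsym[of ?v "(0, r)"] by (simp add: inner_commute)
    have "(x *\<^sub>R ?v + (0, r)) \<bullet> J (x *\<^sub>R ?v + (0, r)) =
        x * x * (?v \<bullet> J ?v) + x * (?v \<bullet> J (0, r)) + x * ((0, r) \<bullet> J ?v) + (0, r) \<bullet> J (0, r)"
      by (simp only: linear_add[OF linJ] linear_scale[OF linJ] inner_add_left inner_add_right inner_scaleR_left inner_scaleR_right)
         (simp add: algebra_simps del: inner_Pair)
    then show ?thesis unfolding s 1 2 q0 by (simp add: power2_eq_square)
  qed
  have detS0: "det S \<noteq> 0" using detT0 U by (simp add: detS)
  have "(det S)\<^sup>2 * U ^ CARD('m) * det C = (inverse (sqrt U) ^ 2 * U) ^ CARD('m) * ((det T)\<^sup>2 * det C)"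
    by (simp add: detS power_mult_distrib mult_ac flip: power_mult)
  also have "\<dots> = 1" using U by (simp add: detT power_inverse)
  finally have c1: "(det S)\<^sup>2 * U ^ CARD('m) * det C = 1" .
  have gs: "(\<integral>\<^sup>+r. ?s r \<partial>lborel) = ennreal (sqrt (2 * pi) ^ CARD('m) / \<bar>det S\<bar>)"
    by (rule ennreal_divide_cancel[OF _ nn_integral_gaussian_form[OF detS0]]) (use detS0 in auto)
  \<comment> \<open>The total mass of the joint density is 1, and this determines
    \<open>K\<close>.\<close>
  have "1 = (\<integral>\<^sup>+\<eta>. \<integral>\<^sup>+x. gauss_density (x - (\<Sum>a\<in>B. \<eta> a * u a)) \<partial>lborel \<partial>gauss_PiM B)"
  proof -
    have "(\<integral>\<^sup>+x. gauss_density (x - g) \<partial>lborel) = 1" for g :: real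
    proof -
      interpret N: prob_space "density lborel (normal_density g 1)"
        by (rule prob_space_normal_density) simp
      have "std_normal_density (x - g) = normal_density g 1 x" for x by (simp add: normal_density_def)
      then show ?thesis using N.emeasure_space_1 by (simp add: emeasure_density)
    qed
    then show ?thesis by (simp add: PB.emeasure_space_1)
  qed
  also have "\<dots> = (\<integral>\<^sup>+x. \<integral>\<^sup>+\<eta>. gauss_density (x - (\<Sum>a\<in>B. \<eta> a * u a)) \<partial>gauss_PiM B \<partial>lborel)"
  proof (rule Fubini')
    have "(\<lambda>\<eta>. \<eta> b) \<in> borel_measurable (gauss_PiM B)" if "b \<in> B" for b
      using measurable_component_singleton[OF that, of "\<lambda>_. std_gauss"] by simp
    then have [measurable]: "b \<in> B \<Longrightarrow> (\<lambda>p. snd p b) \<in> borel_measurable ((lborel :: real measure) \<Otimes>\<^sub>M gauss_PiM B)" for b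
      by (rule measurable_compose[OF measurable_snd])
    show "(\<lambda>(x, \<eta>). gauss_density (x - (\<Sum>a\<in>B. \<eta> a * u a))) \<in> borel_measurable ((lborel :: real measure) \<Otimes>\<^sub>M gauss_PiM B)"
      unfolding split_beta' by measurable
  qed
  also have "\<dots> = (\<integral>\<^sup>+x. \<integral>\<^sup>+r. ennreal (K * exp (- ((x, r) \<bullet> J (x, r)) / 2)) \<partial>lborel \<partial>lborel)"
    using law[of "\<lambda>_. 1"] by simp
  also have "\<dots> = (\<integral>\<^sup>+x. ennreal (K * (sqrt (2 * pi) ^ CARD('m) / \<bar>det S\<bar>)) * ennreal (?g x) \<partial>lborel)"
  proof (rule nn_integral_cong)
    fix x :: real
    let ?v = "x *\<^sub>R ((1 / U) *\<^sub>R m)"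
    have "(\<integral>\<^sup>+r. ennreal (K * exp (- ((x, r) \<bullet> J (x, r)) / 2)) \<partial>lborel) =
        (\<integral>\<^sup>+r. ennreal (K * exp (- ((x, r) \<bullet> J (x, r)) / 2)) \<partial>distr lborel borel ((+) ?v))"
      by (simp only: lborel_distr_plus)
    also have "\<dots> = (\<integral>\<^sup>+r. ennreal (K * exp (- ((x, ?v + r) \<bullet> J (x, ?v + r)) / 2)) \<partial>lborel)"
      by (rule nn_integral_distr) measurable
    also have "\<dots> = (\<integral>\<^sup>+r. ennreal (K * ?g x) * ?s r \<partial>lborel)"
    proof (rule nn_integral_cong)
      fix r
      have "exp (- (x\<^sup>2 / U + (norm (S *v r))\<^sup>2) / 2) = ?g x * exp (- (norm (S *v r))\<^sup>2 / 2)"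
        unfolding exp_add[symmetric] using U by (simp add: field_simps)
      then show "ennreal (K * exp (- ((x, ?v + r) \<bullet> J (x, ?v + r)) / 2)) =
          ennreal (K * ?g x) * ?s r"
        unfolding q1 using K by (simp only:) (subst ennreal_mult[symmetric], auto simp: mult.assoc)
    qed
    also have "\<dots> = ennreal (K * ?g x) * ennreal (sqrt (2 * pi) ^ CARD('m) / \<bar>det S\<bar>)"
      using gs by (subst nn_integral_cmult) auto
    finally show "(\<integral>\<^sup>+r. ennreal (K * exp (- ((x, r) \<bullet> J (x, r)) / 2)) \<partial>lborel) =
        ennreal (K * (sqrt (2 * pi) ^ CARD('m) / \<bar>det S\<bar>)) * ennreal (?g x)"
      using K by (simp add: ennreal_mult[symmetric] mult_ac)
  qed
  also have "\<dots> = ennreal (K * (sqrt (2 * pi) ^ CARD('m) / \<bar>det S\<bar>)) * ennreal (sqrt (2 * pi) * sqrt U)"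
    using nn_integral_gaussian_1d[of "sqrt U"] U by (subst nn_integral_cmult) auto
  also have "\<dots> = ennreal (K * (sqrt (2 * pi) ^ CARD('m) / \<bar>det S\<bar>) * (sqrt (2 * pi) * sqrt U))"
    using K U by (subst ennreal_mult) auto
  finally have "K * (sqrt (2 * pi) ^ CARD('m) / \<bar>det S\<bar>) * (sqrt (2 * pi) * sqrt U) = 1"
    by (metis ennreal_eq_1)
  then have c2: "K * (sqrt (2 * pi) * sqrt U) * sqrt (2 * pi) ^ CARD('m) = \<bar>det S\<bar>"
    using detS0 by (simp add: field_simps)
  \<comment> \<open>Value 0 means that \<open>y\<close> is the negative of
    \<open>\<Sum>a\<in>B. \<eta> a * u a\<close>; evenness removes the sign.\<close>
  have even: "std_normal_density (0 - g) = std_normal_density g" for g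
    by (simp add: normal_density_def)
  have "(\<integral>\<^sup>+\<eta>. f (\<Sum>a\<in>B. \<eta> a *\<^sub>R c a) * gauss_density (\<Sum>a\<in>B. \<eta> a * u a) \<partial>gauss_PiM B) =
      (\<integral>\<^sup>+r. f r * ennreal (K * exp (- (norm (S *v r))\<^sup>2 / 2)) \<partial>lborel)"
    if "f \<in> borel_measurable borel" for f
    using law[OF that, of 0] unfolding q0 even .
  with K detS0 c1 c2 show thesis by (rule that)
qed

subsection \<open>Weighted exponents and their covariance\<close>

locale exp_family =
  fixes A :: "(real^'m::finite) set" and \<alpha> :: "real^'m \<Rightarrow> real"
  assumes finite_A: "finite A" and pos: "\<And>a. a \<in> A \<Longrightarrow> \<alpha> a > 0" and full: "affine hull A = UNIV"
begin

definition Z :: "real^'m \<Rightarrow> real" where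
  "Z x = (\<Sum>a\<in>A. (\<alpha> a * exp (a \<bullet> x))\<^sup>2)"

definition wt :: "real^'m \<Rightarrow> real^'m \<Rightarrow> real" where
  "wt x a = (\<alpha> a * exp (a \<bullet> x))\<^sup>2 / Z x"

definition mean :: "real^'m \<Rightarrow> real^'m" where
  "mean x = (\<Sum>a\<in>A. wt x a *\<^sub>R a)"

definition cov :: "real^'m \<Rightarrow> real^'m^'m" where
  "cov x = (\<chi> i j. \<Sum>a\<in>A. wt x a * ((a - mean x) $ i * (a - mean x) $ j))"

lemma A_nonempty: "A \<noteq> {}"
  using full by auto

lemma Z_pos: "Z x > 0"
  unfolding Z_def using finite_A A_nonempty by (intro sum_pos zero_less_power mult_pos_pos pos) auto

lemma wt_pos: "a \<in> A \<Longrightarrow> wt x a > 0"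
  unfolding wt_def using pos[of a] by (intro divide_pos_pos Z_pos) auto

lemma sum_wt: "(\<Sum>a\<in>A. wt x a) = 1"
  unfolding wt_def sum_divide_distrib[symmetric] using Z_pos[of x] by (simp add: Z_def)

lemma span_diffs:
  assumes "a0 \<in> A"
  shows "span ((\<lambda>a. a - a0) ` A) = UNIV"
proof -
  have "(\<lambda>x. x - a0) ` (affine hull A) = span ((\<lambda>x. x - a0) ` A)"
    using diffs_affine_hull_span[OF assms] by (simp add: Setcompr_eq_image)
  moreover have "range (\<lambda>x. x - a0) = UNIV"
    by (metis add_diff_cancel surjI)
  ultimately show ?thesis by (simp add: full)
qed

lemma cov_mult: "cov x *v z = (\<Sum>a\<in>A. (wt x a * ((a - mean x) \<bullet> z)) *\<^sub>R (a - mean x))"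
proof -
  have "(cov x *v z) $ i = (\<Sum>a\<in>A. \<Sum>j\<in>UNIV. wt x a * ((a - mean x) $ i * (a - mean x) $ j) * z $ j)" for i
    unfolding cov_def matrix_vector_mult_def by (simp add: sum_distrib_right) (rule sum.swap)
  also have "(\<Sum>a\<in>A. \<Sum>j\<in>UNIV. wt x a * ((a - mean x) $ i * (a - mean x) $ j) * z $ j) =
      (\<Sum>a\<in>A. (wt x a * ((a - mean x) \<bullet> z)) * (a - mean x) $ i)" for i
    unfolding inner_vec_def sum_distrib_left sum_distrib_right by (intro sum.cong) (auto simp: mult_ac)
  finally show ?thesis by (simp add: vec_eq_iff sum_component)
qed

lemma transpose_cov: "transpose (cov x) = cov x"
  by (simp add: cov_def transpose_def vec_eq_iff mult.commute)

text \<open>If \<open>a \<bullet> z\<close> had variance zero under the positive weights, all of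
  \<open>A\<close> would lie in a hyperplane orthogonal to \<open>z\<close>, contrary to
  \<open>full\<close>.\<close>

lemma cov_pos:
  assumes "z \<noteq> 0"
  shows "z \<bullet> (cov x *v z) > 0"
proof -
  have eq: "z \<bullet> (cov x *v z) = (\<Sum>a\<in>A. wt x a * ((a - mean x) \<bullet> z)\<^sup>2)"
    unfolding cov_mult inner_sum_right
    by (simp add: power2_eq_square inner_commute[of z] mult.assoc del: inner_diff_left)
  have nn: "wt x a * ((a - mean x) \<bullet> z)\<^sup>2 \<ge> 0" if "a \<in> A" for a
    using wt_pos[OF that, of x] by simp
  have "z \<bullet> (cov x *v z) \<noteq> 0"
  proof
    assume "z \<bullet> (cov x *v z) = 0"
    then have "wt x a * ((a - mean x) \<bullet> z)\<^sup>2 = 0" if "a \<in> A" for a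
      using that nn unfolding eq by (subst (asm) sum_nonneg_eq_0_iff[OF finite_A]) auto
    then have 0: "(a - mean x) \<bullet> z = 0" if "a \<in> A" for a
      using that wt_pos[OF that, of x] by fastforce
    obtain a0 where a0: "a0 \<in> A" using A_nonempty by blast
    have "z \<bullet> y = 0" if "y \<in> (\<lambda>a. a - a0) ` A" for y
      using that 0 a0 by (auto simp: inner_diff_left inner_diff_right inner_commute)
    then have "z \<bullet> y = 0" for y
      using span_diffs[OF a0] orthogonal_to_span[of y "(\<lambda>a. a - a0) ` A" z]
      by (auto simp: orthogonal_def)
    then show False using assms by (metis inner_eq_zero_iff)
  qed
  moreover have "z \<bullet> (cov x *v z) \<ge> 0" unfolding eq by (intro sum_nonneg nn)
  ultimately show ?thesis by simp
qed

lemma det_cov_pos: "det (cov x) > 0"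
proof -
  obtain T :: "real^'m^'m" where T: "transpose T ** cov x ** T = mat 1"
    using congruent_to_identity[OF transpose_cov cov_pos] by metis
  have "det T * det T * det (cov x) = 1"
    using arg_cong[OF T, of det] by (simp add: det_mul det_transpose mult_ac)
  then show ?thesis
    by (smt (verit) mult_nonneg_nonpos zero_le_square)
qed

lemma continuous_on_Z: "continuous_on UNIV Z"
  unfolding Z_def by (intro continuous_intros)

lemma continuous_on_cov: "continuous_on UNIV cov"
proof -
  have wt: "continuous_on UNIV (\<lambda>x. wt x a)" for a
    unfolding wt_def using Z_pos by (intro continuous_intros continuous_on_Z) (metis less_irrefl)
  have mean: "continuous_on UNIV mean"
    unfolding mean_def by (intro continuous_intros wt)
  show ?thesis
    unfolding cov_def by (intro continuous_intros wt mean)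
qed

end

subsection \<open>The Kac--Rice formula\<close>

context exp_family
begin

definition ratio :: "real^'m \<Rightarrow> real^'m \<Rightarrow> real^'m \<Rightarrow> real" where
  "ratio a0 x a = \<alpha> a * exp (a \<bullet> x) / (\<alpha> a0 * exp (a0 \<bullet> x))"

text \<open>Covariance as second moment minus product of means, taken about \<open>a0\<close>. The
  weights are \<open>(ratio a0 x a)\<^sup>2 / U\<close>, so \<open>m\<close> is \<open>U\<close>
  times the mean of \<open>a - a0\<close>; this is the Schur complement that
  \<open>gaussian_row_density\<close> asks for.\<close>

lemma cov_mult_shifted:
  fixes a0 x
  defines "U \<equiv> 1 + (\<Sum>a\<in>A - {a0}. (ratio a0 x a)\<^sup>2)"
    and "c \<equiv> (\<lambda>a. ratio a0 x a *\<^sub>R (a - a0))"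
    and "m \<equiv> (\<Sum>a\<in>A - {a0}. ratio a0 x a *\<^sub>R (ratio a0 x a *\<^sub>R (a - a0)))"
  assumes a0: "a0 \<in> A"
  shows "U *\<^sub>R (cov x *v z) = (\<Sum>a\<in>A - {a0}. (c a \<bullet> z) *\<^sub>R c a) - ((m \<bullet> z) / U) *\<^sub>R m"
proof -
  define v where "v a = \<alpha> a * exp (a \<bullet> x)" for a
  have v0: "v a0 > 0" using pos[OF a0] by (simp add: v_def)
  have r: "ratio a0 x a = v a / v a0" for a by (simp add: ratio_def v_def)
  have r0: "ratio a0 x a0 = 1" using v0 by (simp add: r)
  \<comment> \<open>The summand 1 in \<open>U\<close> is the term of \<open>a0\<close>. In the two
    other sums that term vanishes, so all three may run over \<open>A\<close>.\<close>
  have UA: "U = (\<Sum>a\<in>A. (ratio a0 x a)\<^sup>2)"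
    unfolding U_def by (subst sum.remove[OF finite_A a0]) (simp add: r0)
  have UZ: "U = Z x / (v a0)\<^sup>2"
    unfolding UA Z_def by (simp add: r v_def power_divide sum_divide_distrib)
  have U: "U > 0" using UZ v0 Z_pos[of x] by simp
  have w: "wt x a = (ratio a0 x a)\<^sup>2 / U" for a
    using v0 Z_pos[of x] by (simp add: UZ wt_def r v_def[symmetric] power_divide)
  have mA: "m = (\<Sum>a\<in>A. (U * wt x a) *\<^sub>R (a - a0))"
    unfolding m_def using U by (subst sum.remove[OF finite_A a0]) (simp add: w power2_eq_square)
  have cA: "(\<Sum>a\<in>A - {a0}. (c a \<bullet> z) *\<^sub>R c a) = (\<Sum>a\<in>A. (U * wt x a * ((a - a0) \<bullet> z)) *\<^sub>R (a - a0))"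
    using U by (subst sum.remove[OF finite_A a0]) (simp add: w power2_eq_square c_def mult_ac)
  define \<mu> where "\<mu> = mean x - a0"
  have m\<mu>: "m = U *\<^sub>R \<mu>"
  proof -
    have "m = U *\<^sub>R (\<Sum>a\<in>A. wt x a *\<^sub>R a - wt x a *\<^sub>R a0)"
      unfolding mA by (simp add: scaleR_sum_right scaleR_diff_right)
    also have "(\<Sum>a\<in>A. wt x a *\<^sub>R a - wt x a *\<^sub>R a0) = \<mu>"
      by (simp add: \<mu>_def mean_def sum_subtractf sum_wt flip: scaleR_sum_left)
    finally show ?thesis .
  qed
  have s\<mu>: "(\<Sum>a\<in>A. wt x a *\<^sub>R (a - a0)) = \<mu>"
    by (simp add: \<mu>_def mean_def scaleR_diff_right sum_subtractf sum_wt flip: scaleR_sum_left)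
  have s\<mu>z: "(\<Sum>a\<in>A. wt x a * ((a - a0) \<bullet> z)) = \<mu> \<bullet> z"
    unfolding s\<mu>[symmetric] inner_sum_left by simp
  have "cov x *v z = (\<Sum>a\<in>A. (wt x a * ((a - a0 - \<mu>) \<bullet> z)) *\<^sub>R (a - a0 - \<mu>))"
    by (simp add: cov_mult \<mu>_def)
  also have "\<dots> = (\<Sum>a\<in>A. (wt x a * ((a - a0) \<bullet> z)) *\<^sub>R (a - a0) - (\<mu> \<bullet> z) *\<^sub>R (wt x a *\<^sub>R (a - a0))
      - (wt x a * ((a - a0) \<bullet> z)) *\<^sub>R \<mu> + (wt x a) *\<^sub>R ((\<mu> \<bullet> z) *\<^sub>R \<mu>))"
  proof (rule sum.cong)
    fix a
    define b where "b = a - a0"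
    show "(wt x a * ((a - a0 - \<mu>) \<bullet> z)) *\<^sub>R (a - a0 - \<mu>) = (wt x a * ((a - a0) \<bullet> z)) *\<^sub>R (a - a0) - (\<mu> \<bullet> z) *\<^sub>R (wt x a *\<^sub>R (a - a0))
      - (wt x a * ((a - a0) \<bullet> z)) *\<^sub>R \<mu> + (wt x a) *\<^sub>R ((\<mu> \<bullet> z) *\<^sub>R \<mu>)"
      unfolding b_def[symmetric]
      by (simp add: inner_diff_left scaleR_diff_left scaleR_diff_right right_diff_distrib mult.commute)
  qed simp
  also have "\<dots> = (\<Sum>a\<in>A. (wt x a * ((a - a0) \<bullet> z)) *\<^sub>R (a - a0)) - (\<mu> \<bullet> z) *\<^sub>R (\<Sum>a\<in>A. wt x a *\<^sub>R (a - a0))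
      - (\<Sum>a\<in>A. wt x a * ((a - a0) \<bullet> z)) *\<^sub>R \<mu> + (\<Sum>a\<in>A. wt x a) *\<^sub>R ((\<mu> \<bullet> z) *\<^sub>R \<mu>)"
    by (simp only: sum.distrib sum_subtractf scaleR_sum_left scaleR_sum_right)
  also have "\<dots> = (\<Sum>a\<in>A. (wt x a * ((a - a0) \<bullet> z)) *\<^sub>R (a - a0)) - (\<mu> \<bullet> z) *\<^sub>R \<mu>"
    unfolding s\<mu> s\<mu>z sum_wt by simp
  finally have "U *\<^sub>R (cov x *v z) = (\<Sum>a\<in>A. (U * wt x a * ((a - a0) \<bullet> z)) *\<^sub>R (a - a0)) - (U * (\<mu> \<bullet> z)) *\<^sub>R \<mu>"
    by (simp add: scaleR_diff_right scaleR_sum_right mult.assoc)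
  then show ?thesis using U by (simp add: cA m\<mu>)
qed

lemma span_ratio_diffs:
  assumes a0: "a0 \<in> A"
  shows "span ((\<lambda>a. ratio a0 x a *\<^sub>R (a - a0)) ` (A - {a0})) = UNIV"
proof -
  let ?S = "span ((\<lambda>a. ratio a0 x a *\<^sub>R (a - a0)) ` (A - {a0}))"
  have "a - a0 \<in> ?S" if a: "a \<in> A" for a
  proof (cases "a = a0")
    case True
    then show ?thesis by (simp add: span_zero)
  next
    case False
    have "ratio a0 x a > 0" using pos[OF a0] pos[OF a] by (simp add: ratio_def)
    then have "a - a0 = inverse (ratio a0 x a) *\<^sub>R (ratio a0 x a *\<^sub>R (a - a0))" by simp
    also have "\<dots> \<in> ?S" using False a by (intro span_scale span_base) auto
    finally show ?thesis .
  qed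
  then have "span ((\<lambda>a. a - a0) ` A) \<subseteq> ?S" by (intro span_minimal) auto
  then show ?thesis using span_diffs[OF a0] by auto
qed

text \<open>The reciprocal of the Cauchy integral in dimension m, equal to 2 / s_m.\<close>

definition rice_const :: real where
  "rice_const = Gamma ((real CARD('m) + 1) / 2) / pi powr ((real CARD('m) + 1) / 2)"

lemma rice_const_pos: "rice_const > 0"
  unfolding rice_const_def by (intro divide_pos_pos Gamma_real_pos) (auto simp: add_pos_nonneg)

lemma measurable_component_std_gauss:
  "b \<in> B \<Longrightarrow> (\<lambda>\<eta>. \<eta> b) \<in> borel_measurable (gauss_PiM B)"
  using measurable_component_singleton[of b B "\<lambda>_. std_gauss"] by simp

text \<open>The integrand of the zero count at a fixed \<open>x\<close>. The rows are independent,
  so \<open>gaussian_row_density\<close> replaces each by its density at value 0, and the moment of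
  the absolute determinant evaluates the rest.\<close>

lemma rice_density:
  assumes a0: "a0 \<in> A"
  shows "(\<integral>\<^sup>+\<eta>. (\<Prod>i\<in>UNIV. gauss_density (\<Sum>a\<in>A - {a0}. \<eta> i a * ratio a0 x a)) *
      ennreal \<bar>det (\<chi> i. \<Sum>a\<in>A - {a0}. \<eta> i a *\<^sub>R (ratio a0 x a *\<^sub>R (a - a0)))\<bar>
      \<partial>Pi\<^sub>M UNIV (\<lambda>_::'m. gauss_PiM (A - {a0}))) = ennreal (rice_const * sqrt (det (cov x)))"
proof -
  define B where "B = A - {a0}"
  define u where "u = ratio a0 x"
  define c where "c a = u a *\<^sub>R (a - a0)" for a
  have finB: "finite B" using finite_A by (simp add: B_def)
  interpret PB: prob_space "gauss_PiM B"
    by (intro prob_space_PiM prob_space_std_gauss)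
  define U where "U = 1 + (\<Sum>a\<in>B. (u a)\<^sup>2)"
  have U: "U > 0" unfolding U_def by (intro add_pos_nonneg sum_nonneg) auto
  have spanc: "span (c ` B) = UNIV"
    using span_ratio_diffs[OF a0, of x] by (simp add: c_def[abs_def] u_def B_def)
  have Cm: "U *\<^sub>R (cov x *v z) = (\<Sum>a\<in>B. (c a \<bullet> z) *\<^sub>R c a) - (((\<Sum>a\<in>B. u a *\<^sub>R c a) \<bullet> z) / U) *\<^sub>R (\<Sum>a\<in>B. u a *\<^sub>R c a)" for z
    using cov_mult_shifted[OF a0, of x z] by (simp only: U_def B_def u_def c_def)
  obtain K :: real and S :: "real^'m^'m" where K: "K > 0" and S: "det S \<noteq> 0" "(det S)\<^sup>2 * U ^ CARD('m) * det (cov x) = 1"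
    and KS: "K * (sqrt (2 * pi) * sqrt U) * sqrt (2 * pi) ^ CARD('m) = \<bar>det S\<bar>"
    and law: "\<And>f. f \<in> borel_measurable borel \<Longrightarrow>
      (\<integral>\<^sup>+\<eta>. f (\<Sum>a\<in>B. \<eta> a *\<^sub>R c a) * gauss_density (\<Sum>a\<in>B. \<eta> a * u a) \<partial>gauss_PiM B) =
      (\<integral>\<^sup>+r. f r * ennreal (K * exp (- (norm (S *v r))\<^sup>2 / 2)) \<partial>lborel)"
  proof (rule gaussian_row_density[OF finB spanc transpose_cov[of x] cov_pos, of u, folded U_def])
  qed (assumption, rule Cm, rule that, assumption+)
  let ?I = "\<integral>\<^sup>+r. ennreal \<bar>det (\<chi> i. r i)\<bar> * (\<Prod>i\<in>UNIV. ennreal (exp (- (norm (S *v r i))\<^sup>2 / 2))) \<partial>Pi\<^sub>M UNIV (\<lambda>_::'m. lborel)"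
  have [measurable]: "(\<lambda>r. r i) \<in> borel_measurable (Pi\<^sub>M UNIV (\<lambda>_::'m. lborel :: (real^'m) measure))" for i
    using measurable_component_singleton[of i UNIV "\<lambda>_. lborel"] by simp
  have [measurable]: "a \<in> B \<Longrightarrow> (\<lambda>\<eta>. \<eta> a) \<in> borel_measurable (gauss_PiM B)" for a
    by (rule measurable_component_std_gauss)
  have "(\<integral>\<^sup>+\<eta>. (\<Prod>i\<in>UNIV. gauss_density (\<Sum>a\<in>B. \<eta> i a * u a)) *
      ennreal \<bar>det (\<chi> i. (\<lambda>i\<in>UNIV. \<Sum>a\<in>B. \<eta> i a *\<^sub>R c a) i)\<bar> \<partial>Pi\<^sub>M UNIV (\<lambda>_::'m. gauss_PiM B)) =
      (\<integral>\<^sup>+r. (\<Prod>i\<in>UNIV. ennreal (K * exp (- (norm (S *v r i))\<^sup>2 / 2))) * ennreal \<bar>det (\<chi> i. r i)\<bar> \<partial>Pi\<^sub>M UNIV (\<lambda>_::'m. lborel))"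
  proof (rule nn_integral_PiM_transfer[where T = "\<lambda>_ \<eta>. \<Sum>a\<in>B. \<eta> a *\<^sub>R c a" and h = "\<lambda>_ \<eta>. gauss_density (\<Sum>a\<in>B. \<eta> a * u a)"
        and p = "\<lambda>_ r. ennreal (K * exp (- (norm (S *v r))\<^sup>2 / 2))" and F = "\<lambda>r. ennreal \<bar>det (\<chi> i. r i)\<bar>"])
    fix f :: "real^'m \<Rightarrow> ennreal" assume "f \<in> borel_measurable lborel"
    then show "(\<integral>\<^sup>+\<eta>. gauss_density (\<Sum>a\<in>B. \<eta> a * u a) * f (\<Sum>a\<in>B. \<eta> a *\<^sub>R c a) \<partial>gauss_PiM B) =
        (\<integral>\<^sup>+r. ennreal (K * exp (- (norm (S *v r))\<^sup>2 / 2)) * f r \<partial>lborel)"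
      using law[of f] by (simp add: mult.commute)
  qed (auto intro: sigma_finite_lborel PB.sigma_finite_measure_axioms)
  also have "\<dots> = (\<integral>\<^sup>+r. ennreal (K ^ CARD('m)) * (ennreal \<bar>det (\<chi> i. r i)\<bar> * (\<Prod>i\<in>UNIV. ennreal (exp (- (norm (S *v r i))\<^sup>2 / 2)))) \<partial>Pi\<^sub>M UNIV (\<lambda>_::'m. lborel))"
    using K by (intro nn_integral_cong) (simp add: ennreal_mult prod.distrib ennreal_power mult_ac)
  also have "\<dots> = ennreal (K ^ CARD('m)) * ?I"
    by (rule nn_integral_cmult) measurable
  also have "?I =
      ennreal (sqrt (2 * pi) ^ (CARD('m) * (CARD('m) + 1)) * rice_const / \<bar>det S\<bar> ^ (CARD('m) + 1))"
  proof (rule ennreal_divide_cancel)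
    show "ennreal (\<bar>det S\<bar> ^ (CARD('m) + 1)) * ?I =
        ennreal (sqrt (2 * pi) ^ (CARD('m) * (CARD('m) + 1)) * rice_const)"
      unfolding abs_det_moment_form[OF S(1)] abs_det_moment_eq rice_const_def ..
  qed (use S(1) rice_const_pos in auto)
  also have "ennreal (K ^ CARD('m)) * ennreal (sqrt (2 * pi) ^ (CARD('m) * (CARD('m) + 1)) * rice_const / \<bar>det S\<bar> ^ (CARD('m) + 1)) =
      ennreal (K ^ CARD('m) * (sqrt (2 * pi) ^ (CARD('m) * (CARD('m) + 1)) * rice_const / \<bar>det S\<bar> ^ (CARD('m) + 1)))"
    using K rice_const_pos by (intro ennreal_mult[symmetric]) auto
  also have "K ^ CARD('m) * (sqrt (2 * pi) ^ (CARD('m) * (CARD('m) + 1)) * rice_const / \<bar>det S\<bar> ^ (CARD('m) + 1)) = rice_const * sqrt (det (cov x))"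
  proof -
    \<comment> \<open>Apart from powers of \<open>q\<close>, which cancel, \<open>K ^ n\<close>
      supplies \<open>d ^ n / sqrt U ^ n\<close> and the moment \<open>1 / d ^ (n + 1)\<close>. The
      quotient \<open>1 / (d * sqrt U ^ n)\<close> equals \<open>sqrt (det (cov x))\<close>, so the
      dependence on \<open>a0\<close> through \<open>U\<close> disappears.\<close>
    define d where "d = \<bar>det S\<bar>"
    define q where "q = sqrt (2 * pi)"
    define n where "n = CARD('m)"
    have d: "d > 0" using S(1) by (simp add: d_def)
    have q: "q > 0" by (simp add: q_def)
    have sU: "sqrt U > 0" using U by simp
    have "K * (q ^ (n + 1) * sqrt U) = d" using KS by (simp add: d_def q_def n_def mult_ac)
    then have "(K * (q ^ (n + 1) * sqrt U)) ^ n = d ^ n" by simp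
    then have 1: "K ^ n * q ^ (n * (n + 1)) * sqrt U ^ n = d ^ n"
      by (simp only: power_mult_distrib power_mult[symmetric] mult.commute[of n] mult.assoc)
    have "d * sqrt U ^ n * sqrt (det (cov x)) = sqrt ((d * sqrt U ^ n * sqrt (det (cov x)))\<^sup>2)"
      using d sU det_cov_pos[of x] by simp
    also have "(d * sqrt U ^ n * sqrt (det (cov x)))\<^sup>2 = d\<^sup>2 * ((sqrt U)\<^sup>2) ^ n * det (cov x)"
      using det_cov_pos[of x] by (simp add: power_mult_distrib flip: power_mult) (simp add: mult.commute)
    also have "\<dots> = 1" using S(2) U by (simp add: d_def n_def)
    finally have 2: "d * sqrt U ^ n * sqrt (det (cov x)) = 1" by simp
    have "K ^ n * (q ^ (n * (n + 1)) * rice_const / d ^ (n + 1)) =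
        (K ^ n * q ^ (n * (n + 1))) * rice_const / d ^ (n + 1) * (d * sqrt U ^ n * sqrt (det (cov x)))"
      unfolding 2 by simp
    also have "\<dots> = (K ^ n * q ^ (n * (n + 1)) * sqrt U ^ n) * (d * (rice_const * sqrt (det (cov x)))) / d ^ (n + 1)"
      by (simp only: mult_ac times_divide_eq_left times_divide_eq_right)
    also have "\<dots> = rice_const * sqrt (det (cov x))"
      unfolding 1 using d by simp
    finally show ?thesis unfolding d_def q_def n_def .
  qed
  finally show ?thesis by (simp add: B_def u_def c_def)
qed

lemma measurable_zero_count:
  "(\<lambda>\<omega>. num_elems {x. \<forall>i. (\<Sum>a\<in>A. \<omega> i a * \<alpha> a * exp (a \<bullet> x)) = 0})
    \<in> borel_measurable (Pi\<^sub>M UNIV (\<lambda>_::'m. gauss_PiM A))"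
proof -
  have [measurable]: "a \<in> A \<Longrightarrow> (\<lambda>\<eta>. \<eta> a) \<in> borel_measurable (gauss_PiM A)" for a
    by (rule measurable_component_std_gauss)
  \<comment> \<open>The equations become one vector equation, as
    \<open>measurable_card_zeros\<close> needs.\<close>
  define h :: "('m \<Rightarrow> real^'m \<Rightarrow> real) \<Rightarrow> real^'m \<Rightarrow> real^'m"
    where "h \<omega> x = (\<Sum>i\<in>UNIV. (\<Sum>a\<in>A. \<omega> i a * \<alpha> a * exp (a \<bullet> x)) *\<^sub>R axis i 1)" for \<omega> x
  have hi: "h \<omega> x $ i = (\<Sum>a\<in>A. \<omega> i a * \<alpha> a * exp (a \<bullet> x))" for \<omega> x i
    by (simp add: h_def sum_component axis_def if_distrib[of "\<lambda>z. _ * z"] cong: if_cong)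
  have "{x. \<forall>i. (\<Sum>a\<in>A. \<omega> i a * \<alpha> a * exp (a \<bullet> x)) = 0} = {x. h \<omega> x = 0}" for \<omega>
    by (simp add: vec_eq_iff hi)
  moreover have "(\<lambda>\<omega>. num_elems {x. h \<omega> x = 0}) \<in> borel_measurable (Pi\<^sub>M UNIV (\<lambda>_::'m. gauss_PiM A))"
  proof (rule measurable_card_zeros)
    show "(\<lambda>\<omega>. h \<omega> x) \<in> borel_measurable (Pi\<^sub>M UNIV (\<lambda>_::'m. gauss_PiM A))" for x
      unfolding h_def by measurable
    show "continuous_on UNIV (h \<omega>)" for \<omega>
      unfolding h_def by (intro continuous_intros)
  qed
  ultimately show ?thesis by presburger
qed

text \<open>
  For a fixed \<open>a0\<close> the system is solved for the coefficients of \<open>exp (a0 \<bullet> x)\<close>: they are a function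
  \<open>G\<close> of \<open>x\<close>, the zeros are the fibres of \<open>G\<close>, and the area formula applies.
\<close>

theorem kac_rice:
  "(\<integral>\<^sup>+\<omega>. num_elems {x. \<forall>i. (\<Sum>a\<in>A. \<omega> i a * \<alpha> a * exp (a \<bullet> x)) = 0}
      \<partial>Pi\<^sub>M UNIV (\<lambda>_::'m. gauss_PiM A)) =
   (\<integral>\<^sup>+x. ennreal (rice_const * sqrt (det (cov x))) \<partial>lborel)"
proof -
  obtain a0 where a0: "a0 \<in> A" using A_nonempty by blast
  let ?\<nu> = "Pi\<^sub>M UNIV (\<lambda>_::'m. gauss_PiM A)"
  define B where "B = A - {a0}"
  let ?\<mu> = "Pi\<^sub>M UNIV (\<lambda>_::'m. gauss_PiM B)"
  have finB: "finite B" and a0B: "a0 \<notin> B" and AB: "insert a0 B = A"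
    using finite_A a0 by (auto simp: B_def)
  interpret G: prob_space std_gauss by (rule prob_space_std_gauss)
  interpret PPB: prob_space "?\<mu>"
    by (intro prob_space_PiM prob_space_std_gauss)
  interpret pair_sigma_finite "?\<mu>" "lborel :: (real^'m) measure"
    unfolding pair_sigma_finite_def by (intro conjI sigma_finite_lborel PPB.sigma_finite_measure_axioms)
  have [measurable]: "a \<in> B \<Longrightarrow> (\<lambda>\<eta>. \<eta> a) \<in> borel_measurable (gauss_PiM B)" for a
    by (rule measurable_component_std_gauss)
  have [measurable]: "a \<in> A \<Longrightarrow> (\<lambda>\<eta>. \<eta> a) \<in> borel_measurable (gauss_PiM A)" for a
    by (rule measurable_component_std_gauss)
  define u where "u = ratio a0"
  have u: "u x a = \<alpha> a / \<alpha> a0 * exp ((a - a0) \<bullet> x)" for x a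
    by (simp add: u_def ratio_def exp_diff inner_diff_left)
  have contu: "continuous_on UNIV (\<lambda>x. u x a)" for a
    unfolding u by (intro continuous_intros)
  define N where "N \<omega> = num_elems {x. \<forall>i. (\<Sum>a\<in>A. \<omega> i a * \<alpha> a * exp (a \<bullet> x)) = 0}"
    for \<omega> :: "'m \<Rightarrow> real^'m \<Rightarrow> real"
  have [measurable]: "N \<in> borel_measurable (?\<nu>)"
    unfolding N_def by (rule measurable_zero_count)
  define G where "G \<eta> x = (\<chi> i. - (\<Sum>a\<in>B. \<eta> i a * u x a))" for \<eta> :: "'m \<Rightarrow> real^'m \<Rightarrow> real" and x
  define D where "D \<eta> x = (-1) *\<^sub>R (\<chi> i. \<Sum>a\<in>B. \<eta> i a *\<^sub>R (u x a *\<^sub>R (a - a0)))" for \<eta> :: "'m \<Rightarrow> real^'m \<Rightarrow> real" and x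
  define \<psi> where "\<psi> y = ennreal (inverse (sqrt (2 * pi)) ^ CARD('m) * exp (- (norm y)\<^sup>2 / 2))" for y :: "real^'m"
  have [measurable]: "\<psi> \<in> borel_measurable borel" unfolding \<psi>_def by measurable
  have derG: "(G \<eta> has_derivative (\<lambda>h. D \<eta> x *v h)) (at x)" for \<eta> x
  proof -
    have "((\<lambda>x. - (\<Sum>a\<in>B. \<eta> i a * u x a)) has_derivative
        (\<lambda>h. - (\<Sum>a\<in>B. \<eta> i a * (\<alpha> a / \<alpha> a0 * (exp ((a - a0) \<bullet> x) * ((a - a0) \<bullet> h)))))) (at x)" for i
      unfolding u using pos[OF a0] by (auto intro!: derivative_eq_intros simp: mult_ac)
    moreover have "- (\<Sum>a\<in>B. \<eta> i a * (\<alpha> a / \<alpha> a0 * (exp ((a - a0) \<bullet> x) * ((a - a0) \<bullet> h)))) = (D \<eta> x *v h) $ i" for i h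
    proof -
      have "(D \<eta> x *v h) $ i = - ((\<Sum>a\<in>B. \<eta> i a *\<^sub>R (u x a *\<^sub>R (a - a0))) \<bullet> h)"
        by (simp add: D_def matrix_vector_mult_def inner_vec_def sum_negf)
      then show ?thesis by (simp add: inner_sum_left u mult_ac)
    qed
    ultimately have "((\<lambda>x. G \<eta> x $ i) has_derivative (\<lambda>h. (D \<eta> x *v h) $ i)) (at x)" for i
      by (simp add: G_def)
    then show ?thesis
      by (subst has_derivative_componentwise_within) (auto simp: Basis_vec_def inner_axis)
  qed
  have contD: "continuous_on UNIV (D \<eta>)" for \<eta>
    unfolding D_def by (intro continuous_intros contu)
  have inner: "(\<integral>\<^sup>+y. N (\<lambda>i\<in>UNIV. (\<eta> i)(a0 := y i)) \<partial>Pi\<^sub>M UNIV (\<lambda>_::'m. std_gauss)) =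
      (\<integral>\<^sup>+x. ennreal \<bar>det (D \<eta> x)\<bar> * \<psi> (G \<eta> x) \<partial>lborel)" for \<eta>
  proof -
    have contG: "continuous_on UNIV (G \<eta>)"
      using derG by (meson continuous_at_imp_continuous_on has_derivative_continuous)
    define F where "F y = num_elems {x. G \<eta> x = y}" for y
    have [measurable]: "F \<in> borel_measurable borel"
      unfolding F_def using measurable_card_zeros[of "\<lambda>y x. G \<eta> x - y" borel] contG
      by (simp add: continuous_on_diff)
    \<comment> \<open>Divided by the positive number
      \<open>\<alpha> a0 * exp (a0 \<bullet> x)\<close>, the equation of row \<open>i\<close> reads
      \<open>G \<eta> x $ i = y i\<close>.\<close>
    have NF: "N (\<lambda>i\<in>UNIV. (\<eta> i)(a0 := y i)) = F (\<chi> i. y i)" for y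
    proof -
      have "(\<Sum>a\<in>A. ((\<lambda>i\<in>UNIV. (\<eta> i)(a0 := y i)) i) a * \<alpha> a * exp (a \<bullet> x)) = 0 \<longleftrightarrow> G \<eta> x $ i = y i" for x i
      proof -
        have v0: "\<alpha> a0 * exp (a0 \<bullet> x) > 0" using pos[OF a0] by simp
        have "(\<Sum>a\<in>A. ((\<lambda>i\<in>UNIV. (\<eta> i)(a0 := y i)) i) a * \<alpha> a * exp (a \<bullet> x)) =
            y i * (\<alpha> a0 * exp (a0 \<bullet> x)) + (\<Sum>a\<in>B. \<eta> i a * \<alpha> a * exp (a \<bullet> x))"
          unfolding AB[symmetric] using a0B finB by (auto intro!: sum.cong simp: mult.assoc)
        also have "(\<Sum>a\<in>B. \<eta> i a * \<alpha> a * exp (a \<bullet> x)) = (\<Sum>a\<in>B. \<eta> i a * u x a) * (\<alpha> a0 * exp (a0 \<bullet> x))"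
        proof -
          have "u x a * (\<alpha> a0 * exp (a0 \<bullet> x)) = \<alpha> a * exp (a \<bullet> x)" for a
            unfolding u_def ratio_def using v0 by (metis eq_divide_eq less_irrefl)
          then show ?thesis by (simp add: sum_distrib_right mult.assoc)
        qed
        finally have "(\<Sum>a\<in>A. ((\<lambda>i\<in>UNIV. (\<eta> i)(a0 := y i)) i) a * \<alpha> a * exp (a \<bullet> x)) =
            (y i + (\<Sum>a\<in>B. \<eta> i a * u x a)) * (\<alpha> a0 * exp (a0 \<bullet> x))" by (simp only: distrib_right)
        then show ?thesis using v0 by (auto simp: G_def)
      qed
      then show ?thesis by (simp only: N_def F_def vec_eq_iff vec_lambda_beta)
    qed
    have "(\<integral>\<^sup>+y. N (\<lambda>i\<in>UNIV. (\<eta> i)(a0 := y i)) \<partial>Pi\<^sub>M UNIV (\<lambda>_::'m. std_gauss)) =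
        (\<integral>\<^sup>+y. F (\<chi> i. y (id i)) \<partial>Pi\<^sub>M (range id) (\<lambda>_::'m. std_gauss))"
      unfolding NF by simp
    also have "\<dots> = (\<integral>\<^sup>+y. \<psi> y * F y \<partial>lborel)"
      unfolding \<psi>_def by (rule nn_integral_PiM_std_gauss_reindex) auto
    also have "\<dots> = (\<integral>\<^sup>+x. ennreal \<bar>det (D \<eta> x)\<bar> * \<psi> (G \<eta> x) \<partial>lborel)"
      unfolding F_def by (subst area_formula[OF derG contD, symmetric]) (auto simp: mult.commute)
    finally show ?thesis .
  qed
  have \<psi>G: "\<psi> (G \<eta> x) = (\<Prod>i\<in>UNIV. gauss_density (\<Sum>a\<in>B. \<eta> i a * u x a))" for \<eta> x
  proof -
    have "(norm (G \<eta> x))\<^sup>2 = (\<Sum>i\<in>UNIV. (\<Sum>a\<in>B. \<eta> i a * u x a)\<^sup>2)"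
      by (simp add: norm_vec_def L2_set_def sum_nonneg G_def)
    then have "exp (- (norm (G \<eta> x))\<^sup>2 / 2) = (\<Prod>i\<in>UNIV. exp (- (\<Sum>a\<in>B. \<eta> i a * u x a)\<^sup>2 / 2))"
      by (subst exp_sum[symmetric]) (auto simp: sum_negf simp flip: sum_divide_distrib)
    moreover have "std_normal_density y = inverse (sqrt (2 * pi)) * exp (- y\<^sup>2 / 2)" for y
      by (simp add: std_normal_density_def inverse_eq_divide)
    ultimately have "inverse (sqrt (2 * pi)) ^ CARD('m) * exp (- (norm (G \<eta> x))\<^sup>2 / 2) =
        (\<Prod>i\<in>UNIV. std_normal_density (\<Sum>a\<in>B. \<eta> i a * u x a))"
      by (simp only: prod.distrib prod_constant)
    then show ?thesis unfolding \<psi>_def by (subst prod_ennreal) auto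
  qed
  have detD: "\<bar>det (D \<eta> x)\<bar> = \<bar>det (\<chi> i. \<Sum>a\<in>B. \<eta> i a *\<^sub>R (u x a *\<^sub>R (a - a0)))\<bar>" for \<eta> x
    unfolding D_def det_scaleR by (simp add: abs_mult)
  have "(\<integral>\<^sup>+\<omega>. N \<omega> \<partial>?\<nu>) =
      (\<integral>\<^sup>+\<eta>. \<integral>\<^sup>+y. N (\<lambda>i\<in>UNIV. (\<eta> i)(a0 := y i)) \<partial>Pi\<^sub>M UNIV (\<lambda>_::'m. std_gauss) \<partial>?\<mu>)"
    using nn_integral_PiM_PiM_insert[of "UNIV :: 'm set" B a0 "\<lambda>_. std_gauss" N] finB a0B
    by (simp add: AB G.sigma_finite_measure_axioms)
  also have "\<dots> = (\<integral>\<^sup>+\<eta>. \<integral>\<^sup>+x. \<psi> (G \<eta> x) * ennreal \<bar>det (D \<eta> x)\<bar> \<partial>lborel \<partial>?\<mu>)"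
    unfolding inner by (simp add: mult.commute)
  also have "\<dots> = (\<integral>\<^sup>+x. \<integral>\<^sup>+\<eta>. \<psi> (G \<eta> x) * ennreal \<bar>det (D \<eta> x)\<bar> \<partial>?\<mu> \<partial>lborel)"
  proof (rule Fubini'[symmetric])
    let ?Q = "?\<mu> \<Otimes>\<^sub>M (lborel :: (real^'m) measure)"
    have c1 [measurable]: "a \<in> B \<Longrightarrow> (\<lambda>p. fst p i a) \<in> borel_measurable ?Q" for i a
      by (rule measurable_compose[OF measurable_fst]) measurable
    have "(\<lambda>x. u x a) \<in> borel_measurable borel" for a
      by (rule borel_measurable_continuous_onI[OF contu])
    then have c2 [measurable]: "(\<lambda>p. u (snd p) a) \<in> borel_measurable ?Q" for a
      by (intro measurable_compose[OF measurable_snd]) simp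
    have m1: "(\<lambda>p. \<psi> (G (fst p) (snd p))) \<in> borel_measurable ?Q"
      unfolding \<psi>G by measurable
    have "(\<lambda>p. D (fst p) (snd p) $ i $ j) \<in> borel_measurable ?Q" for i j
      unfolding D_def by (simp add: sum_component)
    then have m2: "(\<lambda>p. det (D (fst p) (snd p))) \<in> borel_measurable ?Q"
      unfolding det_def by simp
    show "(\<lambda>(\<eta>, x). \<psi> (G \<eta> x) * ennreal \<bar>det (D \<eta> x)\<bar>) \<in> borel_measurable ?Q"
      unfolding split_beta' using m1 m2 by measurable
  qed
  also have "\<dots> = (\<integral>\<^sup>+x. ennreal (rice_const * sqrt (det (cov x))) \<partial>lborel)"
    unfolding \<psi>G detD using rice_density[OF a0] by (simp only: B_def u_def)
  finally show ?thesis by (simp only: N_def)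
qed

end

subsection \<open>The Legendre transform\<close>

context exp_family
begin

definition pot :: "real^'m \<Rightarrow> real" where
  "pot x = 1 / 2 * ln (Z x)"

lemma has_derivative_Z: "(Z has_derivative (\<lambda>h. 2 * Z x * (mean x \<bullet> h))) (at x)"
proof -
  have "(Z has_derivative (\<lambda>h. \<Sum>a\<in>A. 2 * (\<alpha> a * exp (a \<bullet> x))\<^sup>2 * (a \<bullet> h))) (at x)"
    unfolding Z_def[abs_def] by (auto intro!: derivative_eq_intros simp: power2_eq_square mult_ac)
  moreover have "(\<Sum>a\<in>A. 2 * (\<alpha> a * exp (a \<bullet> x))\<^sup>2 * (a \<bullet> h)) = 2 * Z x * (mean x \<bullet> h)" for h
  proof -
    have "(\<alpha> a * exp (a \<bullet> x))\<^sup>2 = Z x * wt x a" for a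
      using Z_pos[of x] by (simp add: wt_def)
    then show ?thesis by (simp add: mean_def inner_sum_left sum_distrib_left mult.assoc)
  qed
  ultimately show ?thesis by simp
qed

lemma has_derivative_pot: "(pot has_derivative (\<lambda>h. mean x \<bullet> h)) (at x)"
  unfolding pot_def[abs_def]
  using Z_pos[of x] by (auto intro!: derivative_eq_intros has_derivative_Z)

lemma has_derivative_wt: "((\<lambda>x. wt x a) has_derivative (\<lambda>h. 2 * wt x a * ((a - mean x) \<bullet> h))) (at x)"
proof -
  have "((\<lambda>x. wt x a) has_derivative (\<lambda>h. (2 * (\<alpha> a * exp (a \<bullet> x))\<^sup>2 * (a \<bullet> h) * Z x -
      (\<alpha> a * exp (a \<bullet> x))\<^sup>2 * (2 * Z x * (mean x \<bullet> h))) / (Z x * Z x))) (at x)"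
    unfolding wt_def[abs_def]
    using Z_pos[of x] by (auto intro!: derivative_eq_intros has_derivative_Z simp: power2_eq_square mult_ac)
  moreover have "(2 * e * s * z - e * (2 * z * t)) / (z * z) = 2 * (e / z) * (s - t)" if "z > 0" for e s z t :: real
    using that by (simp add: field_simps)
  ultimately show ?thesis using Z_pos[of x] by (simp add: wt_def inner_diff_left)
qed

text \<open>The factor 2 stems from the squares in the weights: the logarithmic derivative of
  \<open>wt x a\<close> is \<open>2 *\<^sub>R (a - mean x)\<close>.\<close>

lemma has_derivative_mean: "(mean has_derivative (\<lambda>h. (2 *\<^sub>R cov x) *v h)) (at x)"
proof -
  have "(mean has_derivative (\<lambda>h. \<Sum>a\<in>A. (2 * wt x a * ((a - mean x) \<bullet> h)) *\<^sub>R a)) (at x)"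
  proof -
    have "mean = (\<lambda>x. \<Sum>a\<in>A. wt x a *\<^sub>R a)" by (simp add: mean_def fun_eq_iff)
    moreover have "((\<lambda>x. \<Sum>a\<in>A. wt x a *\<^sub>R a) has_derivative (\<lambda>h. \<Sum>a\<in>A. (2 * wt x a * ((a - mean x) \<bullet> h)) *\<^sub>R a)) (at x)"
    proof (rule has_derivative_sum)
      show "((\<lambda>x. wt x a *\<^sub>R a) has_derivative (\<lambda>h. (2 * wt x a * ((a - mean x) \<bullet> h)) *\<^sub>R a)) (at x)" for a
        by (rule bounded_linear.has_derivative[OF bounded_linear_scaleR_left[of a] has_derivative_wt[of a x]])
    qed
    ultimately show ?thesis by simp
  qed
  moreover have "(\<Sum>a\<in>A. (2 * wt x a * ((a - mean x) \<bullet> h)) *\<^sub>R a) = (2 *\<^sub>R cov x) *v h" for h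
  proof -
    have "(\<Sum>a\<in>A. wt x a * ((a - mean x) \<bullet> h)) = (\<Sum>a\<in>A. wt x a *\<^sub>R a) \<bullet> h - (\<Sum>a\<in>A. wt x a) * (mean x \<bullet> h)"
      by (simp add: inner_diff_left right_diff_distrib sum_subtractf inner_sum_left sum_distrib_right)
    also have "\<dots> = 0" by (simp add: mean_def[symmetric] sum_wt)
    \<comment> \<open>Deviations have weighted sum zero, so the outer factor \<open>a\<close> may be
      replaced by \<open>a - mean x\<close>.\<close>
    finally have 0: "(\<Sum>a\<in>A. wt x a * ((a - mean x) \<bullet> h)) = 0" .
    have "(2 *\<^sub>R cov x) *v h = 2 *\<^sub>R (\<Sum>a\<in>A. (wt x a * ((a - mean x) \<bullet> h)) *\<^sub>R a - (wt x a * ((a - mean x) \<bullet> h)) *\<^sub>R mean x)"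
      by (simp only: scaleR_matrix_vector_assoc[symmetric] cov_mult scaleR_diff_right)
    also have "\<dots> = 2 *\<^sub>R (\<Sum>a\<in>A. (wt x a * ((a - mean x) \<bullet> h)) *\<^sub>R a)"
      by (simp add: sum_subtractf 0 flip: scaleR_sum_left)
    finally show ?thesis by (simp only: scaleR_sum_right scaleR_scaleR mult.assoc)
  qed
  ultimately show ?thesis by simp
qed

section \<open>The gradient as a bijection onto the interior of the hull\<close>

lemma inj_mean: "inj mean"
proof (rule injI, rule ccontr)
  fix x y assume eq: "mean x = mean y" and ne: "x \<noteq> y"
  define d where "d = y - x"
  have "d \<noteq> 0" using ne by (simp add: d_def)
  \<comment> \<open>Along the segment from \<open>x\<close> to \<open>y\<close> the component of
    \<open>mean\<close> in direction \<open>d\<close> increases strictly, as \<open>cov\<close> is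
    positive definite.\<close>
  have "mean (x + 0 *\<^sub>R d) \<bullet> d < mean (x + 1 *\<^sub>R d) \<bullet> d"
  proof (rule DERIV_pos_imp_increasing[where f = "\<lambda>t. mean (x + t *\<^sub>R d) \<bullet> d"])
    fix t :: real
    have "((\<lambda>t. mean (x + t *\<^sub>R d) \<bullet> d) has_derivative (\<lambda>s. ((2 *\<^sub>R cov (x + t *\<^sub>R d)) *v (s *\<^sub>R d)) \<bullet> d)) (at t)"
      by (rule has_derivative_inner_left, rule has_derivative_compose[OF _ has_derivative_mean])
         (auto intro!: derivative_eq_intros)
    moreover have "((2 *\<^sub>R cov (x + t *\<^sub>R d)) *v (s *\<^sub>R d)) \<bullet> d = (2 * (d \<bullet> (cov (x + t *\<^sub>R d) *v d))) * s" for s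
      by (simp add: scaleR_matrix_vector_assoc[symmetric] matrix_vector_mult_scaleR inner_commute)
    ultimately have "((\<lambda>t. mean (x + t *\<^sub>R d) \<bullet> d) has_field_derivative 2 * (d \<bullet> (cov (x + t *\<^sub>R d) *v d))) (at t)"
      by (simp add: has_field_derivative_def)
    then show "\<exists>y. ((\<lambda>t. mean (x + t *\<^sub>R d) \<bullet> d) has_real_derivative y) (at t) \<and> 0 < y"
      using cov_pos[OF \<open>d \<noteq> 0\<close>] by (intro exI conjI) auto
  qed simp
  then show False using eq by (simp add: d_def)
qed

text \<open>Otherwise a supporting hyperplane at \<open>mean x\<close> makes the weighted mean of
  the nonnegative numbers \<open>c \<bullet> a - c \<bullet> mean x\<close> zero; all of them
  vanish, and \<open>cov x\<close> annihilates \<open>c\<close>.\<close>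

lemma mean_in_interior: "mean x \<in> interior (convex hull A)"
proof (rule ccontr)
  assume n: "mean x \<notin> interior (convex hull A)"
  have aff: "affine hull (convex hull A) = UNIV" by (simp add: affine_hull_convex_hull full)
  have mem: "mean x \<in> convex hull A"
    unfolding mean_def using wt_pos sum_wt
    by (intro convex_sum[OF finite_A convex_convex_hull]) (auto simp: less_imp_le hull_inc)
  have "mean x \<notin> rel_interior (convex hull A)" using n aff by (simp add: rel_interior_interior)
  then obtain c where c: "c \<noteq> 0" "\<And>y. y \<in> convex hull A \<Longrightarrow> c \<bullet> mean x \<le> c \<bullet> y"
    using supporting_hyperplane_rel_boundary[OF convex_convex_hull mem] by metis
  have nn: "wt x a * (c \<bullet> a - c \<bullet> mean x) \<ge> 0" if "a \<in> A" for a
    using c(2)[of a] wt_pos[OF that, of x] that by (simp add: hull_inc)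
  have "(\<Sum>a\<in>A. wt x a * (c \<bullet> a - c \<bullet> mean x)) = c \<bullet> (\<Sum>a\<in>A. wt x a *\<^sub>R a) - (\<Sum>a\<in>A. wt x a) * (c \<bullet> mean x)"
    by (simp add: right_diff_distrib sum_subtractf inner_sum_right sum_distrib_right)
  also have "\<dots> = 0" by (simp add: mean_def[symmetric] sum_wt)
  finally have z: "wt x a * (c \<bullet> a - c \<bullet> mean x) = 0" if "a \<in> A" for a
    using that nn by (subst (asm) sum_nonneg_eq_0_iff[OF finite_A]) auto
  have "(a - mean x) \<bullet> c = 0" if "a \<in> A" for a
    using z[OF that] wt_pos[OF that, of x] by (simp add: inner_diff_right inner_commute[of _ c])
  then have "cov x *v c = 0" unfolding cov_mult by simp
  then show False using cov_pos[OF c(1), of x] by simp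
qed

text \<open>Moving \<open>p\<close> by \<open>\<epsilon>\<close> in the direction of
  \<open>x\<close> stays in the hull, so some exponent has
  \<open>a \<bullet> x \<ge> p \<bullet> x + \<epsilon> * norm x\<close>, and its term alone bounds
  \<open>Z x\<close> from below.\<close>

lemma pot_coercive:
  assumes p: "p \<in> interior (convex hull A)"
  obtains L \<epsilon> where "\<epsilon> > 0" "\<And>x. pot x - p \<bullet> x \<ge> L + \<epsilon> * norm x"
proof -
  obtain \<epsilon> where \<epsilon>: "\<epsilon> > 0" "cball p \<epsilon> \<subseteq> convex hull A"
    using p by (auto simp: mem_interior_cball)
  define L where "L = Min ((\<lambda>a. ln (\<alpha> a)) ` A)"
  have "pot x - p \<bullet> x \<ge> L + \<epsilon> * norm x" for x
  proof -
    \<comment> \<open>For \<open>x = 0\<close> the quotient is 0 and \<open>q = p\<close>.\<close>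
    define q where "q = p + (\<epsilon> / norm x) *\<^sub>R x"
    have "q \<in> cball p \<epsilon>" using \<epsilon>(1) by (cases "x = 0") (auto simp: q_def dist_norm)
    then have q: "q \<in> convex hull A" using \<epsilon>(2) by blast
    have qx: "q \<bullet> x = p \<bullet> x + \<epsilon> * norm x"
      by (cases "x = 0") (auto simp: q_def inner_add_left dot_square_norm power2_eq_square)
    have "\<exists>a\<in>A. a \<bullet> x \<ge> q \<bullet> x"
    proof (rule ccontr)
      assume "\<not> ?thesis"
      then have "A \<subseteq> {y. x \<bullet> y < q \<bullet> x}" by (auto simp: inner_commute)
      then have "convex hull A \<subseteq> {y. x \<bullet> y < q \<bullet> x}"
        by (rule hull_minimal) (rule convex_halfspace_lt)
      then show False using q by (auto simp: inner_commute)
    qed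
    then obtain a where a: "a \<in> A" "a \<bullet> x \<ge> q \<bullet> x" by blast
    have "(\<alpha> a * exp (a \<bullet> x))\<^sup>2 \<le> Z x"
      unfolding Z_def using a(1) finite_A by (intro member_le_sum) auto
    moreover have ax: "\<alpha> a * exp (a \<bullet> x) > 0" using pos[OF a(1)] by simp
    ultimately have "ln ((\<alpha> a * exp (a \<bullet> x))\<^sup>2) \<le> ln (Z x)"
      using Z_pos[of x] by (subst ln_le_cancel_iff) auto
    then have "2 * (ln (\<alpha> a) + a \<bullet> x) \<le> ln (Z x)"
      using pos[OF a(1)] by (simp add: ln_realpow ln_mult)
    moreover have "L \<le> ln (\<alpha> a)" unfolding L_def using a(1) finite_A by (intro Min_le) auto
    ultimately show ?thesis using a(2) qx by (simp add: pot_def)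
  qed
  with \<epsilon>(1) show thesis by (rule that)
qed

text \<open>Coercivity gives a global minimiser. Its critical point equation yields surjectivity of
  the gradient, and its minimality identifies the supremum in the Legendre transform.\<close>

lemma pot_minimiser:
  assumes p: "p \<in> interior (convex hull A)"
  obtains x where "mean x = p" "\<And>y. pot x - p \<bullet> x \<le> pot y - p \<bullet> y"
proof -
  obtain L \<epsilon> where L: "\<epsilon> > 0" "\<And>x. pot x - p \<bullet> x \<ge> L + \<epsilon> * norm x"
    using pot_coercive[OF p] by blast
  define f where "f x = pot x - p \<bullet> x" for x
  have der: "(f has_derivative (\<lambda>h. mean x \<bullet> h - p \<bullet> h)) (at x)" for x
    unfolding f_def[abs_def] by (auto intro!: derivative_eq_intros has_derivative_pot)
  then have cont: "continuous_on S f" for S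
    by (meson continuous_at_imp_continuous_on has_derivative_continuous)
  \<comment> \<open>Beyond this radius \<open>f\<close> exceeds \<open>f 0\<close>; the 0 in the
    maximum keeps the origin in the ball.\<close>
  define R where "R = max 0 ((f 0 - L) / \<epsilon>)"
  obtain x where x: "x \<in> cball 0 R" "\<And>y. y \<in> cball 0 R \<Longrightarrow> f x \<le> f y"
    using continuous_attains_inf[OF compact_cball _ cont, of 0 R] by (auto simp: R_def)
  have glob: "f x \<le> f y" for y
  proof (cases "y \<in> cball 0 R")
    case False
    then have "norm y > (f 0 - L) / \<epsilon>" by (simp add: R_def)
    then have "f 0 < L + \<epsilon> * norm y" using L(1) by (simp add: field_simps)
    also have "\<dots> \<le> f y" unfolding f_def by (rule L(2))
    finally show ?thesis using x(2)[of 0] by (simp add: R_def)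
  qed (rule x(2))
  have "(\<lambda>h. mean x \<bullet> h - p \<bullet> h) = (\<lambda>h. 0)"
    by (rule has_derivative_local_min[OF der]) (simp add: glob)
  then have "(mean x - p) \<bullet> h = 0" for h by (metis inner_diff_left)
  then have "mean x = p" by (metis inner_eq_zero_iff right_minus_eq)
  then show thesis using glob by (intro that[of x]) (auto simp: f_def)
qed

section \<open>The inverse gradient and the Hessian of the Legendre transform\<close>

definition inv_mean :: "real^'m \<Rightarrow> real^'m" where
  "inv_mean = inv mean"

lemma inv_mean_mean [simp]: "inv_mean (mean x) = x"
  by (simp add: inv_mean_def inj_mean)

lemma mean_inv_mean: "p \<in> interior (convex hull A) \<Longrightarrow> mean (inv_mean p) = p"
  by (metis inv_mean_mean pot_minimiser)

lemma legendre_pot: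
  assumes p: "p \<in> interior (convex hull A)"
  shows "legendre pot p = p \<bullet> inv_mean p - pot (inv_mean p)"
proof -
  obtain x where x: "mean x = p" "\<And>y. pot x - p \<bullet> x \<le> pot y - p \<bullet> y"
    using pot_minimiser[OF p] by blast
  have "legendre pot p = p \<bullet> x - pot x"
    unfolding legendre_def
  proof (rule cSup_eq_maximum)
    fix z assume "z \<in> range (\<lambda>x. p \<bullet> x - pot x)"
    then obtain y where "z = p \<bullet> y - pot y" by auto
    then show "z \<le> p \<bullet> x - pot x" using x(2)[of y] by simp
  qed auto
  then show ?thesis using x(1) by auto
qed

lemma det_hessian_pot: "det (2 *\<^sub>R cov x) = 2 ^ CARD('m) * det (cov x)"
  by (rule det_scaleR)

lemma has_derivative_inv_mean:
  assumes B: "(2 *\<^sub>R cov x) ** B = mat 1"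
  shows "(inv_mean has_derivative (\<lambda>h. B *v h)) (at (mean x))"
proof (rule has_derivative_inverse_strong[of UNIV x mean])
  show "continuous_on UNIV mean"
    using has_derivative_mean by (meson continuous_at_imp_continuous_on has_derivative_continuous)
  show "(\<lambda>h. (2 *\<^sub>R cov x) *v h) \<circ> (\<lambda>h. B *v h) = id"
    by (simp add: fun_eq_iff matrix_vector_mul_assoc B)
qed (auto intro: has_derivative_mean)

lemma right_inverse_cov:
  obtains B where "(2 *\<^sub>R cov x) ** B = mat 1" "det B = inverse (2 ^ CARD('m) * det (cov x))"
proof -
  have "det (2 *\<^sub>R cov x) \<noteq> 0" using det_cov_pos[of x] by (simp add: det_hessian_pot)
  then obtain B where B: "(2 *\<^sub>R cov x) ** B = mat 1"
    by (auto simp: invertible_det_nz[symmetric] invertible_def)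
  have "det (2 *\<^sub>R cov x) * det B = 1" using arg_cong[OF B, of det] by (simp only: det_mul det_I)
  then have "det B = inverse (2 ^ CARD('m) * det (cov x))"
    unfolding det_hessian_pot by (rule inverse_unique[symmetric])
  with B show thesis by (rule that)
qed

text \<open>In the derivative of \<open>q \<bullet> inv_mean q - pot (inv_mean q)\<close> the terms
  through \<open>inv_mean\<close> cancel because \<open>mean (inv_mean p) = p\<close>.\<close>

lemma has_derivative_legendre:
  assumes p: "p \<in> interior (convex hull A)"
  shows "(legendre pot has_derivative (\<lambda>h. inv_mean p \<bullet> h)) (at p)"
proof -
  define x where "x = inv_mean p"
  have x: "mean x = p" unfolding x_def by (rule mean_inv_mean[OF p])
  obtain B where B: "(2 *\<^sub>R cov x) ** B = mat 1" by (rule right_inverse_cov)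
  have X: "(inv_mean has_derivative (\<lambda>h. B *v h)) (at p)"
    using has_derivative_inv_mean[OF B] by (simp add: x)
  have "((\<lambda>q. pot (inv_mean q)) has_derivative (\<lambda>h. mean x \<bullet> (B *v h))) (at p)"
    using has_derivative_compose[OF X has_derivative_pot] by (simp add: x_def)
  then have "((\<lambda>q. q \<bullet> inv_mean q - pot (inv_mean q)) has_derivative
      (\<lambda>h. (p \<bullet> (B *v h) + h \<bullet> inv_mean p) - mean x \<bullet> (B *v h))) (at p)"
    by (intro has_derivative_diff has_derivative_inner has_derivative_ident X)
  then have "((\<lambda>q. q \<bullet> inv_mean q - pot (inv_mean q)) has_derivative (\<lambda>h. inv_mean p \<bullet> h)) (at p)"
    by (simp add: x inner_commute)
  then show ?thesis
    by (rule has_derivative_transform_within_open[OF _ open_interior p]) (simp add: legendre_pot)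
qed

lemma det_hessian_legendre:
  assumes p: "p \<in> interior (convex hull A)"
  shows "det (hessian (legendre pot) p) = inverse (2 ^ CARD('m) * det (cov (inv_mean p)))"
proof -
  define x where "x = inv_mean p"
  have x: "mean x = p" unfolding x_def by (rule mean_inv_mean[OF p])
  obtain B where B: "(2 *\<^sub>R cov x) ** B = mat 1" and detB: "det B = inverse (2 ^ CARD('m) * det (cov x))"
    by (rule right_inverse_cov)
  have X: "(inv_mean has_derivative (\<lambda>h. B *v h)) (at p)"
    using has_derivative_inv_mean[OF B] by (simp add: x)
  have fd: "frechet_derivative (legendre pot) (at q) = (\<lambda>h. inv_mean q \<bullet> h)"
    if "q \<in> interior (convex hull A)" for q
    using frechet_derivative_at[OF has_derivative_legendre[OF that]] by simp
  have "((\<lambda>q. frechet_derivative (legendre pot) (at q) (axis j 1)) has_derivative (\<lambda>h. (B *v h) $ j)) (at p)" for j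
  \<comment> \<open>The formula \<open>fd\<close> is available in the interior only, which is
    open.\<close>
  proof (rule has_derivative_transform_within_open[OF _ open_interior p])
    show "((\<lambda>q. inv_mean q $ j) has_derivative (\<lambda>h. (B *v h) $ j)) (at p)"
      by (rule bounded_linear.has_derivative[OF bounded_linear_vec_nth X])
    show "inv_mean q $ j = frechet_derivative (legendre pot) (at q) (axis j 1)"
      if "q \<in> interior (convex hull A)" for q
      by (simp add: fd[OF that] inner_axis)
  qed
  then have "frechet_derivative (\<lambda>q. frechet_derivative (legendre pot) (at q) (axis j 1)) (at p) = (\<lambda>h. (B *v h) $ j)" for j
    by (metis frechet_derivative_at)
  then have "hessian (legendre pot) p = (\<chi> i j. (B *v axis i 1) $ j)"
    by (simp add: hessian_def)
  \<comment> \<open>In \<open>hessian\<close> the column index belongs to the inner derivative,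
    hence the transpose; the determinant does not see it.\<close>
  also have "\<dots> = transpose B"
    by (simp add: vec_eq_iff transpose_def matrix_vector_mult_basis column_def)
  finally show ?thesis by (simp add: det_transpose detB x_def)
qed

text \<open>The area formula for \<open>mean\<close>, whose fibres have one point over the interior
  and none elsewhere: the Jacobian \<open>d\<close> times the volume density
  \<open>sqrt (inverse d)\<close> is \<open>sqrt d\<close>.\<close>

theorem riemannian_volume_legendre:
  "riemannian_volume (hessian (legendre pot)) (interior (convex hull A)) =
   (\<integral>\<^sup>+x. ennreal (sqrt (2 ^ CARD('m) * det (cov x))) \<partial>lborel)"
proof -
  let ?P = "interior (convex hull A)"
  define H where "H p = sqrt (inverse (2 ^ CARD('m) * det (cov (inv_mean p))))" for p
  \<comment> \<open>Extension by zero yields a Borel function on the whole space from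
    \<open>H\<close>, which is shown continuous on the open set \<open>?P\<close> only.\<close>
  define \<phi> where "\<phi> p = ennreal (indicator ?P p *\<^sub>R H p)" for p
  have "continuous_on ?P inv_mean"
  proof (rule continuous_at_imp_continuous_on, rule)
    fix p assume p: "p \<in> ?P"
    obtain B where B: "(2 *\<^sub>R cov (inv_mean p)) ** B = mat 1" by (rule right_inverse_cov)
    show "isCont inv_mean p"
      using has_derivative_inv_mean[OF B] unfolding mean_inv_mean[OF p] by (rule has_derivative_continuous)
  qed
  then have "continuous_on ?P (\<lambda>p. det (cov (inv_mean p)))"
    by (intro continuous_on_det continuous_on_compose2[OF continuous_on_cov]) auto
  then have "continuous_on ?P H"
    unfolding H_def using det_cov_pos by (intro continuous_intros) (metis less_irrefl mult_eq_0_iff power_not_zero zero_neq_numeral)+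
  then have [measurable]: "\<phi> \<in> borel_measurable borel"
    unfolding \<phi>_def by (intro measurable_compose[OF _ measurable_ennreal] borel_measurable_continuous_on_indicator) auto
  have cnt: "num_elems {x. mean x = p} = indicator ?P p" for p
  proof (cases "p \<in> ?P")
    case True
    then have "{x. mean x = p} = {inv_mean p}" by (auto simp: mean_inv_mean)
    then show ?thesis using True by simp
  next
    case False
    then have "{x. mean x = p} = {}" using mean_in_interior by auto
    then show ?thesis using False by (simp only: emeasure_empty) simp
  qed
  have "riemannian_volume (hessian (legendre pot)) ?P = (\<integral>\<^sup>+p. num_elems {x. mean x = p} * \<phi> p \<partial>lborel)"
    unfolding riemannian_volume_def cnt
    by (intro nn_integral_cong) (auto simp: det_hessian_legendre \<phi>_def H_def split: split_indicator)
  also have "\<dots> = (\<integral>\<^sup>+x. ennreal \<bar>det (2 *\<^sub>R cov x)\<bar> * \<phi> (mean x) \<partial>lborel)"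
    by (rule area_formula[OF has_derivative_mean]) (auto intro!: continuous_intros continuous_on_cov)
  also have "\<dots> = (\<integral>\<^sup>+x. ennreal (sqrt (2 ^ CARD('m) * det (cov x))) \<partial>lborel)"
  proof (rule nn_integral_cong)
    fix x
    define d where "d = 2 ^ CARD('m) * det (cov x)"
    have d: "d > 0" using det_cov_pos[of x] by (simp add: d_def)
    have "d * sqrt (inverse d) = sqrt d"
      using d by (simp add: real_sqrt_inverse real_div_sqrt flip: divide_inverse)
    then show "ennreal \<bar>det (2 *\<^sub>R cov x)\<bar> * \<phi> (mean x) = ennreal (sqrt (2 ^ CARD('m) * det (cov x)))"
      using d mean_in_interior[of x] unfolding det_hessian_pot d_def[symmetric] \<phi>_def H_def inv_mean_mean
      by (simp add: ennreal_mult[symmetric])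
  qed
  finally show ?thesis .
qed

end

subsection \<open>The expected number of zeros\<close>

text \<open>Variances of independent normal variables add up, and the second moment of a centred
  variable is its variance.\<close>

lemma (in prob_space) expectation_square_gaussian_sum:
  assumes fin: "finite A" "A \<noteq> {}" and ind: "indep_vars (\<lambda>_. borel) \<xi> A"
    and dist: "\<And>a. a \<in> A \<Longrightarrow> distributed M lborel (\<xi> a) std_normal_density"
    and c: "\<And>a. a \<in> A \<Longrightarrow> c a > (0::real)"
  shows "expectation (\<lambda>\<omega>. (\<Sum>a\<in>A. \<xi> a \<omega> * c a)\<^sup>2) = (\<Sum>a\<in>A. (c a)\<^sup>2)"
proof -
  define \<sigma> where "\<sigma> = sqrt (\<Sum>a\<in>A. (c a)\<^sup>2)"
  have \<sigma>: "\<sigma> > 0" unfolding \<sigma>_def using fin c by (auto intro!: sum_pos zero_less_power)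
  have "indep_vars (\<lambda>_. borel) (\<lambda>a \<omega>. c a * \<xi> a \<omega>) A"
    by (rule indep_vars_compose2[OF ind]) simp
  moreover have "distributed M lborel (\<lambda>\<omega>. c a * \<xi> a \<omega>) (normal_density 0 (c a))" if "a \<in> A" for a
    using normal_density_affine[OF dist[OF that], of "c a" 0] c[OF that] by simp
  ultimately have "distributed M lborel (\<lambda>\<omega>. \<Sum>a\<in>A. c a * \<xi> a \<omega>) (normal_density (\<Sum>a\<in>A. 0) \<sigma>)"
    unfolding \<sigma>_def using fin c by (intro sum_indep_normal) auto
  then have D: "distributed M lborel (\<lambda>\<omega>. \<Sum>a\<in>A. \<xi> a \<omega> * c a) (normal_density 0 \<sigma>)"
    by (simp add: mult.commute)
  have "expectation (\<lambda>\<omega>. \<Sum>a\<in>A. \<xi> a \<omega> * c a) = 0"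
    by (rule normal_distributed_expectation[OF \<sigma> D])
  with normal_distributed_variance[OF \<sigma> D] show ?thesis
    using fin by (simp add: \<sigma>_def sum_nonneg)
qed

text \<open>The ambient type has dimension \<open>CARD('m) + 1\<close>; the functional equation of
  \<open>Gamma\<close> absorbs the dimension factor.\<close>

lemma hypersurface_volume_sphere_prod:
  "hypersurface_volume (sphere (0 :: (real^'m) \<times> real) 1) =
   2 * pi powr ((real CARD('m) + 1) / 2) / Gamma ((real CARD('m) + 1) / 2)"
proof -
  define n where "n = real CARD('m) + 1"
  have n: "n > 0" by (simp add: n_def add_nonneg_pos)
  have G: "Gamma (n / 2 + 1) = n / 2 * Gamma (n / 2)"
    using n Gamma_plus1[of "n / 2"] by (auto simp: nonpos_Ints_def)
  have "Gamma (n / 2) > 0" using n by (intro Gamma_real_pos) simp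
  then have "n * unit_ball_vol n = 2 * pi powr (n / 2) / Gamma (n / 2)"
    unfolding unit_ball_vol_def G using n by simp
  then show ?thesis
    by (simp add: hypersurface_volume_unit_sphere n_def add.commute)
qed

theorem theorem1:
  fixes A :: "(real ^ 'm) set"
    and \<alpha> :: "real ^ 'm \<Rightarrow> real"
    and M :: "'w measure"
    and \<xi> :: "real ^ 'm \<Rightarrow> 'w \<Rightarrow> real"
    and E :: "'w \<Rightarrow> real ^ 'm \<Rightarrow> real"
    and \<Phi> :: "real ^ 'm \<Rightarrow> real"
  assumes "finite A"
    and "aff_dim (convex hull A) = int CARD('m)"
    and "\<And>a. a \<in> A \<Longrightarrow> \<alpha> a > 0"
    and "prob_space M"
    and "prob_space.indep_vars M (\<lambda>_. borel) \<xi> A"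
    and "\<And>a. a \<in> A \<Longrightarrow> distributed M lborel (\<xi> a) std_normal_density"
    and "E = (\<lambda>\<omega> x. \<Sum>a\<in>A. \<xi> a \<omega> * \<alpha> a * exp (a \<bullet> x))"
    and "\<Phi> = (\<lambda>x. 1 / 2 * ln (prob_space.expectation M (\<lambda>\<omega>. (E \<omega> x)\<^sup>2)))"
  shows "expected_zeros M E UNIV =
    ennreal (1 / (2 powr ((real CARD('m) - 2) / 2)
                  * hypersurface_volume (sphere (0 :: (real ^ 'm) \<times> real) 1)))
    * riemannian_volume (hessian (legendre \<Phi>)) (interior (convex hull A))"
proof -
  interpret prob_space M by (rule assms(4))
  have "aff_dim A = int (DIM(real^'m))" using assms(2) by (simp add: aff_dim_convex_hull)
  then have full: "affine hull A = UNIV" by (simp only: aff_dim_eq_full)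
  interpret exp_family A \<alpha> by standard (use assms(1,3) full in auto)
  have E: "E \<omega> x = (\<Sum>a\<in>A. \<xi> a \<omega> * \<alpha> a * exp (a \<bullet> x))" for \<omega> x
    by (simp add: assms(7))
  have "expectation (\<lambda>\<omega>. (E \<omega> x)\<^sup>2) = Z x" for x
    unfolding E Z_def mult.assoc
    by (rule expectation_square_gaussian_sum[OF assms(1) A_nonempty assms(5,6)]) (use assms(3) in auto)
  then have \<Phi>: "\<Phi> = pot" by (simp add: assms(8) pot_def fun_eq_iff)

  let ?\<nu> = "gauss_PiM A"
  interpret \<nu>: prob_space ?\<nu> by (intro prob_space_PiM prob_space_std_gauss)
  define T where "T \<omega> = (\<lambda>a\<in>A. \<xi> a \<omega>)" for \<omega>
  have \<xi>m: "\<xi> a \<in> borel_measurable M" if "a \<in> A" for a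
    using assms(5) that by (auto simp: indep_vars_def)
  have sets: "sets ?\<nu> = sets (Pi\<^sub>M A (\<lambda>_. borel :: real measure))"
    by (rule sets_PiM_cong) auto
  have Tm: "T \<in> M \<rightarrow>\<^sub>M ?\<nu>"
    unfolding T_def measurable_cong_sets[OF refl sets] by (intro measurable_restrict \<xi>m)
  \<comment> \<open>Independence makes the joint law of the coefficients a product measure, so
    \<open>M\<close> can be replaced by the canonical Gaussian space.\<close>
  have dT: "distr M ?\<nu> T = ?\<nu>"
  proof -
    have "distr M ?\<nu> T = distr M (Pi\<^sub>M A (\<lambda>_. borel)) T"
      by (rule distr_cong) (auto simp: sets)
    also have "\<dots> = Pi\<^sub>M A (\<lambda>a. distr M borel (\<xi> a))"
      using indep_vars_iff_distr_eq_PiM'[OF A_nonempty, where X = \<xi> and M' = "\<lambda>_. borel"] \<xi>m assms(5)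
      by (simp add: T_def[abs_def])
    also have "\<dots> = ?\<nu>"
    proof (rule PiM_cong)
      fix a assume "a \<in> A"
      then have "distr M lborel (\<xi> a) = std_gauss" using assms(6) by (simp add: distributed_def)
      moreover have "distr M lborel (\<xi> a) = distr M borel (\<xi> a)" by (rule distr_cong) auto
      ultimately show "distr M borel (\<xi> a) = std_gauss" by simp
    qed simp
    finally show ?thesis .
  qed
  define N where "N \<omega> = num_elems {x. \<forall>i. (\<Sum>a\<in>A. \<omega> i a * \<alpha> a * exp (a \<bullet> x)) = 0}"
    for \<omega> :: "'m \<Rightarrow> real^'m \<Rightarrow> real"
  have "expected_zeros M E UNIV = (\<integral>\<^sup>+\<omega>. (\<Prod>i\<in>(UNIV :: 'm set). 1) * N (\<lambda>i\<in>UNIV. T (\<omega> i)) \<partial>Pi\<^sub>M UNIV (\<lambda>_::'m. M))"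
    unfolding expected_zeros_def N_def by (intro nn_integral_cong) (simp add: E T_def)
  also have "\<dots> = (\<integral>\<^sup>+\<omega>. (\<Prod>i\<in>(UNIV :: 'm set). 1) * N \<omega> \<partial>Pi\<^sub>M UNIV (\<lambda>_::'m. ?\<nu>))"
  proof (rule nn_integral_PiM_transfer[where T = "\<lambda>_. T" and h = "\<lambda>_ _. 1" and p = "\<lambda>_ _. 1"])
    fix f :: "(real^'m \<Rightarrow> real) \<Rightarrow> ennreal" assume f: "f \<in> borel_measurable ?\<nu>"
    have "(\<integral>\<^sup>+z. f (T z) \<partial>M) = (\<integral>\<^sup>+r. f r \<partial>distr M ?\<nu> T)"
      by (rule nn_integral_distr[symmetric, OF Tm]) (simp add: f)
    then show "(\<integral>\<^sup>+z. 1 * f (T z) \<partial>M) = (\<integral>\<^sup>+r. 1 * f r \<partial>?\<nu>)" by (simp add: dT)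
  next
    show "N \<in> borel_measurable (Pi\<^sub>M UNIV (\<lambda>_::'m. ?\<nu>))"
      unfolding N_def by (rule measurable_zero_count)
  qed (auto intro: Tm sigma_finite_measure_axioms \<nu>.sigma_finite_measure_axioms)
  also have "\<dots> = (\<integral>\<^sup>+x. ennreal (rice_const * sqrt (det (cov x))) \<partial>lborel)"
    using kac_rice by (simp add: N_def)
  finally have zeros: "expected_zeros M E UNIV = (\<integral>\<^sup>+x. ennreal (rice_const * sqrt (det (cov x))) \<partial>lborel)" .

  define k where "k = 1 / (2 powr ((real CARD('m) - 2) / 2) * hypersurface_volume (sphere (0 :: (real^'m) \<times> real) 1))"
  \<comment> \<open>The sphere volume gives 2 / s_m for \<open>rice_const\<close>; the 2 in its
    numerator lowers the exponent of 2 from m/2 to (m-2)/2.\<close>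
  have k: "rice_const = k * sqrt (2 ^ CARD('m))"
  proof -
    have "k = rice_const / (2 * 2 powr ((real CARD('m) - 2) / 2))"
      by (simp add: k_def hypersurface_volume_sphere_prod rice_const_def)
    also have "2 * 2 powr ((real CARD('m) - 2) / 2) = 2 powr (real CARD('m) / 2)"
      by (simp add: diff_divide_distrib powr_diff)
    also have "\<dots> = sqrt (2 ^ CARD('m))"
      by (simp add: powr_half_sqrt[symmetric] powr_realpow[symmetric] powr_powr)
    finally show ?thesis by simp
  qed
  have "k * sqrt (2 ^ CARD('m)) > 0" using rice_const_pos by (simp only: k)
  then have "k \<ge> 0" by (simp add: zero_less_mult_iff)
  have "(\<integral>\<^sup>+x. ennreal (rice_const * sqrt (det (cov x))) \<partial>lborel) =
      (\<integral>\<^sup>+x. ennreal k * ennreal (sqrt (2 ^ CARD('m) * det (cov x))) \<partial>lborel)"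
    using \<open>k \<ge> 0\<close> by (intro nn_integral_cong) (simp add: k ennreal_mult'[symmetric] real_sqrt_mult mult.assoc)
  also have "\<dots> = ennreal k * (\<integral>\<^sup>+x. ennreal (sqrt (2 ^ CARD('m) * det (cov x))) \<partial>lborel)"
  proof (rule nn_integral_cmult)
    have [measurable]: "(\<lambda>x. det (cov x)) \<in> borel_measurable borel"
      by (intro borel_measurable_continuous_onI continuous_on_det continuous_on_cov)
    show "(\<lambda>x. ennreal (sqrt (2 ^ CARD('m) * det (cov x)))) \<in> borel_measurable lborel" by measurable
  qed
  finally show ?thesis
    unfolding \<Phi> riemannian_volume_legendre zeros k_def .
qed

end
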